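(* Let $W_0:\mathbb{R}\to\mathbb{R}$ be the viscous shock $W_0(x)=1-e^{-x}$ for $x>0$ and $W_0(x)=-(1-e^{x})$ for $x<0$ (i.e. $W_0(x)=\mathrm{sign}(x)(1-e^{-|x|})$). For every $\epsilon>0$ there is $\delta>0$ such that every odd function $w_0$ satisfying $\|w_0-W_0\|_{H^2(\mathbb{R})}<\delta$ generates a unique odd solution $w(t,x)$ of the modular Burgers equation $$\partial_t w=\partial_x |w|+\partial_x^2 w$$ with $w(0,x)=w_0(x)$, satisfying $$\|w(t,\cdot)-W_0\|_{H^2(\mathbb{R})}<\epsilon \quad\text{for all } t>0$$ and $$\|w(t,\cdot)-W_0\|_{W^{2,\infty}(\mathbb{R})}\to 0 \quad\text{as } t\to+\infty.$$ The solution belongs to the class of functions with $w-W_0\in C(\mathbb{R}_+,H^2(\mathbb{R}))$.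
   Context: $H^k(\mathbb{R})$ and $W^{k,\infty}(\mathbb{R})$ denote the standard Sobolev spaces. For odd solutions the modular Burgers equation is understood as follows: $w(t,\cdot)$ is odd in $x$, and its restriction to $x>0$ solves the boundary-value problem $w_t=w_x+w_{xx}$ for $x>0$, $w(t,0)=0$, $w(t,x)\to 1$ as $x\to+\infty$, subject to the positivity condition $w(t,x)>0$ for $x>0$; classical solutions satisfy $w_x(t,0^+)+w_{xx}(t,0^+)=0$, and the odd extension to $\mathbb{R}$ is piecewise $C^2$ with the interface condition $w_{xx}(t,0^+)-w_{xx}(t,0^-)=-2w_x(t,0)$. *)

theory Defs
  imports "HOL-Analysis.Analysis" "HOL-Probability.Essential_Supremum"
begin

definition W0 :: "real \<Rightarrow> real" where
  "W0 x = sgn x * (1 - exp (- \<bar>x\<bar>))"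

definition weak_d2 :: "(real \<Rightarrow> real) \<Rightarrow> real \<Rightarrow> real" where
  "weak_d2 u = (SOME v. \<forall>a b. a \<le> b \<longrightarrow> (v has_integral (deriv u b - deriv u a)) {a..b})"

text \<open>Membership in H^2(R), for the continuous (C^1) representative u.\<close>
definition H2 :: "(real \<Rightarrow> real) \<Rightarrow> bool" where
  "H2 u \<longleftrightarrow> (\<forall>x. u differentiable (at x))
     \<and> (\<exists>v. \<forall>a b. a \<le> b \<longrightarrow> (v has_integral (deriv u b - deriv u a)) {a..b})
     \<and> integrable lebesgue (\<lambda>x. (u x)\<^sup>2)
     \<and> integrable lebesgue (\<lambda>x. (deriv u x)\<^sup>2)
     \<and> integrable lebesgue (\<lambda>x. (weak_d2 u x)\<^sup>2)"

definition H2_norm :: "(real \<Rightarrow> real) \<Rightarrow> real" where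
  "H2_norm u = sqrt ((LINT x|lebesgue. (u x)\<^sup>2) + (LINT x|lebesgue. (deriv u x)\<^sup>2)
                     + (LINT x|lebesgue. (weak_d2 u x)\<^sup>2))"

definition W2inf_norm :: "(real \<Rightarrow> real) \<Rightarrow> ereal" where
  "W2inf_norm u = esssup lebesgue (\<lambda>x. ereal \<bar>u x\<bar>) + esssup lebesgue (\<lambda>x. ereal \<bar>deriv u x\<bar>)
                  + esssup lebesgue (\<lambda>x. ereal \<bar>weak_d2 u x\<bar>)"

text \<open>Odd (classical) solution of the modular Burgers equation w_t = (|w|)_x + w_xx
  with initial datum w0, in the sense of the paper: w(t,.) odd; on x>0 it solves
  w_t = w_x + w_xx, w(t,0) = 0, w(t,x) -> 1 as x -> +inf, and w(t,x) > 0.\<close>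
definition odd_mburgers_sol :: "(real \<Rightarrow> real \<Rightarrow> real) \<Rightarrow> (real \<Rightarrow> real) \<Rightarrow> bool" where
  "odd_mburgers_sol w w0 \<longleftrightarrow>
     (\<forall>x. w 0 x = w0 x)
   \<and> (\<forall>t\<ge>0. \<forall>x. w t (- x) = - w t x)
   \<and> (\<forall>t>0. w t 0 = 0)
   \<and> (\<forall>t>0. \<forall>x>0. w t x > 0)
   \<and> (\<forall>t>0. ((\<lambda>x. w t x) \<longlongrightarrow> 1) at_top)
   \<and> (\<forall>t>0. \<forall>x>0. (\<lambda>y. w t y) differentiable (at x))
   \<and> (\<forall>t>0. \<forall>x>0. deriv (\<lambda>y. w t y) differentiable (at x))
   \<and> (\<forall>t>0. \<forall>x>0. ((\<lambda>s. w s x) has_real_derivative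
          (deriv (\<lambda>y. w t y) x + deriv (deriv (\<lambda>y. w t y)) x)) (at t))"

definition in_class :: "(real \<Rightarrow> real \<Rightarrow> real) \<Rightarrow> bool" where
  "in_class w \<longleftrightarrow> (\<forall>t\<ge>0. H2 (\<lambda>x. w t x - W0 x))
     \<and> (\<forall>t0\<ge>0. ((\<lambda>t. H2_norm (\<lambda>x. w t x - w t0 x)) \<longlongrightarrow> 0) (at t0 within {0..}))"

end

theory Submission
  imports Defs "HOL-Probability.Distributions" "HOL-Probability.Sinc_Integral"
begin

text \<open>
  Write \<open>w = W0 + u\<close>. On \<open>x > 0\<close> the perturbation solves the linear problem
  \<open>u\<^sub>t = u\<^sub>x + u\<^sub>x\<^sub>x\<close>, \<open>u(t,0) = 0\<close>. Extending the datum to \<open>y < 0\<close> by \<open>- exp (- y) * u0 (- y)\<close> turns it into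
  a convolution with the Gaussian of drift \<open>t\<close> and variance \<open>2 t\<close> on the whole line, and the extension
  and its first two derivatives evolve by the same convolution. For \<open>x > 0\<close> the kernel, measured
  against the exponential weight of the extension, is at most a Gaussian in \<open>x + t - \<bar>y\<bar>\<close>, so by
  Cauchy--Schwarz the flow is bounded in \<open>L\<^sup>2\<close> uniformly in time and maps \<open>L\<^sup>2\<close> to \<open>L\<^sup>\<infinity>\<close> with norm
  \<open>O(t powr (-1/4))\<close>. Applied to \<open>u\<close>, \<open>u\<^sub>x\<close> and \<open>u\<^sub>x\<^sub>x\<close> this gives stability in \<open>H\<^sup>2\<close> and decay in
  \<open>W\<^sup>2\<^sup>,\<^sup>\<infinity>\<close>; strong continuity follows from density of compactly supported continuous functions.
  The maximum principle on the half-line gives uniqueness and, by comparison with the stationary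
  solution \<open>W0\<close>, also \<open>\<bar>u\<bar> \<le> W0 / 2\<close>, hence positivity of \<open>w\<close>.
\<close>

section \<open>Maximum principle on the half-line\<close>

text \<open>The extension comes from the substitution \<open>u = exp (- x / 2 - t / 4) * v\<close>:
  \<open>v\<close> solves the heat equation with a Dirichlet condition and is reflected oddly;
  undoing the substitution produces the factor \<open>- exp (- y)\<close>. The price is exponential
  growth on the negative axis, hence the weight \<open>wt\<close> and estimates that are stated for
  \<open>0 \<le> x\<close> only. The delicate quantity is the second derivative. An odd perturbation
  in H2 need not satisfy \<open>u_x + u_xx = 0\<close> at the origin, so its extended second
  derivative may jump there, and it is determined only almost everywhere. Statements about it are
  therefore phrased through integrals over intervals (\<open>antiderivative\<close>), and
  derivatives are moved from the kernel to the datum by Fubini and by uniqueness of derivatives.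
  Positivity cannot follow from a small sup norm alone, since \<open>W0\<close> vanishes linearly at
  the origin; smallness in H2 also controls the slope of \<open>u\<close>, which gives the initial
  comparison with \<open>W0 / 2\<close>.\<close>

text \<open>If \<open>l\<close> were positive, \<open>g\<close> would be positive just to the right
  of \<open>x\<close>, and the mean value theorem would lift \<open>f\<close> above its maximal
  value.\<close>

lemma second_derivative_nonpos_at_max:
  fixes f g :: "real \<Rightarrow> real"
  assumes f: "\<And>y. y \<in> {x..<x + r} \<Longrightarrow> (f has_real_derivative g y) (at y)"
    and g: "(g has_real_derivative l) (at x)"
    and g0: "g x = 0" and r: "r > 0"
    and max: "\<And>y. y \<in> {x..<x + r} \<Longrightarrow> f y \<le> f x"
  shows "l \<le> 0"
proof (rule ccontr)
  assume "\<not> l \<le> 0"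
  then obtain d where d: "d > 0" "\<And>h. h > 0 \<Longrightarrow> h < d \<Longrightarrow> g x < g (x + h)"
    using DERIV_pos_inc_right[OF g] by auto
  define h where "h = min d r / 2"
  have h: "0 < h" "h < d" "h < r" using d(1) r by (auto simp: h_def min_def)
  obtain \<xi> where \<xi>: "x < \<xi>" "\<xi> < x + h" "f (x + h) - f x = (x + h - x) * g \<xi>"
    using MVT2[of x "x + h" f g] f h by auto
  have "g \<xi> > 0" using d(2)[of "\<xi> - x"] \<xi> h g0 by auto
  then have "h * g \<xi> > 0" using h by simp
  then have "f (x + h) > f x" using \<xi>(3) by simp
  then show False using max[of "x + h"] h by auto
qed

text \<open>The barrier \<open>\<eta> (x + 2 t)\<close> is a strict supersolution that dominates every bounded
  function at infinity.\<close>
lemma half_line_maximum_principle: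
  fixes z z1 z2 :: "real \<Rightarrow> real \<Rightarrow> real"
  assumes cont: "continuous_on ({0..T} \<times> {0..}) (\<lambda>(t, x). z t x)"
    and bdd: "\<And>t x. 0 \<le> t \<Longrightarrow> t \<le> T \<Longrightarrow> 0 \<le> x \<Longrightarrow> z t x \<le> M"
    and init: "\<And>x. 0 \<le> x \<Longrightarrow> z 0 x \<le> 0"
    and bdry: "\<And>t. 0 \<le> t \<Longrightarrow> t \<le> T \<Longrightarrow> z t 0 \<le> 0"
    and dx: "\<And>t x. 0 < t \<Longrightarrow> 0 < x \<Longrightarrow> (z t has_real_derivative z1 t x) (at x)"
    and dxx: "\<And>t x. 0 < t \<Longrightarrow> 0 < x \<Longrightarrow> (z1 t has_real_derivative z2 t x) (at x)"
    and dt: "\<And>t x. 0 < t \<Longrightarrow> 0 < x \<Longrightarrow> ((\<lambda>s. z s x) has_real_derivative (z1 t x + z2 t x)) (at t)"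
    and t: "0 \<le> t" "t \<le> T" and x: "0 \<le> x"
  shows "z t x \<le> 0"
proof (rule ccontr)
  assume "\<not> z t x \<le> 0"
  then have zpos: "z t x > 0" by simp
  \<comment> \<open>Makes the barrier at \<open>(t, x)\<close> smaller than \<open>z t x\<close>;
    the summand 1 keeps the denominator positive at the origin.\<close>
  define \<eta> where "\<eta> = z t x / (2 * (x + 2 * t + 1))"
  have \<eta>: "\<eta> > 0" using zpos t x unfolding \<eta>_def by (intro divide_pos_pos) auto
  have "z t x = \<eta> * (2 * (x + 2 * t + 1))" using t x by (simp add: \<eta>_def)
  also have "\<dots> > \<eta> * (x + 2 * t)" using \<eta> t x by (intro mult_strict_left_mono) auto
  finally have \<eta>2: "\<eta> * (x + 2 * t) < z t x" .
  \<comment> \<open>At \<open>x = R\<close> the barrier already exceeds the bound \<open>M\<close>,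
    so a positive maximum over the compact rectangle cannot sit on its right side.\<close>
  define R where "R = max x (M / \<eta> + 1)"
  have R: "x \<le> R" "M < \<eta> * R"
  proof -
    have "M < \<eta> * (M / \<eta> + 1)" using \<eta> by (simp add: field_simps)
    also have "\<dots> \<le> \<eta> * R" using \<eta> by (simp add: R_def)
    finally show "M < \<eta> * R" .
  qed (simp add: R_def)
  define \<zeta> where "\<zeta> = (\<lambda>p. z (fst p) (snd p) - \<eta> * (snd p + 2 * fst p))"
  have "continuous_on ({0..T} \<times> {0..R}) (\<lambda>p. z (fst p) (snd p))"
    by (rule continuous_on_subset[OF cont[unfolded case_prod_beta']]) auto
  then have "continuous_on ({0..T} \<times> {0..R}) \<zeta>"
    unfolding \<zeta>_def by (intro continuous_intros)
  moreover have "compact ({0..T} \<times> {0..R})" by (intro compact_Times) auto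
  moreover have "(t, x) \<in> {0..T} \<times> {0..R}" using t x R by auto
  ultimately obtain p where p: "p \<in> {0..T} \<times> {0..R}" "\<And>q. q \<in> {0..T} \<times> {0..R} \<Longrightarrow> \<zeta> q \<le> \<zeta> p"
    using continuous_attains_sup[of "{0..T} \<times> {0..R}" \<zeta>] by blast
  obtain s y where sy: "p = (s, y)" by fastforce
  have s: "0 \<le> s" "s \<le> T" and y: "0 \<le> y" "y \<le> R" using p sy by auto
  have "\<zeta> (t, x) > 0" using \<eta>2 by (simp add: \<zeta>_def)
  then have pos: "z s y > \<eta> * (y + 2 * s)"
    using p(2)[of "(t, x)"] \<open>(t, x) \<in> _\<close> by (auto simp: \<zeta>_def sy)
  have "\<eta> * (y + 2 * s) \<ge> 0" using \<eta> y s by simp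
  then have "z s y > 0" using pos by linarith
  then have s0: "s \<noteq> 0" and y0: "y \<noteq> 0" using init[OF y(1)] bdry[OF s] by auto
  have yR: "y \<noteq> R"
  proof
    assume "y = R"
    then have "\<eta> * R \<le> \<eta> * (y + 2 * s)" using \<eta> s by simp
    then show False using bdd[OF s y(1)] pos R by auto
  qed
  have s': "s > 0" and y': "y > 0" "y < R" using s0 y0 yR s y by auto
  have max_x: "z s y' - \<eta> * y' \<le> z s y - \<eta> * y" if "0 \<le> y'" "y' \<le> R" for y'
    using p(2)[of "(s, y')"] that s by (auto simp: \<zeta>_def sy algebra_simps)
  have max_t: "z s' y - 2 * \<eta> * s' \<le> z s y - 2 * \<eta> * s" if "0 \<le> s'" "s' \<le> T" for s'
    using p(2)[of "(s', y)"] that y by (auto simp: \<zeta>_def sy algebra_simps)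
  have Dx: "((\<lambda>y. z s y - \<eta> * y) has_real_derivative (z1 s y' - \<eta>)) (at y')" if "y' > 0" for y'
    using dx[OF s' that] by (auto intro!: derivative_eq_intros)
  have z1: "z1 s y - \<eta> = 0"
  proof (rule DERIV_local_max[OF Dx[OF y'(1)], of "min y (R - y)"])
    show "\<forall>y'. \<bar>y - y'\<bar> < min y (R - y) \<longrightarrow> z s y' - \<eta> * y' \<le> z s y - \<eta> * y"
      by (intro allI impI max_x) auto
  qed (use y' in auto)
  have z2: "z2 s y \<le> 0"
  proof (rule second_derivative_nonpos_at_max[where r = "R - y"])
    show "((\<lambda>y. z s y - \<eta> * y) has_real_derivative (z1 s y' - \<eta>)) (at y')" if "y' \<in> {y..<y + (R - y)}" for y'
      using Dx that y' by auto
    show "((\<lambda>y'. z1 s y' - \<eta>) has_real_derivative z2 s y) (at y)"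
      using dxx[OF s' y'(1)] by (auto intro!: derivative_eq_intros)
  qed (use z1 y' max_x in auto)
  have Dt: "((\<lambda>s. z s y - 2 * \<eta> * s) has_real_derivative (z1 s y + z2 s y - 2 * \<eta>)) (at s)"
    using dt[OF s' y'(1)] by (auto intro!: derivative_eq_intros)
  \<comment> \<open>At the maximum the drift contributes \<open>\<eta>\<close> and diffusion at most
    0, while the barrier rises at rate \<open>2 * \<eta>\<close>. Only earlier times are compared
    below, so \<open>s = T\<close> is covered.\<close>
  have "z1 s y + z2 s y - 2 * \<eta> < 0" using z1 z2 \<eta> by simp
  then obtain d where d: "d > 0" "\<And>h. h > 0 \<Longrightarrow> h < d \<Longrightarrow> z s y - 2 * \<eta> * s < z (s - h) y - 2 * \<eta> * (s - h)"
    using DERIV_neg_dec_left[OF Dt] by auto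
  define h where "h = min d s / 2"
  have h: "h > 0" "h < d" "h \<le> s" using d(1) s' by (auto simp: h_def min_def)
  then show False using d(2)[of h] max_t[of "s - h"] s by auto
qed

section \<open>Antiderivatives and differentiation under the integral\<close>

text \<open>The same integral condition as in \<open>H2\<close> and \<open>weak_d2\<close>. It
  tolerates an integrand that jumps or is known only almost everywhere, and still makes
  \<open>F\<close> continuous.\<close>

definition antiderivative :: "(real \<Rightarrow> real) \<Rightarrow> (real \<Rightarrow> real) \<Rightarrow> bool" where
  "antiderivative F f \<longleftrightarrow> (\<forall>a b. a \<le> b \<longrightarrow> (f has_integral (F b - F a)) {a..b})"

lemma antiderivativeD: "antiderivative F f \<Longrightarrow> a \<le> b \<Longrightarrow> (f has_integral (F b - F a)) {a..b}"
  by (simp add: antiderivative_def)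

text \<open>The difference of the integrands has integral zero over every interval, and by Lebesgue
  differentiation it is almost everywhere the limit of such averages.\<close>

lemma antiderivative_AE_unique:
  assumes f: "antiderivative F f" and g: "antiderivative F g"
  shows "AE x in lebesgue. f x = g x"
proof -
  define h where "h = (\<lambda>x. f x - g x)"
  have h0: "(h has_integral 0) {a..b}" for a b :: real
  proof (cases "a \<le> b")
    case True
    then show ?thesis
      using has_integral_diff[OF antiderivativeD[OF f True] antiderivativeD[OF g True]] by (simp add: h_def)
  qed (simp add: h_def)
  then have "\<And>a b. h integrable_on cbox a b" by (auto simp: integrable_on_def)
  from integrable_ccontinuous_explicit[OF this] obtain N where N: "negligible N"
    "\<And>x e. \<lbrakk>x \<notin> N; 0 < e\<rbrakk> \<Longrightarrow> \<exists>d>0. \<forall>k. 0 < k \<and> k < d \<longrightarrow>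
        norm (integral (cbox x (x + k *\<^sub>R One)) h /\<^sub>R k ^ DIM(real) - h x) < e"
    by metis
  have "h x = 0" if xN: "x \<notin> N" for x
  proof (rule ccontr)
    assume "h x \<noteq> 0"
    then obtain d where d: "d > 0" "\<forall>k. 0 < k \<and> k < d \<longrightarrow>
        norm (integral (cbox x (x + k *\<^sub>R One)) h /\<^sub>R k ^ DIM(real) - h x) < \<bar>h x\<bar>"
      using N(2)[OF xN, of "\<bar>h x\<bar>"] by auto
    then have "norm (integral (cbox x (x + (d/2) *\<^sub>R One)) h /\<^sub>R (d/2) ^ DIM(real) - h x) < \<bar>h x\<bar>"
      by (metis field_sum_of_halves half_gt_zero less_add_same_cancel1)
    moreover have "integral (cbox x (x + (d/2) *\<^sub>R One)) h = 0"
      using h0[of x "x + d/2"] by (simp add: integral_unique)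
    ultimately show False by simp
  qed
  moreover have "N \<in> null_sets lebesgue" using N(1) by (simp add: negligible_iff_null_sets)
  ultimately show ?thesis
    by (intro AE_I'[of N]) (auto simp: h_def)
qed

lemma antiderivative_measurable:
  assumes "antiderivative F f"
  shows "f \<in> borel_measurable lebesgue"
proof (rule borel_measurable_LIMSEQ_real)
  show "(\<lambda>x. f x * indicator {- real n..real n} x) \<in> borel_measurable lebesgue" for n
    using has_integral_implies_lebesgue_measurable_real[OF antiderivativeD[OF assms, of "- real n" "real n"]] by simp
  show "(\<lambda>n. f x * indicator {- real n..real n} x) \<longlonglongrightarrow> f x" for x
  proof (rule tendsto_eventually)
    obtain m where "\<bar>x\<bar> \<le> real m" using real_arch_simple by blast
    then have "\<And>n. n \<ge> m \<Longrightarrow> \<bar>x\<bar> \<le> real n" by (meson of_nat_mono order_trans)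
    then show "\<forall>\<^sub>F n in sequentially. f x * indicator {- real n..real n} x = f x"
      by (intro eventually_sequentiallyI[of m]) (force simp: indicator_def)
  qed
qed

lemma antiderivative_cong_AE:
  assumes "antiderivative F f" "AE x in lebesgue. f x = g x"
  shows "antiderivative F g"
proof -
  obtain N where "N \<in> null_sets lebesgue" "\<And>x. x \<notin> N \<Longrightarrow> f x = g x"
    using assms(2) by (auto elim!: AE_E3)
  then show ?thesis
    unfolding antiderivative_def
    by (intro allI impI has_integral_spike[OF _ _ antiderivativeD[OF assms(1)], of N])
       (auto simp: negligible_iff_null_sets)
qed

lemma antiderivative_diff:
  assumes "antiderivative F f" "antiderivative G g"
  shows "antiderivative (\<lambda>x. F x - G x) (\<lambda>x. f x - g x)"
proof -
  have "((\<lambda>x. f x - g x) has_integral ((F b - G b) - (F a - G a))) {a..b}" if "a \<le> b" for a b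
    using has_integral_diff[OF assms[THEN antiderivativeD, OF that]] by (simp add: algebra_simps)
  then show ?thesis by (simp add: antiderivative_def)
qed

lemma antiderivative_add:
  assumes "antiderivative F f" "antiderivative G g"
  shows "antiderivative (\<lambda>x. F x + G x) (\<lambda>x. f x + g x)"
proof -
  have "((\<lambda>x. f x + g x) has_integral ((F b + G b) - (F a + G a))) {a..b}" if "a \<le> b" for a b
    using has_integral_add[OF assms[THEN antiderivativeD, OF that]] by (simp add: algebra_simps)
  then show ?thesis by (simp add: antiderivative_def)
qed

lemma antiderivative_continuous:
  assumes "antiderivative F f"
  shows "continuous_on A F"
proof -
  have "isCont F x" for x
  proof -
    have int: "f integrable_on {x-1..x+1}"
      using antiderivativeD[OF assms, of "x-1" "x+1"] by (auto simp: integrable_on_def)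
    have "continuous_on {x-1..x+1} (\<lambda>y. integral {x-1..y} f + F (x-1))"
      by (intro continuous_intros indefinite_integral_continuous_1 int)
    moreover have "integral {x-1..y} f + F (x-1) = F y" if "y \<in> {x-1..x+1}" for y
      using integral_unique[OF antiderivativeD[OF assms, of "x-1" y]] that by auto
    ultimately have "continuous_on {x-1..x+1} F" by (metis (no_types, lifting) continuous_on_cong)
    then show ?thesis
      by (rule continuous_on_interior) auto
  qed
  then show ?thesis by (simp add: continuous_at_imp_continuous_on)
qed

lemma antiderivative_has_derivative:
  assumes F: "antiderivative F f" and f: "continuous_on UNIV f"
  shows "(F has_real_derivative f x) (at x)"
proof -
  have "((\<lambda>y. integral {x-1..y} f) has_vector_derivative f x) (at x within {x-1..x+1})"
    by (rule integral_has_vector_derivative) (auto intro: continuous_on_subset[OF f])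
  then have "((\<lambda>y. integral {x-1..y} f) has_vector_derivative f x) (at x)"
    by (subst (asm) at_within_interior) auto
  then have "((\<lambda>y. integral {x-1..y} f + F (x-1)) has_vector_derivative f x) (at x)"
    by (auto intro!: derivative_eq_intros)
  then have "(F has_vector_derivative f x) (at x)"
  proof (rule has_vector_derivative_transform_within_open[of _ _ _ "{x-1<..<x+1}"])
    show "integral {x-1..y} f + F (x-1) = F y" if "y \<in> {x-1<..<x+1}" for y
      using integral_unique[OF antiderivativeD[OF F, of "x-1" y]] that by auto
  qed auto
  then show ?thesis by (simp add: has_real_derivative_iff_has_vector_derivative)
qed

lemma antiderivative_of_derivative:
  assumes "\<And>x. (F has_real_derivative f x) (at x)"
  shows "antiderivative F f"
  unfolding antiderivative_def
  by (auto intro!: fundamental_theorem_of_calculus has_vector_derivative_at_within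
      assms[unfolded has_real_derivative_iff_has_vector_derivative])

text \<open>Dominated convergence along sequences of difference quotients; the mean value theorem
  bounds the quotients by \<open>B\<close>.\<close>

lemma has_real_derivative_integral_dominated:
  fixes f f' :: "real \<Rightarrow> 'a \<Rightarrow> real"
  assumes f: "\<And>s. a < s \<Longrightarrow> s < b \<Longrightarrow> integrable M (f s)"
    and f': "\<And>s y. a < s \<Longrightarrow> s < b \<Longrightarrow> ((\<lambda>s. f s y) has_real_derivative f' s y) (at s)"
    and bound: "\<And>s y. a < s \<Longrightarrow> s < b \<Longrightarrow> \<bar>f' s y\<bar> \<le> B y"
    and B: "integrable M B" and s: "a < s" "s < b"
  shows "((\<lambda>s. LINT y|M. f s y) has_real_derivative (LINT y|M. f' s y)) (at s)"
  unfolding has_field_derivative_iff tendsto_at_iff_sequentially comp_def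
proof (intro allI impI)
  fix X assume X: "\<forall>i. X i \<in> UNIV - {s}" "X \<longlonglongrightarrow> s"
  from order_tendstoD[OF X(2)] s have "eventually (\<lambda>n. a < X n \<and> X n < b) sequentially"
    by (auto simp: eventually_conj_iff)
  then obtain n0 where n0: "\<And>n. n \<ge> n0 \<Longrightarrow> a < X n \<and> X n < b" by (auto simp: eventually_sequentially)
  define Y where "Y n = X (n + n0)" for n
  have Y: "a < Y n" "Y n < b" "Y n \<noteq> s" for n using n0[of "n + n0"] X(1) by (auto simp: Y_def)
  have Ylim: "Y \<longlonglongrightarrow> s" unfolding Y_def by (rule LIMSEQ_ignore_initial_segment[OF X(2)])
  have lim: "(\<lambda>n. (f (Y n) y - f s y) / (Y n - s)) \<longlonglongrightarrow> f' s y" for y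
    using f'[OF s, of y, unfolded has_field_derivative_iff tendsto_at_iff_sequentially comp_def] Y Ylim by auto
  have fm: "f (Y n) \<in> borel_measurable M" for n using f[OF Y(1,2)] by auto
  have fms: "f s \<in> borel_measurable M" using f[OF s] by auto
  have L: "(\<lambda>n. LINT y|M. (f (Y n) y - f s y) / (Y n - s)) \<longlonglongrightarrow> (LINT y|M. f' s y)"
  proof (rule integral_dominated_convergence[where w = B])
    show "(\<lambda>y. f' s y) \<in> borel_measurable M"
      by (rule borel_measurable_LIMSEQ_real[OF lim]) (use fm fms in measurable)
    show "AE y in M. norm ((f (Y n) y - f s y) / (Y n - s)) \<le> B y" for n
    proof (rule AE_I2)
      fix y
      have "\<exists>\<xi>. a < \<xi> \<and> \<xi> < b \<and> f (Y n) y - f s y = (Y n - s) * f' \<xi> y"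
      proof (cases "Y n < s")
        case True
        then obtain \<xi> where "Y n < \<xi>" "\<xi> < s" "f s y - f (Y n) y = (s - Y n) * f' \<xi> y"
          using MVT2[of "Y n" s "\<lambda>s. f s y" "\<lambda>s. f' s y"] f' Y[of n] s by force
        then show ?thesis using Y[of n] s by (intro exI[of _ \<xi>]) (auto simp: algebra_simps)
      next
        case False
        then have "s < Y n" using Y(3)[of n] by simp
        then obtain \<xi> where "s < \<xi>" "\<xi> < Y n" "f (Y n) y - f s y = (Y n - s) * f' \<xi> y"
          using MVT2[of s "Y n" "\<lambda>s. f s y" "\<lambda>s. f' s y"] f' Y[of n] s by force
        then show ?thesis using Y[of n] s by (intro exI[of _ \<xi>]) auto
      qed
      then show "norm ((f (Y n) y - f s y) / (Y n - s)) \<le> B y" using bound Y(3)[of n] by (auto simp: abs_mult)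
    qed
    show "AE y in M. (\<lambda>n. (f (Y n) y - f s y) / (Y n - s)) \<longlonglongrightarrow> f' s y" using lim by simp
  qed (use fm fms B in measurable)
  have eq: "(LINT y|M. (f (Y n) y - f s y) / (Y n - s))
      = ((LINT y|M. f (Y n) y) - (LINT y|M. f s y)) / (Y n - s)" for n
    using f[OF Y(1,2)[of n]] f[OF s] by simp
  have "(\<lambda>n. ((LINT y|M. f (Y n) y) - (LINT y|M. f s y)) / (Y n - s)) \<longlonglongrightarrow> (LINT y|M. f' s y)"
    using L unfolding eq .
  then show "(\<lambda>n. ((LINT y|M. f (X n) y) - (LINT y|M. f s y)) / (X n - s)) \<longlonglongrightarrow> (LINT y|M. f' s y)"
    unfolding Y_def by (rule LIMSEQ_offset)
qed

section \<open>The drift-diffusion semigroup\<close>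

text \<open>The weight makes \<open>glue p (\<lambda>s. exp s * q s)\<close> square integrable whenever \<open>p\<close> and \<open>q\<close> are;
  \<open>wsq\<close> and, on the half-line, \<open>hsq\<close> below denote squared norms.\<close>
definition wt :: "real \<Rightarrow> real" where "wt y = min 1 (exp y)"

definition wL2 :: "(real \<Rightarrow> real) \<Rightarrow> bool" where
  "wL2 H \<longleftrightarrow> H \<in> borel_measurable borel \<and> integrable lborel (\<lambda>y. (wt y * H y)\<^sup>2)"

definition wsq :: "(real \<Rightarrow> real) \<Rightarrow> real" where
  "wsq H = (LINT y|lborel. (wt y * H y)\<^sup>2)"

text \<open>The semigroup of \<open>u\<^sub>t = u\<^sub>x + u\<^sub>x\<^sub>x\<close> on the whole line. Written with a standard normal variable
  instead of the kernel, it also makes sense (as the identity) at \<open>t = 0\<close>.\<close>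
definition drift_heat :: "real \<Rightarrow> (real \<Rightarrow> real) \<Rightarrow> real \<Rightarrow> real" where
  "drift_heat t H x = (LINT z|lborel. std_normal_density z * H (x + t + sqrt (2 * t) * z))"

text \<open>The Gaussian density with mean 0 and variance \<open>2 * t\<close>; \<open>kern1\<close>
  and \<open>kern2\<close> are its first two space derivatives.\<close>

definition kern :: "real \<Rightarrow> real \<Rightarrow> real" where
  "kern t s = exp (- s\<^sup>2 / (4 * t)) / sqrt (4 * pi * t)"

definition kern1 :: "real \<Rightarrow> real \<Rightarrow> real" where
  "kern1 t s = - (s / (2 * t)) * kern t s"

definition kern2 :: "real \<Rightarrow> real \<Rightarrow> real" where
  "kern2 t s = (s\<^sup>2 / (4 * t\<^sup>2) - 1 / (2 * t)) * kern t s"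

section \<open>Derivatives and locally uniform decay of the heat kernel\<close>

lemma wt_pos: "0 < wt y" and wt_le_1: "wt y \<le> 1" and exp_minus_abs_le_wt: "exp (- \<bar>y\<bar>) \<le> wt y"
  by (auto simp: wt_def)

lemma wt_measurable[measurable]: "wt \<in> borel_measurable borel"
  unfolding wt_def by measurable

lemma kern_measurable[measurable]: "kern t \<in> borel_measurable borel" "kern1 t \<in> borel_measurable borel"
  "kern2 t \<in> borel_measurable borel"
  unfolding kern2_def kern1_def kern_def by measurable

lemma kern_nonneg: "0 < t \<Longrightarrow> 0 \<le> kern t s"
  by (simp add: kern_def)

lemma kern_DERIV_space: "0 < t \<Longrightarrow> (kern t has_real_derivative kern1 t s) (at s)"
  unfolding kern_def[abs_def] kern1_def by (auto intro!: derivative_eq_intros simp: field_simps)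

lemma kern1_DERIV_space: "0 < t \<Longrightarrow> (kern1 t has_real_derivative kern2 t s) (at s)"
  unfolding kern1_def[abs_def] kern2_def
  by (auto intro!: derivative_eq_intros kern_DERIV_space simp: kern1_def field_simps power2_eq_square)

text \<open>The explicit time dependence gives \<open>kern2\<close> by the heat equation, and the
  moving argument \<open>x + t - y\<close> gives \<open>kern1\<close> by the chain rule.\<close>

lemma kern_DERIV_drift:
  assumes "0 < t"
  shows "((\<lambda>t. kern t (x + t - y)) has_real_derivative (kern1 t (x + t - y) + kern2 t (x + t - y))) (at t)"
proof -
  have pos: "sqrt (4 * pi * t) > 0" using assms by simp
  have eq: "sqrt (4 * pi * t) * sqrt (4 * pi * t) = 4 * pi * t"
    using assms by (intro real_sqrt_mult_self[THEN trans] abs_of_nonneg mult_nonneg_nonneg) auto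
  have "((\<lambda>t. sqrt (4 * pi * t)) has_real_derivative (4 * pi) / (2 * sqrt (4 * pi * t))) (at t)"
    using DERIV_chain2[OF DERIV_real_sqrt DERIV_cmult_Id, of "4 * pi" t UNIV] assms
    by (simp add: field_simps)
  moreover have "(4 * pi) / (2 * sqrt (4 * pi * t)) = sqrt (4 * pi * t) / (2 * t)"
    using pos eq assms by (simp add: field_simps)
  ultimately have D: "((\<lambda>t. sqrt (4 * pi * t)) has_real_derivative sqrt (4 * pi * t) / (2 * t)) (at t)" by simp
  define s where "s = x + t - y"
  have "((\<lambda>t. - (x + t - y)\<^sup>2 / (4 * t)) has_real_derivative (s\<^sup>2 / (4 * t\<^sup>2) - s / (2 * t))) (at t)"
    using assms by (auto intro!: derivative_eq_intros simp: s_def[symmetric]) (simp add: field_simps power2_eq_square)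
  note E = DERIV_chain2[OF DERIV_exp this]
  define E0 S0 where "E0 = exp (- s\<^sup>2 / (4 * t))" and "S0 = sqrt (4 * pi * t)"
  have "(E0 * (s\<^sup>2 / (4 * t\<^sup>2) - s / (2 * t)) * S0 - E0 * (S0 / (2 * t))) / (S0 * S0)
      = (- (s / (2 * t))) * (E0 / S0) + (s\<^sup>2 / (4 * t\<^sup>2) - 1 / (2 * t)) * (E0 / S0)"
    using pos unfolding S0_def[symmetric] by (simp add: divide_simps) (simp add: algebra_simps)
  then show ?thesis
    using DERIV_divide[OF E D] pos assms
    unfolding kern_def[abs_def] kern1_def kern2_def s_def[symmetric] E0_def S0_def by simp
qed

text \<open>Completing the square with \<open>\<bar>s\<bar> - 6 * b\<close> yields the decay
  \<open>exp (- 3 * \<bar>s\<bar>)\<close>; one of the three factors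
  \<open>exp (- \<bar>s\<bar>)\<close> is spent on the polynomial.\<close>

lemma one_plus_square_gauss_bound:
  fixes s t b :: real
  assumes "0 < t" "t \<le> b"
  shows "(1 + s\<^sup>2) * exp (- s\<^sup>2 / (4 * t)) \<le> 2 * exp (9 * b) * exp (- 2 * \<bar>s\<bar>)"
proof -
  have b: "0 < b" using assms by linarith
  have "0 \<le> (\<bar>s\<bar> - 6 * b)\<^sup>2 / (4 * b)" using b by simp
  also have "\<dots> = s\<^sup>2 / (4 * b) - 3 * \<bar>s\<bar> + 9 * b" using b by (simp add: power2_diff field_simps power2_eq_square)
  finally have "- s\<^sup>2 / (4 * b) \<le> 9 * b - 3 * \<bar>s\<bar>" by simp
  moreover have "- s\<^sup>2 / (4 * t) \<le> - s\<^sup>2 / (4 * b)"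
    using assms by (simp add: frac_le)
  ultimately have e: "exp (- s\<^sup>2 / (4 * t)) \<le> exp (9 * b - 3 * \<bar>s\<bar>)" by simp
  have "1 + s\<^sup>2 \<le> 2 * exp \<bar>s\<bar>"
    using exp_lower_Taylor_quadratic[of "\<bar>s\<bar>"] by (simp add: power2_eq_square)
  then have "(1 + s\<^sup>2) * exp (- s\<^sup>2 / (4 * t)) \<le> (2 * exp \<bar>s\<bar>) * exp (9 * b - 3 * \<bar>s\<bar>)"
    using e by (intro mult_mono) auto
  also have "\<dots> = 2 * exp (9 * b) * exp (- 2 * \<bar>s\<bar>)"
    by (simp add: exp_add[symmetric])
  finally show ?thesis .
qed

text \<open>One bound for all times in a compact interval away from 0 and all \<open>x\<close> in a
  bounded set, as differentiation under the integral requires.\<close>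

lemma kern_dominated:
  assumes a: "0 < a" "a \<le> b" and R: "0 \<le> R"
  obtains C where "0 < C"
    "\<And>t x y. a \<le> t \<Longrightarrow> t \<le> b \<Longrightarrow> \<bar>x\<bar> \<le> R \<Longrightarrow> \<bar>kern t (x - y)\<bar> \<le> C * exp (- 2 * \<bar>y\<bar>)"
    "\<And>t x y. a \<le> t \<Longrightarrow> t \<le> b \<Longrightarrow> \<bar>x\<bar> \<le> R \<Longrightarrow> \<bar>kern1 t (x - y)\<bar> \<le> C * exp (- 2 * \<bar>y\<bar>)"
    "\<And>t x y. a \<le> t \<Longrightarrow> t \<le> b \<Longrightarrow> \<bar>x\<bar> \<le> R \<Longrightarrow> \<bar>kern2 t (x - y)\<bar> \<le> C * exp (- 2 * \<bar>y\<bar>)"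
proof -
  \<comment> \<open>\<open>K * (1 + s\<^sup>2)\<close> dominates 1 and the polynomial factors of
    \<open>kern1\<close> and \<open>kern2\<close> for \<open>a \<le> t\<close>. The factor
    \<open>exp (2 * R)\<close> in \<open>C\<close> pays for replacing
    \<open>\<bar>x - y\<bar>\<close> by \<open>\<bar>y\<bar>\<close>.\<close>
  define K where "K = 1 + 1 / a + 1 / a\<^sup>2"
  define C where "C = K * (2 * exp (9 * b) / sqrt (4 * pi * a)) * exp (2 * R)"
  have K: "0 < K" "1 \<le> K" "1 / a \<le> K" "1 / a\<^sup>2 \<le> K" using a by (auto simp: K_def add_pos_nonneg)
  have C: "C > 0" using K a by (simp add: C_def)
  have main: "p * kern t (x - y) \<le> C * exp (- 2 * \<bar>y\<bar>)"
    if t: "a \<le> t" "t \<le> b" and x: "\<bar>x\<bar> \<le> R" and p: "0 \<le> p" "p \<le> K * (1 + (x - y)\<^sup>2)" for p t x y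
  proof -
    have "p * kern t (x - y) \<le> K * (1 + (x - y)\<^sup>2) * (exp (- (x - y)\<^sup>2 / (4 * t)) / sqrt (4 * pi * a))"
      unfolding kern_def using a t p K by (intro mult_mono divide_left_mono mult_nonneg_nonneg) (auto simp: mult_mono)
    also have "\<dots> = K / sqrt (4 * pi * a) * ((1 + (x - y)\<^sup>2) * exp (- (x - y)\<^sup>2 / (4 * t)))" by simp
    also have "\<dots> \<le> K / sqrt (4 * pi * a) * (2 * exp (9 * b) * exp (- 2 * \<bar>x - y\<bar>))"
      using one_plus_square_gauss_bound[of t b "x - y"] a t K by (intro mult_left_mono) auto
    also have "\<dots> \<le> K / sqrt (4 * pi * a) * (2 * exp (9 * b) * (exp (2 * R) * exp (- 2 * \<bar>y\<bar>)))"
      using a K x abs_triangle_ineq2[of y x] by (intro mult_left_mono) (auto simp: exp_add[symmetric] abs_minus_commute)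
    also have "\<dots> = C * exp (- 2 * \<bar>y\<bar>)" by (simp add: C_def)
    finally show ?thesis .
  qed
  show ?thesis
  proof (rule that[OF C])
    fix t x y assume t: "a \<le> t" "t \<le> b" and x: "\<bar>x\<bar> \<le> R"
    have t0: "0 < t" using a t by simp
    define s where "s = x - y"
    have it: "1 / t \<le> 1 / a" using a t by (simp add: frac_le)
    have it2: "1 / t\<^sup>2 \<le> 1 / a\<^sup>2" using a t by (simp add: frac_le power_mono)
    have k: "0 \<le> kern t (x - y)" using t0 by (rule kern_nonneg)
    show "\<bar>kern t (x - y)\<bar> \<le> C * exp (- 2 * \<bar>y\<bar>)"
      using main[OF t x, of 1 y] k K mult_mono[of 1 K 1 "1 + (x - y)\<^sup>2"] by simp
    have "\<bar>s\<bar> / (2 * t) \<le> K * (1 + s\<^sup>2)"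
    proof -
      have "\<bar>s\<bar> \<le> 1 + s\<^sup>2" using zero_le_power2[of "\<bar>s\<bar> - 1"] by (simp add: power2_diff)
      then have "(1 / t) * (\<bar>s\<bar> / 2) \<le> K * (1 + s\<^sup>2)" using it K t0 by (intro mult_mono) auto
      then show ?thesis by simp
    qed
    then show "\<bar>kern1 t (x - y)\<bar> \<le> C * exp (- 2 * \<bar>y\<bar>)"
      using main[OF t x, of "\<bar>s\<bar> / (2 * t)" y] k t0 by (simp add: kern1_def abs_mult s_def)
    have "\<bar>s\<^sup>2 / (4 * t\<^sup>2) - 1 / (2 * t)\<bar> \<le> s\<^sup>2 / (4 * t\<^sup>2) + 1 / (2 * t)"
      using t0 by (intro abs_triangle_ineq4[THEN order_trans]) auto
    also have "\<dots> \<le> s\<^sup>2 * (1 / t\<^sup>2) + 1 / t" using t0 by (intro add_mono) (auto simp: field_simps)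
    also have "\<dots> \<le> s\<^sup>2 * K + K" using it it2 K by (intro add_mono mult_left_mono) auto
    also have "\<dots> = K * (1 + s\<^sup>2)" by (simp add: algebra_simps)
    finally show "\<bar>kern2 t (x - y)\<bar> \<le> C * exp (- 2 * \<bar>y\<bar>)"
      using main[OF t x, of "\<bar>s\<^sup>2 / (4 * t\<^sup>2) - 1 / (2 * t)\<bar>" y] k by (simp add: kern2_def abs_mult s_def)
  qed
qed

lemma integrable_exp_minus_two_abs: "integrable lborel (\<lambda>y::real. exp (- 2 * \<bar>y\<bar>))"
proof (rule Bochner_Integration.integrable_bound)
  show "integrable lborel (\<lambda>y::real. inverse (1 + y\<^sup>2))"
    using integrable_inverse_1_plus_square by (simp add: set_integrable_def)
  have "exp (- 2 * \<bar>y\<bar>) \<le> inverse (1 + y\<^sup>2)" for y :: real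
  proof -
    have "1 + y\<^sup>2 \<le> exp (2 * \<bar>y\<bar>)"
    proof -
      have "1 + 2 * \<bar>y\<bar> + 2 * y\<^sup>2 \<le> exp (2 * \<bar>y\<bar>)"
        using exp_lower_Taylor_quadratic[of "2 * \<bar>y\<bar>"] by (simp add: power_mult_distrib)
      then show ?thesis using zero_le_power2[of y] abs_ge_zero[of y] by linarith
    qed
    then show ?thesis
      by (simp add: exp_minus le_imp_inverse_le add_pos_nonneg)
  qed
  then show "AE y::real in lborel. norm (exp (- 2 * \<bar>y\<bar>)) \<le> norm (inverse (1 + y\<^sup>2))"
    by (auto simp: add_nonneg_nonneg)
qed measurable

section \<open>Weighted square integrable data\<close>

lemma wL2_measurable: "wL2 H \<Longrightarrow> H \<in> borel_measurable borel"
  by (simp add: wL2_def)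

text \<open>The rate 2 leaves two factors \<open>exp (- \<bar>y\<bar>)\<close>: one is absorbed by
  the weight, the other is itself square integrable, so the product is controlled by a sum of two
  squares.\<close>

lemma wL2_integrable_exp:
  assumes "wL2 H"
  shows "integrable lborel (\<lambda>y. exp (- 2 * \<bar>y\<bar>) * H y)"
proof (rule Bochner_Integration.integrable_bound)
  note [measurable] = wL2_measurable[OF assms]
  show "integrable lborel (\<lambda>y. exp (- 2 * \<bar>y\<bar>) + (wt y * H y)\<^sup>2)"
    using assms integrable_exp_minus_two_abs by (auto simp: wL2_def)
  show "(\<lambda>y. exp (- 2 * \<bar>y\<bar>) * H y) \<in> borel_measurable lborel" by measurable
  have "\<bar>exp (- 2 * \<bar>y\<bar>) * H y\<bar> \<le> exp (- 2 * \<bar>y\<bar>) + (wt y * H y)\<^sup>2" for y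
  proof -
    have "exp (- 2 * \<bar>y\<bar>) = exp (- \<bar>y\<bar>) * exp (- \<bar>y\<bar>)" by (simp add: exp_add[symmetric])
    then have "\<bar>exp (- 2 * \<bar>y\<bar>) * H y\<bar> = exp (- \<bar>y\<bar>) * (exp (- \<bar>y\<bar>) * \<bar>H y\<bar>)" by (simp add: abs_mult)
    also have "\<dots> \<le> exp (- \<bar>y\<bar>) * (wt y * \<bar>H y\<bar>)"
      by (intro mult_left_mono mult_right_mono exp_minus_abs_le_wt) auto
    also have "\<dots> \<le> (exp (- \<bar>y\<bar>))\<^sup>2 + (wt y * \<bar>H y\<bar>)\<^sup>2"
    proof -
      have "a * b \<le> a\<^sup>2 + b\<^sup>2" for a b :: real
        using sum_squares_bound[of a b] zero_le_power2[of a] zero_le_power2[of b] by linarith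
      then show ?thesis .
    qed
    also have "\<dots> = exp (- 2 * \<bar>y\<bar>) + (wt y * H y)\<^sup>2"
      by (simp add: power_mult_distrib power2_eq_square exp_add[symmetric])
    finally show ?thesis .
  qed
  then show "AE y in lborel. norm (exp (- 2 * \<bar>y\<bar>) * H y) \<le> norm (exp (- 2 * \<bar>y\<bar>) + (wt y * H y)\<^sup>2)"
    by (auto simp: add_nonneg_nonneg)
qed

lemma wL2_dominated_integrable:
  assumes H: "wL2 H" and [measurable]: "g \<in> borel_measurable borel" and g: "\<And>y. \<bar>g y\<bar> \<le> C * exp (- 2 * \<bar>y\<bar>)"
  shows "integrable lborel (\<lambda>y. g y * H y)"
proof (rule Bochner_Integration.integrable_bound)
  note [measurable] = wL2_measurable[OF H]
  show "integrable lborel (\<lambda>y. C * (exp (- 2 * \<bar>y\<bar>) * H y))" using wL2_integrable_exp[OF H] by simp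
  show "(\<lambda>y. g y * H y) \<in> borel_measurable lborel" by measurable
  have "\<bar>g y * H y\<bar> \<le> \<bar>C * (exp (- 2 * \<bar>y\<bar>) * H y)\<bar>" for y
    using mult_right_mono[OF order_trans[OF g[of y] abs_ge_self], of "\<bar>H y\<bar>"] by (simp add: abs_mult mult.assoc)
  then show "AE y in lborel. norm (g y * H y) \<le> norm (C * (exp (- 2 * \<bar>y\<bar>) * H y))" by simp
qed

lemma wL2_set_integrable:
  assumes H: "wL2 H"
  shows "set_integrable lborel {a..b} H"
  unfolding set_integrable_def real_scaleR_def
proof (rule wL2_dominated_integrable[OF H])
  show "\<bar>indicator {a..b} y\<bar> \<le> exp (2 * (\<bar>a\<bar> + \<bar>b\<bar>)) * exp (- 2 * \<bar>y\<bar>)" for y :: real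
    by (auto simp: indicator_def exp_add[symmetric])
qed simp

lemma wL2_abs: "wL2 H \<Longrightarrow> wL2 (\<lambda>y. \<bar>H y\<bar>)"
  by (auto simp: wL2_def power_mult_distrib)

lemma wL2_diff:
  assumes "wL2 G" "wL2 H"
  shows "wL2 (\<lambda>y. G y - H y)"
proof -
  note [measurable] = assms[THEN wL2_measurable]
  have "integrable lborel (\<lambda>y. 2 * (wt y * G y)\<^sup>2 + 2 * (wt y * H y)\<^sup>2)"
    using assms by (auto simp: wL2_def)
  moreover
  have "(wt y * (G y - H y))\<^sup>2 \<le> 2 * (wt y * G y)\<^sup>2 + 2 * (wt y * H y)\<^sup>2" for y
    using zero_le_power2[of "wt y * G y + wt y * H y"]
    by (simp add: right_diff_distrib power2_diff power2_sum)
  then have "AE y in lborel. norm ((wt y * (G y - H y))\<^sup>2) \<le> norm (2 * (wt y * G y)\<^sup>2 + 2 * (wt y * H y)\<^sup>2)"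
    by (intro AE_I2) (simp add: add_nonneg_nonneg)
  moreover have "(\<lambda>y. (wt y * (G y - H y))\<^sup>2) \<in> borel_measurable lborel" by measurable
  ultimately have "integrable lborel (\<lambda>y. (wt y * (G y - H y))\<^sup>2)"
    using Bochner_Integration.integrable_bound by blast
  then show ?thesis by (simp add: wL2_def)
qed

section \<open>Kernel representation and derivatives of the flow\<close>

lemma std_normal_eq_kern:
  assumes "0 < t"
  shows "std_normal_density z = sqrt (2 * t) * kern t (x - (x + sqrt (2 * t) * z))"
proof -
  have "sqrt (4 * pi * t) = sqrt (2 * pi) * sqrt (2 * t)" by (simp add: real_sqrt_mult[symmetric])
  moreover have "(sqrt (2 * t) * z)\<^sup>2 / (4 * t) = z\<^sup>2 / 2" using assms by (simp add: power_mult_distrib)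
  ultimately show ?thesis using assms by (simp add: std_normal_density_def kern_def)
qed

lemma drift_heat_kern:
  assumes "0 < t"
  shows "drift_heat t H x = (LINT y|lborel. kern t (x + t - y) * H y)"
proof -
  have "(LINT y|lborel. kern t (x + t - y) * H y) =
    \<bar>sqrt (2 * t)\<bar> *\<^sub>R (LINT z|lborel. kern t (x + t - ((x + t) + sqrt (2 * t) * z)) * H ((x + t) + sqrt (2 * t) * z))"
    by (rule lborel_integral_real_affine) (use assms in simp)
  also have "\<dots> = drift_heat t H x"
    unfolding drift_heat_def using assms
    by (subst std_normal_eq_kern[OF assms, of _ "x + t"])
       (simp add: integral_mult_right_zero[symmetric] mult.assoc del: integral_mult_right_zero)
  finally show ?thesis by simp
qed

lemma drift_heat_0: "drift_heat 0 H x = H x"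
  by (simp add: drift_heat_def)

lemma kern_integrable:
  assumes H: "wL2 H" and t: "0 < t"
  shows "integrable lborel (\<lambda>y. kern t (x - y) * H y)" "integrable lborel (\<lambda>y. kern1 t (x - y) * H y)"
    "integrable lborel (\<lambda>y. kern2 t (x - y) * H y)"
proof -
  obtain C where C: "\<And>y. \<bar>kern t (x - y)\<bar> \<le> C * exp (- 2 * \<bar>y\<bar>)"
    "\<And>y. \<bar>kern1 t (x - y)\<bar> \<le> C * exp (- 2 * \<bar>y\<bar>)" "\<And>y. \<bar>kern2 t (x - y)\<bar> \<le> C * exp (- 2 * \<bar>y\<bar>)"
    using kern_dominated[of t t "\<bar>x\<bar>"] t by (metis abs_ge_zero order_refl)
  show "integrable lborel (\<lambda>y. kern t (x - y) * H y)" by (rule wL2_dominated_integrable[OF H _ C(1)]) simp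
  show "integrable lborel (\<lambda>y. kern1 t (x - y) * H y)" by (rule wL2_dominated_integrable[OF H _ C(2)]) simp
  show "integrable lborel (\<lambda>y. kern2 t (x - y) * H y)" by (rule wL2_dominated_integrable[OF H _ C(3)]) simp
qed

lemma drift_heat_integrable:
  assumes H: "wL2 H" and t: "0 \<le> t"
  shows "integrable lborel (\<lambda>z. std_normal_density z * H (x + t + sqrt (2 * t) * z))"
proof (cases "t = 0")
  case False
  then have t: "0 < t" using t by simp
  have "integrable lborel (\<lambda>z. kern t (x + t - (x + t + sqrt (2 * t) * z)) * H (x + t + sqrt (2 * t) * z))"
    by (rule lborel_integrable_real_affine[OF kern_integrable(1)[OF H t]]) (use t in simp)
  then have "integrable lborel (\<lambda>z. sqrt (2 * t) * (kern t (x + t - (x + t + sqrt (2 * t) * z)) * H (x + t + sqrt (2 * t) * z)))"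
    by (rule integrable_mult_right)
  then show ?thesis by (subst std_normal_eq_kern[OF t, of _ "x + t"]) (simp add: mult.assoc)
qed simp

lemma drift_heat_diff:
  assumes "wL2 G" "wL2 H" "0 \<le> t"
  shows "drift_heat t (\<lambda>y. G y - H y) x = drift_heat t G x - drift_heat t H x"
  unfolding drift_heat_def right_diff_distrib
  by (rule Bochner_Integration.integral_diff) (intro drift_heat_integrable assms)+

lemma integral_kern_DERIV_space:
  assumes H: "wL2 H" and t: "0 < t"
  shows "((\<lambda>x. LINT y|lborel. kern t (x - y) * H y) has_real_derivative (LINT y|lborel. kern1 t (x - y) * H y)) (at x)"
    and "((\<lambda>x. LINT y|lborel. kern1 t (x - y) * H y) has_real_derivative (LINT y|lborel. kern2 t (x - y) * H y)) (at x)"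
proof -
  obtain C where C: "\<And>x' y. \<bar>x'\<bar> \<le> \<bar>x\<bar> + 1 \<Longrightarrow> \<bar>kern1 t (x' - y)\<bar> \<le> C * exp (- 2 * \<bar>y\<bar>)"
    "\<And>x' y. \<bar>x'\<bar> \<le> \<bar>x\<bar> + 1 \<Longrightarrow> \<bar>kern2 t (x' - y)\<bar> \<le> C * exp (- 2 * \<bar>y\<bar>)"
    using kern_dominated[of t t "\<bar>x\<bar> + 1"] t by (metis abs_ge_zero add_nonneg_nonneg order_refl zero_le_one)
  have B: "integrable lborel (\<lambda>y. C * exp (- 2 * \<bar>y\<bar>) * \<bar>H y\<bar>)"
    using wL2_integrable_exp[OF wL2_abs[OF H]] by (simp add: mult.assoc)
  show "((\<lambda>x. LINT y|lborel. kern t (x - y) * H y) has_real_derivative (LINT y|lborel. kern1 t (x - y) * H y)) (at x)"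
  proof (rule has_real_derivative_integral_dominated[where a = "x - 1" and b = "x + 1", OF _ _ _ B])
    show "((\<lambda>s. kern t (s - y) * H y) has_real_derivative kern1 t (s - y) * H y) (at s)" for s y
      by (auto intro!: derivative_eq_intros DERIV_chain2[OF kern_DERIV_space[OF t]])
    show "\<bar>kern1 t (s - y) * H y\<bar> \<le> C * exp (- 2 * \<bar>y\<bar>) * \<bar>H y\<bar>" if "x - 1 < s" "s < x + 1" for s y
      unfolding abs_mult using that by (intro mult_right_mono C) auto
  qed (auto intro: kern_integrable[OF H t])
  show "((\<lambda>x. LINT y|lborel. kern1 t (x - y) * H y) has_real_derivative (LINT y|lborel. kern2 t (x - y) * H y)) (at x)"
  proof (rule has_real_derivative_integral_dominated[where a = "x - 1" and b = "x + 1", OF _ _ _ B])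
    show "((\<lambda>s. kern1 t (s - y) * H y) has_real_derivative kern2 t (s - y) * H y) (at s)" for s y
      by (auto intro!: derivative_eq_intros DERIV_chain2[OF kern1_DERIV_space[OF t]])
    show "\<bar>kern2 t (s - y) * H y\<bar> \<le> C * exp (- 2 * \<bar>y\<bar>) * \<bar>H y\<bar>" if "x - 1 < s" "s < x + 1" for s y
      unfolding abs_mult using that by (intro mult_right_mono C) auto
  qed (auto intro: kern_integrable[OF H t])
qed

lemma drift_heat_DERIV_time:
  assumes H: "wL2 H" and t: "0 < t"
  shows "((\<lambda>t. drift_heat t H x) has_real_derivative
    ((LINT y|lborel. kern1 t (x + t - y) * H y) + (LINT y|lborel. kern2 t (x + t - y) * H y))) (at t)"
proof -
  \<comment> \<open>The window from \<open>t / 2\<close> to \<open>2 * t\<close> stays away from the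
    singular time 0 and keeps the drifted point \<open>x + t'\<close> bounded.\<close>
  obtain C where C: "\<And>t' x' y. t / 2 \<le> t' \<Longrightarrow> t' \<le> 2 * t \<Longrightarrow> \<bar>x'\<bar> \<le> \<bar>x\<bar> + 2 * t \<Longrightarrow> \<bar>kern1 t' (x' - y)\<bar> \<le> C * exp (- 2 * \<bar>y\<bar>)"
    "\<And>t' x' y. t / 2 \<le> t' \<Longrightarrow> t' \<le> 2 * t \<Longrightarrow> \<bar>x'\<bar> \<le> \<bar>x\<bar> + 2 * t \<Longrightarrow> \<bar>kern2 t' (x' - y)\<bar> \<le> C * exp (- 2 * \<bar>y\<bar>)"
    by (rule kern_dominated[of "t / 2" "2 * t" "\<bar>x\<bar> + 2 * t"]) (use t in auto)
  have B: "integrable lborel (\<lambda>y. 2 * C * exp (- 2 * \<bar>y\<bar>) * \<bar>H y\<bar>)"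
    using wL2_integrable_exp[OF wL2_abs[OF H]] by (simp add: mult.assoc)
  have "((\<lambda>t. LINT y|lborel. kern t (x + t - y) * H y) has_real_derivative
      (LINT y|lborel. (kern1 t (x + t - y) + kern2 t (x + t - y)) * H y)) (at t)"
  proof (rule has_real_derivative_integral_dominated[where a = "t / 2" and b = "2 * t", OF _ _ _ B])
    show "((\<lambda>s. kern s (x + s - y) * H y) has_real_derivative (kern1 s (x + s - y) + kern2 s (x + s - y)) * H y) (at s)"
      if "t / 2 < s" for s y
      by (rule DERIV_cmult_right[OF kern_DERIV_drift]) (use that t in simp)
    show "\<bar>(kern1 s (x + s - y) + kern2 s (x + s - y)) * H y\<bar> \<le> 2 * C * exp (- 2 * \<bar>y\<bar>) * \<bar>H y\<bar>"
      if "t / 2 < s" "s < 2 * t" for s y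
    proof -
      have "\<bar>kern1 s (x + s - y) + kern2 s (x + s - y)\<bar> \<le> C * exp (- 2 * \<bar>y\<bar>) + C * exp (- 2 * \<bar>y\<bar>)"
        using that t by (intro order_trans[OF abs_triangle_ineq] add_mono C) auto
      then show ?thesis unfolding abs_mult by (intro mult_right_mono) auto
    qed
    show "integrable lborel (\<lambda>y. kern s (x + s - y) * H y)" if "t / 2 < s" for s
      by (rule kern_integrable[OF H]) (use that t in simp)
  qed (use t in auto)
  also have "(LINT y|lborel. (kern1 t (x + t - y) + kern2 t (x + t - y)) * H y)
      = (LINT y|lborel. kern1 t (x + t - y) * H y) + (LINT y|lborel. kern2 t (x + t - y) * H y)"
    unfolding distrib_right by (rule Bochner_Integration.integral_add) (rule kern_integrable[OF H t])+
  finally show ?thesis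
    by (rule has_field_derivative_transform_within_open[where S = "{0<..}"]) (use t in \<open>auto simp: drift_heat_kern\<close>)
qed

lemma drift_heat_DERIV_kern:
  assumes H: "wL2 H" and t: "0 < t"
  shows "(drift_heat t H has_real_derivative (LINT y|lborel. kern1 t (x + t - y) * H y)) (at x)"
proof -
  have "((\<lambda>x. LINT y|lborel. kern t (x + t - y) * H y) has_real_derivative (LINT y|lborel. kern1 t (x + t - y) * H y)) (at x)"
    using DERIV_shift[THEN iffD1, OF integral_kern_DERIV_space(1)[OF H t, of "x + t"]] by simp
  moreover have "drift_heat t H = (\<lambda>x. LINT y|lborel. kern t (x + t - y) * H y)"
    by (intro ext drift_heat_kern t)
  ultimately show ?thesis by simp
qed

lemma drift_heat_continuous:
  assumes "wL2 H" "0 < t"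
  shows "continuous_on A (drift_heat t H)"
  by (intro continuous_at_imp_continuous_on ballI DERIV_isCont[OF drift_heat_DERIV_kern[OF assms]])

lemma antiderivative_LBINT:
  assumes "antiderivative F f" "set_integrable lborel {a..b} f" "a \<le> b"
  shows "(LINT x:{a..b}|lborel. f x) = F b - F a"
  using set_borel_integral_eq_integral(2)[OF assms(2)] integral_unique[OF antiderivativeD[OF assms(1,3)]] by simp

lemma antiderivativeI_LBINT:
  assumes "\<And>a b. a \<le> b \<Longrightarrow> set_integrable lborel {a..b} f"
    and "\<And>a b. a \<le> b \<Longrightarrow> (LINT x:{a..b}|lborel. f x) = F b - F a"
  shows "antiderivative F f"
  unfolding antiderivative_def
proof (intro allI impI)
  fix a b :: real assume ab: "a \<le> b"
  show "(f has_integral F b - F a) {a..b}"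
    using integrable_integral[OF set_borel_integral_eq_integral(1)[OF assms(1)[OF ab]]]
      set_borel_integral_eq_integral(2)[OF assms(1)[OF ab]] assms(2)[OF ab] by simp
qed

text \<open>The flow averages translates of \<open>f\<close>, so integrating over
  \<open>{a..b}\<close> before averaging leaves increments of \<open>F\<close>. Fubini applies
  because the flow of \<open>\<bar>f\<bar>\<close> is continuous, hence integrable over
  \<open>{a..b}\<close>.\<close>

lemma drift_heat_antiderivative:
  assumes F: "wL2 F" and f: "wL2 f" and Ff: "antiderivative F f" and t: "0 < t"
  shows "antiderivative (drift_heat t F) (drift_heat t f)"
proof (rule antiderivativeI_LBINT)
  fix a b :: real assume ab: "a \<le> b"
  note [measurable] = wL2_measurable[OF f]
  show "set_integrable lborel {a..b} (drift_heat t f)"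
    by (rule borel_integrable_atLeastAtMost'[OF drift_heat_continuous[OF f t]])
  define g where "g = (\<lambda>(x, z). indicator {a..b} x * (std_normal_density z * f (x + t + sqrt (2 * t) * z)))"
  have "integrable (lborel \<Otimes>\<^sub>M lborel) g"
  proof (rule lborel_pair.Fubini_integrable)
    show "g \<in> borel_measurable (lborel \<Otimes>\<^sub>M lborel)" unfolding g_def by measurable
    have "set_integrable lborel {a..b} (drift_heat t (\<lambda>y. \<bar>f y\<bar>))"
      by (rule borel_integrable_atLeastAtMost'[OF drift_heat_continuous[OF wL2_abs[OF f] t]])
    then show "integrable lborel (\<lambda>x. LINT z|lborel. norm (g (x, z)))"
      by (simp add: g_def set_integrable_def drift_heat_def[abs_def] abs_mult)
    show "AE x in lborel. integrable lborel (\<lambda>z. g (x, z))"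
      using drift_heat_integrable[OF f, of t] t by (simp add: g_def)
  qed
  then have "(LINT z|lborel. LINT x|lborel. g (x, z)) = (LINT x|lborel. LINT z|lborel. g (x, z))"
    using lborel_pair.Fubini_integral[of "\<lambda>x z. g (x, z)"] by simp
  moreover have "(LINT x|lborel. LINT z|lborel. g (x, z)) = (LINT x:{a..b}|lborel. drift_heat t f x)"
    by (simp add: g_def set_lebesgue_integral_def drift_heat_def)
  moreover have "(LINT x|lborel. g (x, z)) = std_normal_density z * F (b + t + sqrt (2 * t) * z)
      - std_normal_density z * F (a + t + sqrt (2 * t) * z)" for z
  proof -
    define c where "c = t + sqrt (2 * t) * z"
    have "(LINT x|lborel. g (x, z)) = std_normal_density z * (LINT x|lborel. indicator {a..b} x * f (x + c))"
      by (simp add: g_def c_def mult.left_commute add.assoc)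
    also have "(LINT x|lborel. indicator {a..b} x * f (x + c)) = (LINT x|lborel. indicator {a+c..b+c} x * f x)"
      by (subst lborel_integral_real_affine[where c = 1 and t = c and f = "\<lambda>x. indicator {a+c..b+c} x * f x"])
         (auto simp: indicator_def add.commute intro!: Bochner_Integration.integral_cong)
    also have "\<dots> = (LINT x:{a+c..b+c}|lborel. f x)" by (simp add: set_lebesgue_integral_def)
    also have "\<dots> = F (b + c) - F (a + c)"
      by (rule antiderivative_LBINT[OF Ff wL2_set_integrable[OF f]]) (use ab in simp)
    finally show ?thesis by (simp add: c_def right_diff_distrib add.assoc)
  qed
  moreover have "(LINT z|lborel. std_normal_density z * F (b + t + sqrt (2 * t) * z)
      - std_normal_density z * F (a + t + sqrt (2 * t) * z)) = drift_heat t F b - drift_heat t F a"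
    unfolding drift_heat_def
    by (rule Bochner_Integration.integral_diff) (use t in \<open>auto intro: drift_heat_integrable[OF F]\<close>)
  ultimately show "(LINT x:{a..b}|lborel. drift_heat t f x) = drift_heat t F b - drift_heat t F a" by simp
qed

lemma drift_heat_DERIV_space:
  assumes "wL2 F" "wL2 f" "antiderivative F f" "0 < t"
  shows "(drift_heat t F has_real_derivative drift_heat t f x) (at x)"
  by (rule antiderivative_has_derivative[OF drift_heat_antiderivative[OF assms] drift_heat_continuous]) (use assms in auto)

text \<open>The flow of \<open>U0\<close> has space derivatives computed from the kernel and others
  computed from the datum; uniqueness of derivatives turns the integrals against
  \<open>kern1\<close> and \<open>kern2\<close> into the flows of \<open>U1\<close> and
  \<open>U2\<close>.\<close>

lemma drift_heat_equation:
  assumes U0: "wL2 U0" and U1: "wL2 U1" and U2: "wL2 U2"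
    and U01: "antiderivative U0 U1" and U12: "antiderivative U1 U2" and t: "0 < t"
  shows "((\<lambda>t. drift_heat t U0 x) has_real_derivative (drift_heat t U1 x + drift_heat t U2 x)) (at t)"
proof -
  have 1: "(LINT y|lborel. kern1 t (x + t - y) * U0 y) = drift_heat t U1 x" for x
    using drift_heat_DERIV_kern[OF U0 t] drift_heat_DERIV_space[OF U0 U1 U01 t] by (rule DERIV_unique)
  have "((\<lambda>x. LINT y|lborel. kern1 t (x + t - y) * U0 y) has_real_derivative (LINT y|lborel. kern2 t (x + t - y) * U0 y)) (at x)"
    using DERIV_shift[THEN iffD1, OF integral_kern_DERIV_space(2)[OF U0 t, of "x + t"]] by simp
  then have 2: "(LINT y|lborel. kern2 t (x + t - y) * U0 y) = drift_heat t U2 x"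
    unfolding 1 using drift_heat_DERIV_space[OF U1 U2 U12 t] by (rule DERIV_unique)
  show ?thesis using drift_heat_DERIV_time[OF U0 t, of x] unfolding 1 2 .
qed

section \<open>Uniform bounds\<close>

definition hL2 :: "(real \<Rightarrow> real) \<Rightarrow> bool" where
  "hL2 p \<longleftrightarrow> p \<in> borel_measurable borel \<and> integrable lborel (\<lambda>x. indicator {0..} x * (p x)\<^sup>2)"

definition hsq :: "(real \<Rightarrow> real) \<Rightarrow> real" where
  "hsq p = (LINT x|lborel. indicator {0..} x * (p x)\<^sup>2)"

text \<open>For \<open>y < 0\<close>, replacing \<open>y\<close> by \<open>\<bar>y\<bar>\<close>
  lowers the exponent's loss by \<open>(x + t) * y / t\<close>, which is at most \<open>y\<close>
  because \<open>0 \<le> x\<close>. The gained factor \<open>exp y\<close> is exactly what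
  compensates the growth of the extended datum.\<close>

lemma kern_reflect_bound:
  assumes "0 < t" "0 \<le> x"
  shows "kern t (x + t - y) \<le> wt y * kern t (x + t - \<bar>y\<bar>)"
proof (cases "0 \<le> y")
  case True then show ?thesis by (simp add: wt_def)
next
  case False
  then have y: "y < 0" by simp
  have "(x + t + y)\<^sup>2 - (x + t - y)\<^sup>2 = 4 * (x * y) + 4 * (t * y)" by (simp add: power2_eq_square algebra_simps)
  moreover have "x * y \<le> 0" using assms y by (simp add: mult_nonneg_nonpos)
  ultimately have "(x + t + y)\<^sup>2 - (x + t - y)\<^sup>2 \<le> y * (4 * t)" by simp
  then have "((x + t + y)\<^sup>2 - (x + t - y)\<^sup>2) / (4 * t) \<le> y"
    using assms by (simp add: pos_divide_le_eq)
  then have "- (x + t - y)\<^sup>2 / (4 * t) \<le> y + - (x + t + y)\<^sup>2 / (4 * t)"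
    by (simp add: diff_divide_distrib)
  then have "exp (- (x + t - y)\<^sup>2 / (4 * t)) \<le> exp y * exp (- (x + t + y)\<^sup>2 / (4 * t))"
    by (metis exp_add exp_le_cancel_iff)
  then show ?thesis using y assms by (simp add: kern_def wt_def divide_right_mono)
qed

lemma kern_le: "0 < t \<Longrightarrow> kern t s \<le> 1 / sqrt (4 * pi * t)"
  unfolding kern_def by (intro divide_right_mono) auto

lemma kern_normal_density: "0 < t \<Longrightarrow> kern t (c - y) = normal_density c (sqrt (2 * t)) y"
  by (simp add: kern_def normal_density_def power2_commute[of c y] mult.commute[of _ t])

lemma kern_minus: "kern t (- s) = kern t s"
  by (simp add: kern_def)

lemma nn_integral_kern: "0 < t \<Longrightarrow> (\<integral>\<^sup>+y. kern t (c - y) \<partial>lborel) = 1"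
  by (simp add: kern_normal_density nn_integral_eq_integral)

lemma nn_integral_kern_abs:
  assumes t: "0 < t"
  shows "(\<integral>\<^sup>+y. kern t (c - \<bar>y\<bar>) \<partial>lborel) \<le> 2"
proof -
  have "(\<integral>\<^sup>+y. kern t (c - \<bar>y\<bar>) \<partial>lborel) \<le> (\<integral>\<^sup>+y. ennreal (kern t (c - y)) + ennreal (kern t (- c - y)) \<partial>lborel)"
  proof (rule nn_integral_mono)
    fix y
    have "kern t (- c - y) = kern t (c + y)" using kern_minus[of t "c + y"] by simp
    then have "kern t (c - \<bar>y\<bar>) \<le> kern t (c - y) + kern t (- c - y)"
      using kern_nonneg[OF t] by (cases "0 \<le> y") auto
    then show "ennreal (kern t (c - \<bar>y\<bar>)) \<le> ennreal (kern t (c - y)) + ennreal (kern t (- c - y))"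
      using kern_nonneg[OF t] by (simp add: ennreal_plus[symmetric] ennreal_leI del: ennreal_plus)
  qed
  also have "\<dots> = (\<integral>\<^sup>+y. kern t (c - y) \<partial>lborel) + (\<integral>\<^sup>+y. kern t (- c - y) \<partial>lborel)"
    by (rule nn_integral_add) auto
  also have "\<dots> = 2" by (simp add: nn_integral_kern[OF t])
  finally show ?thesis .
qed

text \<open>Cauchy--Schwarz with the reflected kernel split into two square roots; one factor is its
  total mass, at most 2. The sup bound, the L2 bound and the limit at infinity all start from
  here.\<close>

lemma drift_heat_square_le:
  assumes H: "wL2 H" and t: "0 < t" and x: "0 \<le> x"
  shows "ennreal ((drift_heat t H x)\<^sup>2) \<le> 2 * (\<integral>\<^sup>+y. kern t (x + t - \<bar>y\<bar>) * (wt y * H y)\<^sup>2 \<partial>lborel)"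
proof -
  note [measurable] = wL2_measurable[OF H]
  define k where "k y = kern t (x + t - \<bar>y\<bar>)" for y
  have k: "0 \<le> k y" for y using kern_nonneg[OF t] by (simp add: k_def)
  have [measurable]: "k \<in> borel_measurable borel" unfolding k_def by measurable
  have "ennreal \<bar>drift_heat t H x\<bar> \<le> (\<integral>\<^sup>+y. norm (kern t (x + t - y) * H y) \<partial>lborel)"
    unfolding drift_heat_kern[OF t] real_norm_def[symmetric]
    by (rule integral_norm_bound_ennreal[OF kern_integrable(1)[OF H t]])
  also have "\<dots> \<le> (\<integral>\<^sup>+y. ennreal (sqrt (k y)) * ennreal (sqrt (k y) * \<bar>wt y * H y\<bar>) \<partial>lborel)"
  proof (rule nn_integral_mono)
    fix y
    have "norm (kern t (x + t - y) * H y) \<le> (wt y * k y) * \<bar>H y\<bar>"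
      using kern_reflect_bound[OF t x, of y] kern_nonneg[OF t] by (auto simp: abs_mult k_def intro!: mult_right_mono)
    also have "\<dots> = sqrt (k y) * (sqrt (k y) * \<bar>wt y * H y\<bar>)"
      using k[of y] wt_pos[of y] by (simp add: abs_mult mult.assoc[symmetric])
    finally show "ennreal (norm (kern t (x + t - y) * H y)) \<le> ennreal (sqrt (k y)) * ennreal (sqrt (k y) * \<bar>wt y * H y\<bar>)"
      using k by (simp add: ennreal_mult[symmetric] ennreal_leI)
  qed
  finally have "(ennreal \<bar>drift_heat t H x\<bar>)\<^sup>2 \<le>
      (\<integral>\<^sup>+y. ennreal (sqrt (k y)) * ennreal (sqrt (k y) * \<bar>wt y * H y\<bar>) \<partial>lborel)\<^sup>2"
    by (rule power_mono) simp
  also have "\<dots> \<le> (\<integral>\<^sup>+y. (ennreal (sqrt (k y)))\<^sup>2 \<partial>lborel) * (\<integral>\<^sup>+y. (ennreal (sqrt (k y) * \<bar>wt y * H y\<bar>))\<^sup>2 \<partial>lborel)"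
    by (rule Cauchy_Schwarz_nn_integral) auto
  also have "\<dots> = (\<integral>\<^sup>+y. k y \<partial>lborel) * (\<integral>\<^sup>+y. k y * (wt y * H y)\<^sup>2 \<partial>lborel)"
    using k by (simp add: ennreal_power power_mult_distrib)
  also have "\<dots> \<le> 2 * (\<integral>\<^sup>+y. k y * (wt y * H y)\<^sup>2 \<partial>lborel)"
    unfolding k_def by (intro mult_right_mono nn_integral_kern_abs[OF t]) simp
  finally show ?thesis by (simp add: ennreal_power k_def)
qed

lemma nn_integral_wsq: "wL2 H \<Longrightarrow> (\<integral>\<^sup>+y. (wt y * H y)\<^sup>2 \<partial>lborel) = ennreal (wsq H)"
  unfolding wsq_def by (rule nn_integral_eq_integral) (auto simp: wL2_def)

lemma wsq_nonneg: "0 \<le> wsq H"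
  by (simp add: wsq_def)

lemma hsq_nonneg: "0 \<le> hsq H"
  by (simp add: hsq_def)

text \<open>The kernel is bounded by its height \<open>1 / sqrt (4 * pi * t)\<close>, the source of
  the decay in time.\<close>

lemma drift_heat_sup_bound:
  assumes H: "wL2 H" and t: "0 < t" and x: "0 \<le> x"
  shows "(drift_heat t H x)\<^sup>2 \<le> 2 * wsq H / sqrt (4 * pi * t)"
proof -
  note [measurable] = wL2_measurable[OF H]
  have "(\<integral>\<^sup>+y. kern t (x + t - \<bar>y\<bar>) * (wt y * H y)\<^sup>2 \<partial>lborel) \<le> (\<integral>\<^sup>+y. ennreal (1 / sqrt (4 * pi * t)) * ennreal ((wt y * H y)\<^sup>2) \<partial>lborel)"
  proof (rule nn_integral_mono)
    fix y
    have "kern t (x + t - \<bar>y\<bar>) * (wt y * H y)\<^sup>2 \<le> 1 / sqrt (4 * pi * t) * (wt y * H y)\<^sup>2"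
      by (intro mult_right_mono kern_le[OF t]) simp
    moreover have "0 \<le> 1 / sqrt (4 * pi * t)" using t by simp
    ultimately show "ennreal (kern t (x + t - \<bar>y\<bar>) * (wt y * H y)\<^sup>2) \<le> ennreal (1 / sqrt (4 * pi * t)) * ennreal ((wt y * H y)\<^sup>2)"
      by (metis ennreal_leI ennreal_mult zero_le_power2)
  qed
  also have "\<dots> = ennreal (1 / sqrt (4 * pi * t)) * ennreal (wsq H)"
    by (simp add: nn_integral_cmult nn_integral_wsq[OF H])
  finally have "ennreal ((drift_heat t H x)\<^sup>2) \<le> 2 * (ennreal (1 / sqrt (4 * pi * t)) * ennreal (wsq H))"
    using drift_heat_square_le[OF assms] by (meson mult_left_mono order_trans zero_le)
  also have "\<dots> = ennreal (2 * wsq H / sqrt (4 * pi * t))"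
    using t wsq_nonneg[of H] by (simp add: ennreal_mult[symmetric] ennreal_numeral[symmetric] del: ennreal_numeral)
  finally show ?thesis using t wsq_nonneg[of H] by (subst (asm) ennreal_le_iff) auto
qed

lemma drift_heat_measurable[measurable]:
  assumes [measurable]: "H \<in> borel_measurable borel"
  shows "drift_heat t H \<in> borel_measurable borel"
  unfolding drift_heat_def[abs_def] by measurable

lemma hL2I:
  assumes [measurable]: "p \<in> borel_measurable borel"
    and le: "(\<integral>\<^sup>+x. ennreal (indicator {0..} x * (p x)\<^sup>2) \<partial>lborel) \<le> ennreal c" and c: "0 \<le> c"
  shows "hL2 p" "hsq p \<le> c"
proof -
  show p: "hL2 p"
    unfolding hL2_def using le by (auto intro!: integrableI_bounded simp: less_top[symmetric] top_unique)
  have "ennreal (hsq p) = (\<integral>\<^sup>+x. ennreal (indicator {0..} x * (p x)\<^sup>2) \<partial>lborel)"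
    unfolding hsq_def using p by (intro nn_integral_eq_integral[symmetric]) (auto simp: hL2_def)
  then have "ennreal (hsq p) \<le> ennreal c" using le by simp
  then show "hsq p \<le> c" using c by (simp add: ennreal_le_iff)
qed

text \<open>After Tonelli the kernel is integrated in \<open>x\<close> first, where it has mass 1.
  The constant 2 is the one of the pointwise estimate; at \<open>t = 0\<close> the weight is 1 on
  the half-line.\<close>

lemma drift_heat_L2_bound:
  assumes H: "wL2 H" and t: "0 \<le> t"
  shows "hL2 (drift_heat t H)" "hsq (drift_heat t H) \<le> 2 * wsq H"
proof -
  note [measurable] = wL2_measurable[OF H]
  have "(\<integral>\<^sup>+x. ennreal (indicator {0..} x * (drift_heat t H x)\<^sup>2) \<partial>lborel) \<le> ennreal (2 * wsq H)"
  proof (cases "t = 0")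
    case True
    have "(\<integral>\<^sup>+x. ennreal (indicator {0..} x * (H x)\<^sup>2) \<partial>lborel) \<le> (\<integral>\<^sup>+x. ennreal ((wt x * H x)\<^sup>2) \<partial>lborel)"
      by (intro nn_integral_mono ennreal_leI) (auto simp: indicator_def wt_def)
    also have "\<dots> \<le> ennreal (2 * wsq H)" unfolding nn_integral_wsq[OF H] using wsq_nonneg[of H] by (intro ennreal_leI) simp
    finally show ?thesis by (simp add: True drift_heat_0)
  next
    case False
    then have t: "0 < t" using t by simp
    have "(\<integral>\<^sup>+x. ennreal (indicator {0..} x * (drift_heat t H x)\<^sup>2) \<partial>lborel)
      \<le> (\<integral>\<^sup>+x. 2 * (\<integral>\<^sup>+y. ennreal (kern t (x + t - \<bar>y\<bar>) * (wt y * H y)\<^sup>2) \<partial>lborel) \<partial>lborel)"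
      using drift_heat_square_le[OF H t] by (intro nn_integral_mono) (auto simp: indicator_def)
    also have "\<dots> = 2 * (\<integral>\<^sup>+x. \<integral>\<^sup>+y. ennreal (kern t (x + t - \<bar>y\<bar>) * (wt y * H y)\<^sup>2) \<partial>lborel \<partial>lborel)"
      by (rule nn_integral_cmult) measurable
    also have "(\<integral>\<^sup>+x. \<integral>\<^sup>+y. ennreal (kern t (x + t - \<bar>y\<bar>) * (wt y * H y)\<^sup>2) \<partial>lborel \<partial>lborel)
      = (\<integral>\<^sup>+y. \<integral>\<^sup>+x. ennreal (kern t (x + t - \<bar>y\<bar>) * (wt y * H y)\<^sup>2) \<partial>lborel \<partial>lborel)"
      by (rule lborel_pair.Fubini') measurable
    also have "\<dots> = (\<integral>\<^sup>+y. ennreal ((wt y * H y)\<^sup>2) \<partial>lborel)"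
    proof (rule nn_integral_cong)
      fix y
      have "(\<integral>\<^sup>+x. ennreal (kern t (x + t - \<bar>y\<bar>) * (wt y * H y)\<^sup>2) \<partial>lborel)
        = (\<integral>\<^sup>+x. ennreal ((wt y * H y)\<^sup>2) * ennreal (kern t (\<bar>y\<bar> - t - x)) \<partial>lborel)"
      proof (rule nn_integral_cong)
        fix x
        have "kern t (x + t - \<bar>y\<bar>) = kern t (\<bar>y\<bar> - t - x)" using kern_minus[of t "\<bar>y\<bar> - t - x"] by (simp add: algebra_simps)
        then show "ennreal (kern t (x + t - \<bar>y\<bar>) * (wt y * H y)\<^sup>2) = ennreal ((wt y * H y)\<^sup>2) * ennreal (kern t (\<bar>y\<bar> - t - x))"
          using kern_nonneg[OF t] by (simp add: ennreal_mult mult.commute)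
      qed
      also have "\<dots> = ennreal ((wt y * H y)\<^sup>2)"
        by (subst nn_integral_cmult) (simp_all add: nn_integral_kern[OF t])
      finally show "(\<integral>\<^sup>+x. ennreal (kern t (x + t - \<bar>y\<bar>) * (wt y * H y)\<^sup>2) \<partial>lborel) = ennreal ((wt y * H y)\<^sup>2)" .
    qed
    also have "2 * \<dots> = ennreal (2 * wsq H)"
      unfolding nn_integral_wsq[OF H] by (simp add: ennreal_mult wsq_nonneg)
    finally show ?thesis .
  qed
  then show "hL2 (drift_heat t H)" "hsq (drift_heat t H) \<le> 2 * wsq H"
    using hL2I[of "drift_heat t H"] wsq_nonneg[of H] by auto
qed

lemma hL2_diff:
  assumes "hL2 p" "hL2 q"
  shows "hL2 (\<lambda>x. p x - q x)" "hsq (\<lambda>x. p x - q x) \<le> 2 * hsq p + 2 * hsq q"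
proof -
  have [measurable]: "p \<in> borel_measurable borel" "q \<in> borel_measurable borel" using assms by (auto simp: hL2_def)
  let ?b = "\<lambda>x. 2 * (indicator {0..} x * (p x)\<^sup>2) + 2 * (indicator {0..} x * (q x)\<^sup>2)"
  have b: "integrable lborel ?b" using assms by (auto simp: hL2_def)
  have le: "indicator {0..} x * (p x - q x)\<^sup>2 \<le> ?b x" for x
    using zero_le_power2[of "p x + q x"] by (auto simp: indicator_def power2_diff power2_sum)
  have "AE x in lborel. norm (indicator {0..} x * (p x - q x)\<^sup>2) \<le> norm (?b x)"
    using le by (intro AE_I2) (auto simp: indicator_def)
  then have i: "integrable lborel (\<lambda>x. indicator {0..} x * (p x - q x)\<^sup>2)"
    by (intro Bochner_Integration.integrable_bound[OF b]) simp_all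
  then show "hL2 (\<lambda>x. p x - q x)" by (simp add: hL2_def)
  have "hsq (\<lambda>x. p x - q x) \<le> integral\<^sup>L lborel ?b"
    unfolding hsq_def by (rule integral_mono[OF i b le])
  also have "\<dots> = 2 * hsq p + 2 * hsq q" using assms by (simp add: hsq_def hL2_def)
  finally show "hsq (\<lambda>x. p x - q x) \<le> 2 * hsq p + 2 * hsq q" .
qed

section \<open>Strong continuity\<close>

text \<open>A stand-in for Lipschitz continuity: uniform continuity handles close points,
  boundedness the others. The linear form is kept because it can be integrated against the
  Gaussian.\<close>

lemma compact_support_modulus:
  fixes H :: "real \<Rightarrow> real"
  assumes cont: "continuous_on UNIV H" and supp: "\<forall>y. \<bar>y\<bar> > R \<longrightarrow> H y = 0" and e: "0 < e"
  obtains L where "0 \<le> L" "\<And>a b. \<bar>H a - H b\<bar> \<le> e + L * \<bar>a - b\<bar>"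
proof -
  have comp: "compact {- R - 1..R + 1}" by simp
  have "uniformly_continuous_on {- R - 1..R + 1} H"
    by (rule compact_uniformly_continuous) (auto intro: continuous_on_subset[OF cont])
  then obtain d where d: "0 < d" "\<And>a b. a \<in> {- R - 1..R + 1} \<Longrightarrow> b \<in> {- R - 1..R + 1} \<Longrightarrow> \<bar>a - b\<bar> < d \<Longrightarrow> \<bar>H a - H b\<bar> < e"
    using e unfolding uniformly_continuous_on_def dist_real_def by (metis abs_minus_commute)
  have "bounded (H ` {- R - 1..R + 1})"
    by (intro compact_imp_bounded compact_continuous_image comp continuous_on_subset[OF cont]) auto
  then obtain M where M: "0 < M" "\<And>y. y \<in> {- R - 1..R + 1} \<Longrightarrow> \<bar>H y\<bar> \<le> M"
    by (auto simp: bounded_pos)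
  have M': "\<bar>H y\<bar> \<le> M" for y
    using M(1) M(2)[of y] supp[rule_format, of y] by (cases "\<bar>y\<bar> > R") (auto simp: abs_le_iff not_less)
  \<comment> \<open>Two points at distance below 1 either both lie in the interval enlarged by 1 or
    both lie outside the support; farther points differ in value by at most
    \<open>2 * M\<close>.\<close>
  define L where "L = 2 * M / min d 1"
  have L: "0 \<le> L" using M d by (simp add: L_def)
  show ?thesis
  proof (rule that[OF L])
    fix a b
    show "\<bar>H a - H b\<bar> \<le> e + L * \<bar>a - b\<bar>"
    proof (cases "\<bar>a - b\<bar> < min d 1")
      case True
      have "\<bar>H a - H b\<bar> \<le> e"
      proof (cases "a \<in> {- R - 1..R + 1} \<and> b \<in> {- R - 1..R + 1}")
        case True
        then show ?thesis using d(2)[of a b] \<open>\<bar>a - b\<bar> < min d 1\<close> by simp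
      next
        case False
        then have "\<bar>a\<bar> > R" "\<bar>b\<bar> > R" using True by auto
        then show ?thesis using supp e by simp
      qed
      then show ?thesis using L by (simp add: add_increasing2)
    next
      case False
      have "\<bar>H a - H b\<bar> \<le> 2 * M" using M'[of a] M'[of b] by linarith
      also have "\<dots> = L * min d 1" using d by (simp add: L_def)
      also have "\<dots> \<le> L * \<bar>a - b\<bar>" using False L by (intro mult_left_mono) auto
      finally show ?thesis using e by simp
    qed
  qed
qed

lemma compact_support_wL2:
  assumes cont: "continuous_on UNIV H" and supp: "\<forall>y. \<bar>y\<bar> > R \<longrightarrow> H y = 0"
  shows "wL2 H" "integrable lborel (\<lambda>y. \<bar>H y\<bar>)"
proof -
  have [measurable]: "H \<in> borel_measurable borel" by (rule borel_measurable_continuous_onI[OF cont])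
  have wt: "continuous_on UNIV wt" unfolding wt_def by (intro continuous_intros)
  have "integrable lborel (\<lambda>y. indicator {-R..R} y *\<^sub>R (wt y * H y)\<^sup>2)"
    by (intro borel_integrable_atLeastAtMost'[unfolded set_integrable_def] continuous_intros
        continuous_on_subset[OF cont] continuous_on_subset[OF wt]) auto
  moreover have "indicator {-R..R} y *\<^sub>R (wt y * H y)\<^sup>2 = (wt y * H y)\<^sup>2" for y
    using supp[rule_format, of y] by (cases "\<bar>y\<bar> > R") (auto simp: indicator_def abs_le_iff not_less)
  ultimately have "integrable lborel (\<lambda>y. (wt y * H y)\<^sup>2)" by (simp only:)
  then show "wL2 H" by (simp add: wL2_def)
  have "integrable lborel (\<lambda>y. indicator {-R..R} y *\<^sub>R \<bar>H y\<bar>)"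
    by (intro borel_integrable_atLeastAtMost'[unfolded set_integrable_def] continuous_intros
        continuous_on_subset[OF cont]) auto
  moreover have "indicator {-R..R} y *\<^sub>R \<bar>H y\<bar> = \<bar>H y\<bar>" for y
    using supp[rule_format, of y] by (cases "\<bar>y\<bar> > R") (auto simp: indicator_def abs_le_iff not_less)
  ultimately show "integrable lborel (\<lambda>y. \<bar>H y\<bar>)" by (simp only:)
qed

text \<open>Averaging translates does not increase the L1 norm. Combined with uniform convergence
  this gives convergence in L2.\<close>

lemma drift_heat_L1_bound:
  assumes [measurable]: "H \<in> borel_measurable borel" and H: "integrable lborel (\<lambda>y. \<bar>H y\<bar>)"
  shows "integrable lborel (\<lambda>x. \<bar>drift_heat t H x\<bar>)" "(LINT x|lborel. \<bar>drift_heat t H x\<bar>) \<le> (LINT y|lborel. \<bar>H y\<bar>)"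
proof -
  have "(\<integral>\<^sup>+x. ennreal \<bar>drift_heat t H x\<bar> \<partial>lborel)
      \<le> (\<integral>\<^sup>+x. \<integral>\<^sup>+z. ennreal (std_normal_density z * \<bar>H (x + t + sqrt (2 * t) * z)\<bar>) \<partial>lborel \<partial>lborel)"
  proof (rule nn_integral_mono)
    fix x
    let ?f = "\<lambda>z. std_normal_density z * H (x + t + sqrt (2 * t) * z)"
    show "ennreal \<bar>drift_heat t H x\<bar> \<le> (\<integral>\<^sup>+z. ennreal (std_normal_density z * \<bar>H (x + t + sqrt (2 * t) * z)\<bar>) \<partial>lborel)"
    \<comment> \<open>Where the integrand is not integrable, the integral defining the flow is 0 by
      convention and the bound is trivial.\<close>
    proof (cases "integrable lborel ?f")
      case True
      from integral_norm_bound_ennreal[OF True] show ?thesis by (simp add: drift_heat_def abs_mult)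
    qed (simp add: drift_heat_def not_integrable_integral_eq)
  qed
  also have "\<dots> = (\<integral>\<^sup>+z. \<integral>\<^sup>+x. ennreal (std_normal_density z * \<bar>H (x + t + sqrt (2 * t) * z)\<bar>) \<partial>lborel \<partial>lborel)"
    by (rule lborel_pair.Fubini') measurable
  also have "\<dots> = (\<integral>\<^sup>+z. ennreal (std_normal_density z) * (\<integral>\<^sup>+y. ennreal \<bar>H y\<bar> \<partial>lborel) \<partial>lborel)"
  proof (rule nn_integral_cong)
    fix z
    have "(\<integral>\<^sup>+x. ennreal (std_normal_density z * \<bar>H (x + t + sqrt (2 * t) * z)\<bar>) \<partial>lborel)
      = ennreal (std_normal_density z) * (\<integral>\<^sup>+x. ennreal \<bar>H (x + t + sqrt (2 * t) * z)\<bar> \<partial>lborel)"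
      by (subst nn_integral_cmult[symmetric]) (auto simp: ennreal_mult)
    also have "(\<integral>\<^sup>+x. ennreal \<bar>H (x + t + sqrt (2 * t) * z)\<bar> \<partial>lborel) = (\<integral>\<^sup>+y. ennreal \<bar>H y\<bar> \<partial>lborel)"
      by (subst nn_integral_real_affine[where c = 1 and t = "t + sqrt (2 * t) * z" and f = "\<lambda>y. ennreal \<bar>H y\<bar>"])
         (auto simp: ac_simps)
    finally show "(\<integral>\<^sup>+x. ennreal (std_normal_density z * \<bar>H (x + t + sqrt (2 * t) * z)\<bar>) \<partial>lborel)
      = ennreal (std_normal_density z) * (\<integral>\<^sup>+y. ennreal \<bar>H y\<bar> \<partial>lborel)" .
  qed
  also have "\<dots> = (\<integral>\<^sup>+z. ennreal (std_normal_density z) \<partial>lborel) * (\<integral>\<^sup>+y. ennreal \<bar>H y\<bar> \<partial>lborel)"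
    by (rule nn_integral_multc) simp
  also have "(\<integral>\<^sup>+z. ennreal (std_normal_density z) \<partial>lborel) = 1"
    by (subst nn_integral_eq_integral) auto
  finally have le: "(\<integral>\<^sup>+x. ennreal \<bar>drift_heat t H x\<bar> \<partial>lborel) \<le> ennreal (LINT y|lborel. \<bar>H y\<bar>)"
    by (simp add: nn_integral_eq_integral[OF H])
  show i: "integrable lborel (\<lambda>x. \<bar>drift_heat t H x\<bar>)"
    by (rule integrableI_bounded) (use le_less_trans[OF le ennreal_less_top] in simp_all)
  show "(LINT x|lborel. \<bar>drift_heat t H x\<bar>) \<le> (LINT y|lborel. \<bar>H y\<bar>)"
    using le by (simp add: nn_integral_eq_integral[OF i] ennreal_le_iff)
qed

text \<open>Both times share the same normal variable \<open>z\<close>, so the arguments of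
  \<open>H\<close> differ by \<open>(t - s) + (sqrt (2 * t) - sqrt (2 * s)) * z\<close>, uniformly
  in \<open>x\<close>. This form has no singularity at \<open>s = 0\<close>.\<close>

lemma drift_heat_uniform_continuity:
  assumes cont: "continuous_on UNIV H" and supp: "\<forall>y. \<bar>y\<bar> > R \<longrightarrow> H y = 0" and s: "0 \<le> s" and e: "0 < e"
  shows "\<forall>\<^sub>F t in at s within {0..}. \<forall>x. \<bar>drift_heat t H x - drift_heat s H x\<bar> \<le> e"
proof -
  obtain L where L: "0 \<le> L" "\<And>a b. \<bar>H a - H b\<bar> \<le> e / 2 + L * \<bar>a - b\<bar>"
    using compact_support_modulus[OF cont supp half_gt_zero[OF e]] by blast
  note wL2 = compact_support_wL2(1)[OF cont supp]
  define m where "m = (LINT z|lborel. std_normal_density z * \<bar>z\<bar>)"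
  have im: "integrable lborel (\<lambda>z. std_normal_density z * \<bar>z\<bar>)"
    using integrable_std_normal_moment_abs[of 1] by simp
  define B where "B t = e / 2 + L * \<bar>t - s\<bar> + L * \<bar>sqrt (2 * t) - sqrt (2 * s)\<bar> * m" for t
  have bound: "\<bar>drift_heat t H x - drift_heat s H x\<bar> \<le> B t" if t: "0 \<le> t" for t x
  proof -
    let ?g = "\<lambda>z. (e / 2 + L * \<bar>t - s\<bar>) * std_normal_density z + (L * \<bar>sqrt (2 * t) - sqrt (2 * s)\<bar>) * (std_normal_density z * \<bar>z\<bar>)"
    let ?f = "\<lambda>z. std_normal_density z * H (x + t + sqrt (2 * t) * z) - std_normal_density z * H (x + s + sqrt (2 * s) * z)"
    have ig: "integrable lborel ?g" using im by (intro Bochner_Integration.integrable_add integrable_mult_right) auto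
    have f: "integrable lborel ?f" by (intro Bochner_Integration.integrable_diff drift_heat_integrable[OF wL2] t s)
    have "\<bar>?f z\<bar> \<le> ?g z" for z
    proof -
      have "\<bar>(x + t + sqrt (2 * t) * z) - (x + s + sqrt (2 * s) * z)\<bar> = \<bar>(t - s) + (sqrt (2 * t) - sqrt (2 * s)) * z\<bar>"
        by (simp add: algebra_simps)
      also have "\<dots> \<le> \<bar>t - s\<bar> + \<bar>sqrt (2 * t) - sqrt (2 * s)\<bar> * \<bar>z\<bar>"
        by (metis abs_mult abs_triangle_ineq)
      finally have "e / 2 + L * \<bar>(x + t + sqrt (2 * t) * z) - (x + s + sqrt (2 * s) * z)\<bar>
          \<le> e / 2 + L * (\<bar>t - s\<bar> + \<bar>sqrt (2 * t) - sqrt (2 * s)\<bar> * \<bar>z\<bar>)"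
        using L(1) by (intro add_left_mono mult_left_mono)
      then have "\<bar>H (x + t + sqrt (2 * t) * z) - H (x + s + sqrt (2 * s) * z)\<bar>
          \<le> e / 2 + L * (\<bar>t - s\<bar> + \<bar>sqrt (2 * t) - sqrt (2 * s)\<bar> * \<bar>z\<bar>)"
        using L(2) order_trans by blast
      then have "std_normal_density z * \<bar>H (x + t + sqrt (2 * t) * z) - H (x + s + sqrt (2 * s) * z)\<bar>
          \<le> std_normal_density z * (e / 2 + L * (\<bar>t - s\<bar> + \<bar>sqrt (2 * t) - sqrt (2 * s)\<bar> * \<bar>z\<bar>))"
        by (intro mult_left_mono) auto
      moreover have "\<bar>?f z\<bar> = std_normal_density z * \<bar>H (x + t + sqrt (2 * t) * z) - H (x + s + sqrt (2 * s) * z)\<bar>"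
        by (simp add: right_diff_distrib[symmetric] abs_mult)
      moreover have "?g z = std_normal_density z * (e / 2 + L * (\<bar>t - s\<bar> + \<bar>sqrt (2 * t) - sqrt (2 * s)\<bar> * \<bar>z\<bar>))"
        by (simp add: algebra_simps)
      ultimately show ?thesis by simp
    qed
    then have "(LINT z|lborel. \<bar>?f z\<bar>) \<le> (LINT z|lborel. ?g z)"
      by (intro integral_mono integrable_abs f ig)
    moreover have "\<bar>LINT z|lborel. ?f z\<bar> \<le> (LINT z|lborel. \<bar>?f z\<bar>)" by (rule integral_abs_bound)
    moreover have "(LINT z|lborel. ?f z) = drift_heat t H x - drift_heat s H x"
      unfolding drift_heat_def by (intro Bochner_Integration.integral_diff drift_heat_integrable[OF wL2] t s)
    moreover have "(LINT z|lborel. ?g z) = B t"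
      using im by (subst Bochner_Integration.integral_add) (auto simp: B_def m_def)
    ultimately show ?thesis by linarith
  qed
  have "(B \<longlongrightarrow> e / 2 + L * \<bar>s - s\<bar> + L * \<bar>sqrt (2 * s) - sqrt (2 * s)\<bar> * m) (at s within {0..})"
    unfolding B_def by (intro tendsto_intros)
  then have "\<forall>\<^sub>F t in at s within {0..}. B t < e" by (rule order_tendstoD(2)) (use e in simp)
  moreover have "\<forall>\<^sub>F t in at s within {0..}. 0 \<le> t" by (simp add: eventually_at_filter)
  ultimately show ?thesis
  proof eventually_elim
    case (elim t)
    then show ?case using bound[of t] by (meson less_imp_le order_trans)
  qed
qed

text \<open>The squared difference is at most its supremum, which tends to 0, times the sum of the
  two absolute values, whose integral stays bounded.\<close>

lemma drift_heat_strong_continuity_compact_support: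
  assumes cont: "continuous_on UNIV H" and supp: "\<forall>y. \<bar>y\<bar> > R \<longrightarrow> H y = 0" and s: "0 \<le> s"
  shows "((\<lambda>t. hsq (\<lambda>x. drift_heat t H x - drift_heat s H x)) \<longlongrightarrow> 0) (at s within {0..})"
proof (rule tendstoI)
  fix e :: real assume e: "0 < e"
  note wL2 = compact_support_wL2(1)[OF cont supp]
  note [measurable] = wL2_measurable[OF wL2]
  note i1 = compact_support_wL2(2)[OF cont supp]
  define N where "N = (LINT y|lborel. \<bar>H y\<bar>)"
  have N: "0 \<le> N" by (simp add: N_def)
  \<comment> \<open>Ensures \<open>d * (2 * N) < e\<close>; the summand 1 covers
    \<open>N = 0\<close>.\<close>
  define d where "d = e / (2 * (2 * N + 1))"
  have d: "0 < d" using e N by (simp add: d_def)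
  have "d * (2 * (2 * N + 1)) = e" using N by (simp add: d_def)
  then have dN: "d * (2 * N) < e" using d mult_nonneg_nonneg[of d N] N unfolding distrib_left by linarith
  have "\<forall>\<^sub>F t in at s within {0..}. \<forall>x. \<bar>drift_heat t H x - drift_heat s H x\<bar> \<le> d"
    by (rule drift_heat_uniform_continuity[OF cont supp s d])
  moreover have "\<forall>\<^sub>F t in at s within {0..}. 0 \<le> t" by (simp add: eventually_at_filter)
  ultimately show "\<forall>\<^sub>F t in at s within {0..}. dist (hsq (\<lambda>x. drift_heat t H x - drift_heat s H x)) 0 < e"
  proof eventually_elim
    case (elim t)
    note b = drift_heat_L1_bound[of H, OF _ i1]
    let ?D = "\<lambda>x. drift_heat t H x - drift_heat s H x"
    have "hsq ?D \<le> (LINT x|lborel. d * (\<bar>drift_heat t H x\<bar> + \<bar>drift_heat s H x\<bar>))"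
      unfolding hsq_def
    proof (rule integral_mono)
      show "integrable lborel (\<lambda>x. indicator {0..} x * (?D x)\<^sup>2)"
        using hL2_diff(1)[OF drift_heat_L2_bound(1)[OF wL2] drift_heat_L2_bound(1)[OF wL2]] elim s by (auto simp: hL2_def)
      show "integrable lborel (\<lambda>x. d * (\<bar>drift_heat t H x\<bar> + \<bar>drift_heat s H x\<bar>))" using b by simp
      fix x
      have "(?D x)\<^sup>2 = \<bar>?D x\<bar> * \<bar>?D x\<bar>" by (simp add: power2_eq_square)
      also have "\<dots> \<le> d * (\<bar>drift_heat t H x\<bar> + \<bar>drift_heat s H x\<bar>)"
        using elim d by (intro mult_mono) auto
      finally show "indicator {0..} x * (?D x)\<^sup>2 \<le> d * (\<bar>drift_heat t H x\<bar> + \<bar>drift_heat s H x\<bar>)"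
        using d by (auto simp: indicator_def)
    qed
    also have "\<dots> = d * ((LINT x|lborel. \<bar>drift_heat t H x\<bar>) + (LINT x|lborel. \<bar>drift_heat s H x\<bar>))" using b by simp
    also have "\<dots> \<le> d * (N + N)" using b d unfolding N_def by (intro mult_left_mono add_mono) auto
    also have "\<dots> < e" using dN by simp
    finally show ?case by (simp add: hsq_nonneg)
  qed
qed

lemma square_diff_le: "(a - c)\<^sup>2 \<le> 2 * (a - b)\<^sup>2 + 2 * (b - c)\<^sup>2" for a b c :: real
  using zero_le_power2[of "(a - b) - (b - c)"] by (simp add: power2_eq_square algebra_simps)

text \<open>Measurability supplies continuous functions that converge only almost everywhere and
  without a common bound. Therefore \<open>clip\<close> bounds the values and \<open>cut\<close> the
  support: first \<open>k\<close> is fixed so that truncating \<open>f\<close> costs little, then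
  \<open>n\<close>, each time by dominated convergence. Division by the positive continuous weight
  returns from \<open>f\<close> to \<open>H\<close>.\<close>

lemma continuous_approximation_wL2:
  assumes H: "wL2 H" and e: "0 < e"
  obtains G R where "continuous_on UNIV G" "\<forall>y. \<bar>y\<bar> > R \<longrightarrow> G y = 0" "wsq (\<lambda>y. H y - G y) < e"
proof -
  define f where "f y = wt y * H y" for y
  note [measurable] = wL2_measurable[OF H]
  have [measurable]: "f \<in> borel_measurable borel" unfolding f_def by measurable
  have f2: "integrable lborel (\<lambda>y. (f y)\<^sup>2)" using H by (simp add: wL2_def f_def)
  have "f \<in> borel_measurable lebesgue" by (simp add: measurable_completion)
  then have "f measurable_on UNIV" by (simp add: measurable_on_iff_borel_measurable lebesgue_on_UNIV_eq)
  then obtain N g where N: "negligible N" and g: "\<And>n. continuous_on UNIV (g n)"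
    and lim: "\<And>x. x \<notin> N \<Longrightarrow> (\<lambda>n. g n x) \<longlonglongrightarrow> f x"
    unfolding measurable_on_def by auto
  have "AE x in lebesgue. x \<notin> N"
    using N by (intro AE_not_in) (simp add: negligible_iff_null_sets)
  then have AEN: "AE x in lborel. x \<notin> N" by (simp add: AE_completion_iff)
  have gm[measurable]: "g n \<in> borel_measurable borel" for n by (rule borel_measurable_continuous_onI[OF g])
  define cut where "cut k y = max 0 (min 1 (real k + 1 - \<bar>y\<bar>))" for k y
  define clip where "clip k v = max (- real k) (min (real k) v)" for k v
  define h where "h k v y = cut k y * clip k v" for k v y
  have cut: "0 \<le> cut k y" "cut k y \<le> 1" "\<bar>y\<bar> \<le> real k \<Longrightarrow> cut k y = 1" "\<bar>y\<bar> > real k + 1 \<Longrightarrow> cut k y = 0" for k y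
    by (auto simp: cut_def)
  have clip: "\<bar>clip k v\<bar> \<le> real k" "\<bar>clip k v\<bar> \<le> \<bar>v\<bar>" "\<bar>v\<bar> \<le> real k \<Longrightarrow> clip k v = v" for k v
    by (auto simp: clip_def)
  have hm[measurable]: "(\<lambda>y. h k (f y) y) \<in> borel_measurable borel" "(\<lambda>y. h k (g n y) y) \<in> borel_measurable borel" for k n
    unfolding h_def cut_def clip_def by measurable
  have habs: "\<bar>h k v y\<bar> \<le> \<bar>v\<bar>" "\<bar>h k v y\<bar> \<le> real k * cut k y" for k v y
    using mult_mono[OF cut(2)[of k y] clip(2)[of k v]] mult_mono[OF order_refl[of "cut k y"] clip(1)[of k v]] cut(1)[of k y]
    by (auto simp: h_def abs_mult mult.commute)
  have "(\<lambda>k. LINT y|lborel. (f y - h k (f y) y)\<^sup>2) \<longlonglongrightarrow> integral\<^sup>L lborel (\<lambda>y::real. 0::real)"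
  proof (rule integral_dominated_convergence[where w = "\<lambda>y. 4 * (f y)\<^sup>2"])
    show "AE y in lborel. (\<lambda>k. (f y - h k (f y) y)\<^sup>2) \<longlonglongrightarrow> 0"
    proof (rule AE_I2, rule tendsto_eventually)
      fix y
      obtain k0 where "\<bar>y\<bar> + \<bar>f y\<bar> \<le> real k0" using real_arch_simple by blast
      then have "\<bar>y\<bar> \<le> real k \<and> \<bar>f y\<bar> \<le> real k" if "k \<ge> k0" for k
        using of_nat_mono[OF that, where 'a = real] abs_ge_zero[of y] abs_ge_zero[of "f y"] by linarith
      then show "\<forall>\<^sub>F k in sequentially. (f y - h k (f y) y)\<^sup>2 = 0"
        by (intro eventually_sequentiallyI[of k0]) (simp add: h_def cut clip)
    qed
    show "AE y in lborel. norm ((f y - h k (f y) y)\<^sup>2) \<le> 4 * (f y)\<^sup>2" for k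
    proof (rule AE_I2)
      fix y
      have "\<bar>f y - h k (f y) y\<bar> \<le> \<bar>2 * f y\<bar>" using habs(1)[of k "f y" y] by linarith
      then have "(f y - h k (f y) y)\<^sup>2 \<le> (2 * f y)\<^sup>2" by (simp only: abs_le_square_iff)
      then show "norm ((f y - h k (f y) y)\<^sup>2) \<le> 4 * (f y)\<^sup>2" by (simp add: power_mult_distrib)
    qed
  qed (use f2 in simp_all)
  then have "\<forall>\<^sub>F k in sequentially. (LINT y|lborel. (f y - h k (f y) y)\<^sup>2) < e / 4"
    using e by (intro order_tendstoD(2)) auto
  then obtain k where k: "(LINT y|lborel. (f y - h k (f y) y)\<^sup>2) < e / 4"
    by (meson eventually_sequentially order_refl)
  have cutm[measurable]: "cut k \<in> borel_measurable borel" unfolding cut_def by measurable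
  have dom: "integrable lborel (\<lambda>y. (2 * real k)\<^sup>2 * indicator {- real k - 1..real k + 1} y)" by simp
  have h2: "norm ((h k v y - h k v' y)\<^sup>2) \<le> (2 * real k)\<^sup>2 * indicator {- real k - 1..real k + 1} y" for v v' y
  proof (cases "y \<in> {- real k - 1..real k + 1}")
    case True
    have "real k * cut k y \<le> real k" using cut(1)[of k y] cut(2)[of k y] by (simp add: mult_left_le)
    then have "\<bar>h k v y - h k v' y\<bar> \<le> \<bar>2 * real k\<bar>" using habs(2)[of k v y] habs(2)[of k v' y] by linarith
    then have "(h k v y - h k v' y)\<^sup>2 \<le> (2 * real k)\<^sup>2" by (simp only: abs_le_square_iff)
    then show ?thesis using True by simp
  next
    case False
    then have "cut k y = 0" by (intro cut) auto
    then show ?thesis by (simp add: h_def)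
  qed
  have ih: "integrable lborel (\<lambda>y. (h k (f y) y - h k (g n y) y)\<^sup>2)" for n
    by (rule Bochner_Integration.integrable_bound[OF dom]) (use h2 in \<open>auto intro: order_trans[OF _ abs_ge_self]\<close>)
  have if': "integrable lborel (\<lambda>y. (f y - h k (f y) y)\<^sup>2)"
  proof (rule Bochner_Integration.integrable_bound[of _ "\<lambda>y. 4 * (f y)\<^sup>2"])
    show "AE y in lborel. norm ((f y - h k (f y) y)\<^sup>2) \<le> norm (4 * (f y)\<^sup>2)"
    proof (rule AE_I2)
      fix y
      have "\<bar>f y - h k (f y) y\<bar> \<le> \<bar>2 * f y\<bar>" using habs(1)[of k "f y" y] by linarith
      then have "(f y - h k (f y) y)\<^sup>2 \<le> (2 * f y)\<^sup>2" by (simp only: abs_le_square_iff)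
      then show "norm ((f y - h k (f y) y)\<^sup>2) \<le> norm (4 * (f y)\<^sup>2)" by (simp add: power_mult_distrib)
    qed
  qed (use f2 in simp_all)
  have "(\<lambda>n. LINT y|lborel. (h k (f y) y - h k (g n y) y)\<^sup>2) \<longlonglongrightarrow> integral\<^sup>L lborel (\<lambda>y::real. 0::real)"
  proof (rule integral_dominated_convergence[OF _ _ dom])
    show "AE y in lborel. (\<lambda>n. (h k (f y) y - h k (g n y) y)\<^sup>2) \<longlonglongrightarrow> 0"
      using AEN
    proof eventually_elim
      case (elim y)
      have "(\<lambda>n. (h k (f y) y - h k (g n y) y)\<^sup>2) \<longlonglongrightarrow> (h k (f y) y - h k (f y) y)\<^sup>2"
        unfolding h_def clip_def by (intro tendsto_intros lim[OF elim])
      then show ?case by simp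
    qed
  qed (use h2 in simp_all)
  then have "\<forall>\<^sub>F n in sequentially. (LINT y|lborel. (h k (f y) y - h k (g n y) y)\<^sup>2) < e / 4"
    using e by (intro order_tendstoD(2)) auto
  then obtain n where n: "(LINT y|lborel. (h k (f y) y - h k (g n y) y)\<^sup>2) < e / 4"
    by (meson eventually_sequentially order_refl)
  define G where "G y = h k (g n y) y / wt y" for y
  show ?thesis
  proof (rule that[of G "real k + 1"])
    have "continuous_on UNIV (\<lambda>y. cut k y)" "continuous_on UNIV (\<lambda>y. clip k (g n y))"
      unfolding cut_def clip_def by (intro continuous_intros g)+
    moreover have "continuous_on UNIV wt" unfolding wt_def by (intro continuous_intros)
    ultimately show "continuous_on UNIV G"
      unfolding G_def h_def using wt_pos by (intro continuous_intros) (auto simp: less_imp_neq[symmetric])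
    show "\<forall>y. \<bar>y\<bar> > real k + 1 \<longrightarrow> G y = 0" using cut(4) by (simp add: G_def h_def)
    have "wt y * (H y - G y) = f y - h k (g n y) y" for y
      using wt_pos[of y] by (simp add: f_def G_def right_diff_distrib)
    then have "wsq (\<lambda>y. H y - G y) = (LINT y|lborel. (f y - h k (g n y) y)\<^sup>2)"
      by (simp add: wsq_def)
    also have "\<dots> \<le> (LINT y|lborel. 2 * (f y - h k (f y) y)\<^sup>2 + 2 * (h k (f y) y - h k (g n y) y)\<^sup>2)"
    proof (rule integral_mono')
      show "integrable lborel (\<lambda>y. 2 * (f y - h k (f y) y)\<^sup>2 + 2 * (h k (f y) y - h k (g n y) y)\<^sup>2)"
        using ih if' by simp
    qed (auto simp: square_diff_le)
    also have "\<dots> = 2 * (LINT y|lborel. (f y - h k (f y) y)\<^sup>2) + 2 * (LINT y|lborel. (h k (f y) y - h k (g n y) y)\<^sup>2)"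
      using ih if' by simp
    also have "\<dots> < e" using k n by simp
    finally show "wsq (\<lambda>y. H y - G y) < e" .
  qed
qed

lemma drift_heat_strong_continuity:
  assumes H: "wL2 H" and s: "0 \<le> s"
  shows "((\<lambda>t. hsq (\<lambda>x. drift_heat t H x - drift_heat s H x)) \<longlongrightarrow> 0) (at s within {0..})"
proof (rule tendstoI)
  fix e :: real assume e: "0 < e"
  \<comment> \<open>The triangle inequalities for squares below cost
    \<open>16 * wsq (\<lambda>y. H y - G y) + 2 * hsq ?E\<close>, hence less than
    \<open>e / 2 + e / 4\<close>.\<close>
  obtain G R where G: "continuous_on UNIV G" "\<forall>y. \<bar>y\<bar> > R \<longrightarrow> G y = 0" "wsq (\<lambda>y. H y - G y) < e / 32"
    using continuous_approximation_wL2[OF H, of "e / 32"] e by auto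
  note wG = compact_support_wL2(1)[OF G(1,2)]
  note wD = wL2_diff[OF H wG]
  have "\<forall>\<^sub>F t in at s within {0..}. hsq (\<lambda>x. drift_heat t G x - drift_heat s G x) < e / 8"
    by (rule order_tendstoD(2)[OF drift_heat_strong_continuity_compact_support[OF G(1,2) s]]) (use e in auto)
  moreover have "\<forall>\<^sub>F t in at s within {0..}. 0 \<le> t" by (simp add: eventually_at_filter)
  ultimately show "\<forall>\<^sub>F t in at s within {0..}. dist (hsq (\<lambda>x. drift_heat t H x - drift_heat s H x)) 0 < e"
  proof eventually_elim
    case (elim t)
    let ?A = "drift_heat t (\<lambda>y. H y - G y)" and ?B = "drift_heat s (\<lambda>y. H y - G y)"
    let ?E = "\<lambda>x. drift_heat s G x - drift_heat t G x"
    have A: "hL2 ?A" "hsq ?A \<le> 2 * wsq (\<lambda>y. H y - G y)" using drift_heat_L2_bound[OF wD] elim by auto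
    have B: "hL2 ?B" "hsq ?B \<le> 2 * wsq (\<lambda>y. H y - G y)" using drift_heat_L2_bound[OF wD] s by auto
    have E: "hL2 ?E" by (intro hL2_diff drift_heat_L2_bound wG s elim)
    have eq: "drift_heat t H x - drift_heat s H x = (?A x - ?B x) - ?E x" for x
      using drift_heat_diff[OF H wG] elim s by simp
    have "hsq (\<lambda>x. drift_heat t H x - drift_heat s H x) \<le> 2 * hsq (\<lambda>x. ?A x - ?B x) + 2 * hsq ?E"
      unfolding eq by (intro hL2_diff A B E)
    moreover have "hsq (\<lambda>x. ?A x - ?B x) \<le> 2 * hsq ?A + 2 * hsq ?B" by (intro hL2_diff A B)
    moreover have "hsq ?E = hsq (\<lambda>x. drift_heat t G x - drift_heat s G x)" by (simp add: hsq_def power2_commute)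
    ultimately have "hsq (\<lambda>x. drift_heat t H x - drift_heat s H x) < e" using A(2) B(2) elim(1) G(3) e by linarith
    then show ?case by (simp add: hsq_nonneg)
  qed
qed

section \<open>Sobolev norms of odd extensions\<close>

text \<open>\<open>weak_d2\<close> is a choice among integrands, so this is all that is known about
  it; any concrete candidate agrees with it only up to a null set.\<close>

lemma weak_d2_antiderivative:
  assumes "antiderivative (deriv u) v"
  shows "antiderivative (deriv u) (weak_d2 u)"
  using someI[of "antiderivative (deriv u)", OF assms] unfolding weak_d2_def antiderivative_def .

lemma H2_antiderivative: "H2 u \<Longrightarrow> antiderivative (deriv u) (weak_d2 u)"
  unfolding H2_def antiderivative_def[symmetric] using weak_d2_antiderivative by blast

lemma weak_d2_AE:
  assumes "antiderivative (deriv u) v"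
  shows "AE x in lebesgue. weak_d2 u x = v x"
  by (rule antiderivative_AE_unique[OF weak_d2_antiderivative[OF assms] assms])

lemma weak_d2_measurable:
  "antiderivative (deriv u) v \<Longrightarrow> weak_d2 u \<in> borel_measurable lebesgue"
  using antiderivative_measurable weak_d2_antiderivative by blast

lemma H2_DERIV: "H2 u \<Longrightarrow> (u has_real_derivative deriv u x) (at x)"
  unfolding H2_def by (simp add: DERIV_deriv_iff_real_differentiable)

text \<open>Passes from \<open>lebesgue\<close> and the chosen \<open>weak_d2\<close> to
  \<open>lborel\<close> and an explicit Borel representative, where the norms of the flow are
  computed.\<close>

lemma H2I:
  assumes u: "\<And>x. (u has_real_derivative u1 x) (at x)" and u12: "antiderivative u1 u2"
    and [measurable]: "u2 \<in> borel_measurable borel"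
    and i: "integrable lborel (\<lambda>x. (u x)\<^sup>2)" "integrable lborel (\<lambda>x. (u1 x)\<^sup>2)" "integrable lborel (\<lambda>x. (u2 x)\<^sup>2)"
  shows "H2 u"
    "H2_norm u = sqrt ((LINT x|lborel. (u x)\<^sup>2) + (LINT x|lborel. (u1 x)\<^sup>2) + (LINT x|lborel. (u2 x)\<^sup>2))"
    "deriv u = u1"
proof -
  show d: "deriv u = u1" by (intro ext DERIV_imp_deriv u)
  have ad: "antiderivative (deriv u) u2" using u12 by (simp add: d)
  have wm[measurable]: "weak_d2 u \<in> borel_measurable lebesgue" by (rule weak_d2_measurable[OF ad])
  have u2m: "u2 \<in> borel_measurable lebesgue" by (simp add: measurable_completion)
  have ae: "AE x in lebesgue. (weak_d2 u x)\<^sup>2 = (u2 x)\<^sup>2" using weak_d2_AE[OF ad] by eventually_elim simp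
  have m2: "(\<lambda>x. (weak_d2 u x)\<^sup>2) \<in> borel_measurable lebesgue" "(\<lambda>x. (u2 x)\<^sup>2) \<in> borel_measurable lebesgue"
    using wm u2m by measurable
  have i': "integrable lebesgue (\<lambda>x. (u x)\<^sup>2)" "integrable lebesgue (\<lambda>x. (u1 x)\<^sup>2)" "integrable lebesgue (\<lambda>x. (u2 x)\<^sup>2)"
    using i by (auto simp: integrable_completion dest: borel_measurable_integrable)
  have "integrable lebesgue (\<lambda>x. (weak_d2 u x)\<^sup>2)"
    using integrable_cong_AE[OF m2 ae] i'(3) by simp
  then show "H2 u"
    unfolding H2_def antiderivative_def[symmetric]
    using i' ad u d by (auto simp: real_differentiable_def)
  have "(LINT x|lebesgue. (weak_d2 u x)\<^sup>2) = (LINT x|lebesgue. (u2 x)\<^sup>2)"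
    by (rule integral_cong_AE[OF m2 ae])
  then show "H2_norm u = sqrt ((LINT x|lborel. (u x)\<^sup>2) + (LINT x|lborel. (u1 x)\<^sup>2) + (LINT x|lborel. (u2 x)\<^sup>2))"
    using i by (simp add: H2_norm_def d integral_completion borel_measurable_integrable)
qed

section \<open>Gluing and reflection at the origin\<close>

lemma antiderivative_glue:
  assumes pos: "\<And>a b. 0 \<le> a \<Longrightarrow> a \<le> b \<Longrightarrow> (f has_integral (F b - F a)) {a..b}"
    and neg: "\<And>a b. a \<le> b \<Longrightarrow> b \<le> 0 \<Longrightarrow> (f has_integral (F b - F a)) {a..b}"
  shows "antiderivative F f"
  unfolding antiderivative_def
proof (intro allI impI)
  fix a b :: real assume ab: "a \<le> b"
  consider "0 \<le> a" | "b \<le> 0" | "a \<le> 0" "0 \<le> b" by linarith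
  then show "(f has_integral (F b - F a)) {a..b}"
  proof cases
    case 3
    show ?thesis using has_integral_combine[OF 3 neg[OF 3(1)] pos[OF _ 3(2)]] by simp
  qed (use pos neg ab in auto)
qed

text \<open>\<open>q\<close> is a function of the distance to the origin, so both branches are data
  on the half-line.\<close>

definition glue :: "(real \<Rightarrow> real) \<Rightarrow> (real \<Rightarrow> real) \<Rightarrow> real \<Rightarrow> real" where
  "glue p q y = (if 0 \<le> y then p y else q (- y))"

lemma glue_measurable[measurable]:
  assumes [measurable]: "p \<in> borel_measurable borel" "q \<in> borel_measurable borel"
  shows "glue p q \<in> borel_measurable borel"
  unfolding glue_def[abs_def] by measurable

text \<open>The reflection contributes the minus sign, and matching values at 0 exclude a jump of
  the glued antiderivative; the integrand itself may jump.\<close>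

lemma glue_antiderivative:
  assumes P: "antiderivative P p" and Q: "antiderivative Q q" and 0: "P 0 = Q 0"
  shows "antiderivative (glue P Q) (glue p (\<lambda>s. - q s))"
proof (rule antiderivative_glue)
  fix a b :: real assume "0 \<le> a" "a \<le> b"
  then show "(glue p (\<lambda>s. - q s) has_integral (glue P Q b - glue P Q a)) {a..b}"
    using antiderivativeD[OF P, of a b] has_integral_cong[of "{a..b}" "glue p (\<lambda>s. - q s)" p] by (simp add: glue_def)
next
  fix a b :: real assume ab: "a \<le> b" "b \<le> 0"
  have "(q has_integral (Q (- a) - Q (- b))) {- b..- a}" using antiderivativeD[OF Q, of "- b" "- a"] ab by simp
  then have "((\<lambda>x. q (- x)) has_integral (Q (- a) - Q (- b))) {a..b}" by (subst (asm) has_integral_reflect_real[symmetric]) simp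
  then have "((\<lambda>x. - q (- x)) has_integral - (Q (- a) - Q (- b))) {a..b}" by (rule has_integral_neg)
  moreover have "glue P Q x = Q (- x)" if "x \<le> 0" for x using that 0 by (auto simp: glue_def)
  ultimately have "((\<lambda>x. - q (- x)) has_integral (glue P Q b - glue P Q a)) {a..b}" using ab by simp
  then show "(glue p (\<lambda>s. - q s) has_integral (glue P Q b - glue P Q a)) {a..b}"
    by (rule has_integral_spike_finite[of "{0}", rotated 2]) (use ab in \<open>auto simp: glue_def\<close>)
qed

text \<open>The value at 0 is \<open>p 0\<close>, so this is a genuinely odd function only when
  \<open>p 0 = 0\<close>.\<close>

definition odd_ext :: "(real \<Rightarrow> real) \<Rightarrow> real \<Rightarrow> real" where
  "odd_ext p x = (if 0 \<le> x then p x else - p (- x))"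

lemma odd_ext_DERIV:
  assumes p: "\<And>x. (p has_real_derivative p1 x) (at x)" and p0: "p 0 = 0"
  shows "(odd_ext p has_real_derivative p1 \<bar>x\<bar>) (at x)"
proof -
  consider "x > 0" | "x < 0" | "x = 0" by linarith
  then show ?thesis
  proof cases
    case 1
    show ?thesis
      by (rule has_field_derivative_transform_within_open[where S = "{0<..}" and f = p])
         (use p 1 in \<open>auto simp: odd_ext_def\<close>)
  next
    case 2
    have "((\<lambda>x. - p (- x)) has_real_derivative - (p1 (- x) * (- 1))) (at x)"
      by (rule DERIV_minus, rule DERIV_chain2[OF p]) (auto intro!: derivative_eq_intros)
    then have "((\<lambda>x. - p (- x)) has_real_derivative p1 \<bar>x\<bar>) (at x)" using 2 by simp
    then show ?thesis
      by (rule has_field_derivative_transform_within_open[where S = "{..<0}"])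
         (use 2 in \<open>auto simp: odd_ext_def\<close>)
  next
    case 3
    \<comment> \<open>At the origin the difference quotient of the odd extension is even in
      \<open>h\<close>, so the right-hand quotient of \<open>p\<close> determines both
      sides.\<close>
    have "((\<lambda>k. p k / k) \<longlongrightarrow> p1 0) (at 0)"
      using p[of 0] p0 by (simp add: has_field_derivative_iff)
    moreover have "filterlim (\<lambda>h::real. \<bar>h\<bar>) (at 0) (at 0)"
      unfolding filterlim_at by (auto intro!: tendsto_eq_intros simp: eventually_at_filter)
    ultimately have "((\<lambda>h. p \<bar>h\<bar> / \<bar>h\<bar>) \<longlongrightarrow> p1 0) (at 0)" by (rule filterlim_compose)
    moreover have "p \<bar>h\<bar> / \<bar>h\<bar> = odd_ext p h / h" for h by (simp add: odd_ext_def)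
    ultimately show ?thesis using p0 by (simp add: 3 has_field_derivative_iff odd_ext_def)
  qed
qed

text \<open>The interface jump enters here: \<open>p2 0\<close> need not vanish, so
  \<open>odd_ext p2\<close> serves as an integrand and not as a pointwise derivative.\<close>

lemma antiderivative_even_odd_ext:
  assumes "antiderivative p1 p2"
  shows "antiderivative (\<lambda>x. p1 \<bar>x\<bar>) (odd_ext p2)"
proof -
  have "(\<lambda>x. p1 \<bar>x\<bar>) = glue p1 p1" "odd_ext p2 = glue p2 (\<lambda>s. - p2 s)"
    by (auto simp: glue_def odd_ext_def)
  then show ?thesis using glue_antiderivative[OF assms assms] by simp
qed

lemma square_abs_integral:
  assumes "hL2 p"
  shows "integrable lborel (\<lambda>x. (p \<bar>x\<bar>)\<^sup>2)" "(LINT x|lborel. (p \<bar>x\<bar>)\<^sup>2) = 2 * hsq p"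
proof -
  have [measurable]: "p \<in> borel_measurable borel" using assms by (simp add: hL2_def)
  let ?f = "\<lambda>x. indicator {0..} x * (p x)\<^sup>2"
  have f: "integrable lborel ?f" using assms by (simp add: hL2_def)
  have g: "integrable lborel (\<lambda>x. ?f (0 + (- 1) * x))" by (rule lborel_integrable_real_affine[OF f]) simp
  have geq: "(LINT x|lborel. ?f (0 + (- 1) * x)) = (LINT x|lborel. ?f x)"
    using lborel_integral_real_affine[of "- 1" ?f 0] by simp
  have ae: "AE x in lborel. ?f x + ?f (0 + (- 1) * x) = (p \<bar>x\<bar>)\<^sup>2"
    using AE_lborel_singleton[of "0::real"] by eventually_elim (auto simp: indicator_def)
  have m: "(\<lambda>x. ?f x + ?f (0 + (- 1) * x)) \<in> borel_measurable lborel" "(\<lambda>x. (p \<bar>x\<bar>)\<^sup>2) \<in> borel_measurable lborel"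
    by measurable
  show "integrable lborel (\<lambda>x. (p \<bar>x\<bar>)\<^sup>2)"
    using integrable_cong_AE[OF m ae] f g by simp
  show "(LINT x|lborel. (p \<bar>x\<bar>)\<^sup>2) = 2 * hsq p"
    using integral_cong_AE[OF m ae] Bochner_Integration.integral_add[OF f g] geq by (simp add: hsq_def)
qed

lemma odd_ext_square: "(odd_ext p x)\<^sup>2 = (p \<bar>x\<bar>)\<^sup>2"
  by (simp add: odd_ext_def)

lemma odd_ext_measurable[measurable]:
  assumes [measurable]: "p \<in> borel_measurable borel"
  shows "odd_ext p \<in> borel_measurable borel"
  unfolding odd_ext_def[abs_def] by measurable

lemma odd_ext_H2:
  assumes p: "\<And>x. (p has_real_derivative p1 x) (at x)" and p0: "p 0 = 0" and p12: "antiderivative p1 p2"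
    and L2: "hL2 p" "hL2 p1" "hL2 p2"
  shows "H2 (odd_ext p)" "H2_norm (odd_ext p) = sqrt (2 * hsq p + 2 * hsq p1 + 2 * hsq p2)"
    "deriv (odd_ext p) = (\<lambda>x. p1 \<bar>x\<bar>)"
proof -
  have m[measurable]: "p2 \<in> borel_measurable borel" using L2 by (simp add: hL2_def)
  note * = H2I[OF odd_ext_DERIV[of p p1, OF p p0] antiderivative_even_odd_ext[OF p12] odd_ext_measurable[OF m]]
  show "H2 (odd_ext p)" "H2_norm (odd_ext p) = sqrt (2 * hsq p + 2 * hsq p1 + 2 * hsq p2)"
    "deriv (odd_ext p) = (\<lambda>x. p1 \<bar>x\<bar>)"
    using * by (simp_all add: odd_ext_square square_abs_integral L2)
qed

lemma odd_ext_W2inf: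
  assumes p: "\<And>x. (p has_real_derivative p1 x) (at x)" and p0: "p 0 = 0" and p12: "antiderivative p1 p2"
    and L2: "hL2 p" "hL2 p1" "hL2 p2"
    and c: "\<And>x. 0 \<le> x \<Longrightarrow> \<bar>p x\<bar> \<le> c" "\<And>x. 0 \<le> x \<Longrightarrow> \<bar>p1 x\<bar> \<le> c" "\<And>x. 0 \<le> x \<Longrightarrow> \<bar>p2 x\<bar> \<le> c"
  shows "0 \<le> W2inf_norm (odd_ext p)" "W2inf_norm (odd_ext p) \<le> ereal (3 * c)"
proof -
  have [measurable]: "p \<in> borel_measurable borel" "p1 \<in> borel_measurable borel" "p2 \<in> borel_measurable borel"
    using L2 by (auto simp: hL2_def)
  note d = odd_ext_H2(3)[of p p1, OF p p0 p12 L2]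
  have ad: "antiderivative (deriv (odd_ext p)) (odd_ext p2)"
    unfolding d by (rule antiderivative_even_odd_ext[OF p12])
  have nonneg: "0 \<le> esssup lebesgue (\<lambda>x. ereal \<bar>f x\<bar>)" for f :: "real \<Rightarrow> real"
  proof -
    have "esssup lebesgue (\<lambda>x::real. 0::ereal) \<le> esssup lebesgue (\<lambda>x. ereal \<bar>f x\<bar>)"
      by (rule esssup_mono) auto
    then show ?thesis by (simp add: esssup_const)
  qed
  show "0 \<le> W2inf_norm (odd_ext p)"
    unfolding W2inf_norm_def by (intro add_nonneg_nonneg nonneg)
  have "esssup lebesgue (\<lambda>x. ereal \<bar>odd_ext p x\<bar>) \<le> ereal c"
  proof (rule esssup_I)
    show "(\<lambda>x. ereal \<bar>odd_ext p x\<bar>) \<in> borel_measurable lebesgue" by (intro measurable_completion) simp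
  qed (use c(1) in \<open>auto simp: odd_ext_def\<close>)
  moreover have "esssup lebesgue (\<lambda>x. ereal \<bar>deriv (odd_ext p) x\<bar>) \<le> ereal c"
    unfolding d
  proof (rule esssup_I)
    show "(\<lambda>x. ereal \<bar>p1 \<bar>x\<bar>\<bar>) \<in> borel_measurable lebesgue" by (intro measurable_completion) simp
  qed (use c(2) in auto)
  moreover have "esssup lebesgue (\<lambda>x. ereal \<bar>weak_d2 (odd_ext p) x\<bar>) \<le> ereal c"
  proof (rule esssup_I)
    show "(\<lambda>x. ereal \<bar>weak_d2 (odd_ext p) x\<bar>) \<in> borel_measurable lebesgue"
      using weak_d2_measurable[OF ad] by measurable
    show "AE x in lebesgue. ereal \<bar>weak_d2 (odd_ext p) x\<bar> \<le> ereal c"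
      using weak_d2_AE[OF ad] by eventually_elim (use c(3) in \<open>auto simp: odd_ext_def\<close>)
  qed
  ultimately have "W2inf_norm (odd_ext p) \<le> ereal c + ereal c + ereal c"
    unfolding W2inf_norm_def by (intro add_mono)
  then show "W2inf_norm (odd_ext p) \<le> ereal (3 * c)" by simp
qed

text \<open>The second term comes from \<open>0 \<le> \<integral> (v - m)\<^sup>2\<close> over an interval of length at most one,
  where \<open>m\<close> is the integral of \<open>v\<close> over it.\<close>
lemma sobolev_sup_bound:
  assumes gv: "antiderivative g v" and g2: "integrable lebesgue (\<lambda>x. (g x)\<^sup>2)" and v2: "integrable lebesgue (\<lambda>x. (v x)\<^sup>2)"
  shows "\<bar>g x\<bar> \<le> sqrt (LINT x|lebesgue. (g x)\<^sup>2) + sqrt (LINT x|lebesgue. (v x)\<^sup>2)"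
proof -
  have sub: "f integrable_on {a..b}" "integral {a..b} f \<le> (LINT x|lebesgue. f x)"
    if f: "integrable lebesgue f" "\<And>x. 0 \<le> f x" for f :: "real \<Rightarrow> real" and a b
  proof -
    have i: "(f has_integral (LINT x|lebesgue. f x)) UNIV" by (rule has_integral_integral_lebesgue[OF f(1)])
    then have "f integrable_on UNIV" by (rule has_integral_integrable)
    then show j: "f integrable_on {a..b}" using integrable_on_subcbox[of f UNIV a b] by simp
    show "integral {a..b} f \<le> (LINT x|lebesgue. f x)"
      by (rule has_integral_subset_le[OF _ integrable_integral[OF j] i]) (use f in auto)
  qed
  \<comment> \<open>At a minimiser \<open>y\<close> over an interval of length 1,
    \<open>(g y)\<^sup>2\<close> is at most the integral of the square. The passage from
    \<open>y\<close> back to \<open>x\<close> costs \<open>m\<close>.\<close>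
  have "continuous_on {x..x+1} (\<lambda>y. (g y)\<^sup>2)"
    by (intro continuous_intros antiderivative_continuous[OF gv])
  then obtain y where y: "y \<in> {x..x+1}" "\<And>z. z \<in> {x..x+1} \<Longrightarrow> (g y)\<^sup>2 \<le> (g z)\<^sup>2"
    using continuous_attains_inf[of "{x..x+1}" "\<lambda>y. (g y)\<^sup>2"] by auto
  have "(g y)\<^sup>2 = integral {x..x+1} (\<lambda>_. (g y)\<^sup>2)" by simp
  also have "\<dots> \<le> integral {x..x+1} (\<lambda>z. (g z)\<^sup>2)"
    by (rule integral_le[OF integrable_const_ivl sub(1)[OF g2]]) (use y in auto)
  also have "\<dots> \<le> (LINT x|lebesgue. (g x)\<^sup>2)" by (intro sub g2) auto
  finally have gy: "\<bar>g y\<bar> \<le> sqrt (LINT x|lebesgue. (g x)\<^sup>2)" by (simp add: real_le_rsqrt)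
  define m where "m = g y - g x"
  have xy: "x \<le> y" "y - x \<le> 1" using y by auto
  have v: "(v has_integral m) {x..y}" unfolding m_def by (rule antiderivativeD[OF gv xy(1)])
  have sq: "((\<lambda>z. (v z)\<^sup>2) has_integral integral {x..y} (\<lambda>z. (v z)\<^sup>2)) {x..y}"
    by (intro integrable_integral sub v2) auto
  have const: "((\<lambda>z. m\<^sup>2) has_integral (y - x) * m\<^sup>2) {x..y}"
    using has_integral_const_real[of "m\<^sup>2" x y] xy by simp
  have "((\<lambda>z. (v z)\<^sup>2 - (2 * m) * v z + m\<^sup>2) has_integral (integral {x..y} (\<lambda>z. (v z)\<^sup>2) - (2 * m) * m + (y - x) * m\<^sup>2)) {x..y}"
    by (intro has_integral_add has_integral_diff sq const has_integral_mult_right v)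
  then have "0 \<le> integral {x..y} (\<lambda>z. (v z)\<^sup>2) - (2 * m) * m + (y - x) * m\<^sup>2"
  proof (rule has_integral_nonneg)
    fix z
    show "0 \<le> (v z)\<^sup>2 - (2 * m) * v z + m\<^sup>2" using zero_le_power2[of "v z - m"] by (simp add: power2_diff algebra_simps)
  qed
  moreover have "(y - x) * m\<^sup>2 \<le> 1 * m\<^sup>2" using xy by (intro mult_right_mono) auto
  ultimately have "m\<^sup>2 \<le> integral {x..y} (\<lambda>z. (v z)\<^sup>2)" by (simp add: power2_eq_square)
  also have "\<dots> \<le> (LINT x|lebesgue. (v x)\<^sup>2)" by (intro sub v2) auto
  finally have "\<bar>m\<bar> \<le> sqrt (LINT x|lebesgue. (v x)\<^sup>2)" by (simp add: real_le_rsqrt)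
  then show ?thesis using gy unfolding m_def by linarith
qed

lemma sqrt_LINT_le_H2_norm:
  "sqrt (LINT x|lebesgue. (u x)\<^sup>2) \<le> H2_norm u" "sqrt (LINT x|lebesgue. (deriv u x)\<^sup>2) \<le> H2_norm u"
  "sqrt (LINT x|lebesgue. (weak_d2 u x)\<^sup>2) \<le> H2_norm u"
  unfolding H2_norm_def by (intro real_sqrt_le_mono; simp add: add_nonneg_nonneg add_increasing add_increasing2)+

lemma H2_sup_bound:
  assumes "H2 u"
  shows "\<bar>u x\<bar> \<le> 2 * H2_norm u" "\<bar>deriv u x\<bar> \<le> 2 * H2_norm u"
proof -
  have i: "integrable lebesgue (\<lambda>x. (u x)\<^sup>2)" "integrable lebesgue (\<lambda>x. (deriv u x)\<^sup>2)" "integrable lebesgue (\<lambda>x. (weak_d2 u x)\<^sup>2)"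
    using assms by (auto simp: H2_def)
  show "\<bar>u x\<bar> \<le> 2 * H2_norm u"
    using sobolev_sup_bound[OF antiderivative_of_derivative[OF H2_DERIV[OF assms]] i(1,2), of x]
      sqrt_LINT_le_H2_norm(1,2)[of u] by linarith
  show "\<bar>deriv u x\<bar> \<le> 2 * H2_norm u"
    using sobolev_sup_bound[OF H2_antiderivative[OF assms] i(2,3), of x]
      sqrt_LINT_le_H2_norm(2,3)[of u] by linarith
qed

lemma integrable_square_diff:
  assumes [measurable]: "f \<in> borel_measurable M" "g \<in> borel_measurable M"
    and fg: "integrable M (\<lambda>x. (f x)\<^sup>2)" "integrable M (\<lambda>x. (g x)\<^sup>2)"
  shows "integrable M (\<lambda>x. (f x - g x :: real)\<^sup>2)"
proof (rule Bochner_Integration.integrable_bound[of _ "\<lambda>x. 2 * (f x)\<^sup>2 + 2 * (g x)\<^sup>2"])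
  have "(f x - g x)\<^sup>2 \<le> 2 * (f x)\<^sup>2 + 2 * (g x)\<^sup>2" for x using square_diff_le[of "f x" "g x" 0] by simp
  then show "AE x in M. norm ((f x - g x)\<^sup>2) \<le> norm (2 * (f x)\<^sup>2 + 2 * (g x)\<^sup>2)" by (simp add: add_nonneg_nonneg)
qed (use fg in simp_all)

text \<open>\<open>in_class\<close> measures the increments \<open>w t - w s\<close>; their
  membership in H2 follows from that of the two perturbations of \<open>W0\<close>.\<close>

lemma H2_diff:
  assumes u: "H2 u" and v: "H2 v"
  shows "H2 (\<lambda>x. u x - v x)"
proof -
  have D: "((\<lambda>x. u x - v x) has_real_derivative (deriv u x - deriv v x)) (at x)" for x
    by (intro DERIV_diff H2_DERIV u v)
  have d: "deriv (\<lambda>x. u x - v x) = (\<lambda>x. deriv u x - deriv v x)" by (intro ext DERIV_imp_deriv D)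
  have ad: "antiderivative (deriv (\<lambda>x. u x - v x)) (\<lambda>x. weak_d2 u x - weak_d2 v x)"
    unfolding d by (intro antiderivative_diff H2_antiderivative u v)
  have cont: "continuous_on UNIV u" "continuous_on UNIV (deriv u)" if "H2 u" for u
    using antiderivative_continuous[OF H2_antiderivative[OF that]]
      antiderivative_continuous[OF antiderivative_of_derivative[OF H2_DERIV[OF that]]] by auto
  have m: "u \<in> borel_measurable lebesgue" "deriv u \<in> borel_measurable lebesgue" if "H2 u" for u
    using cont[OF that, THEN borel_measurable_continuous_onI] by (auto simp: measurable_completion)
  have w: "weak_d2 u \<in> borel_measurable lebesgue" "weak_d2 v \<in> borel_measurable lebesgue"
    using antiderivative_measurable H2_antiderivative u v by blast+
  have ae: "AE x in lebesgue. (weak_d2 u x - weak_d2 v x)\<^sup>2 = (weak_d2 (\<lambda>x. u x - v x) x)\<^sup>2"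
    using weak_d2_AE[OF ad] by eventually_elim simp
  have i: "integrable lebesgue (\<lambda>x. (weak_d2 u x - weak_d2 v x)\<^sup>2)"
    using u v by (intro integrable_square_diff w) (auto simp: H2_def)
  have "integrable lebesgue (\<lambda>x. (weak_d2 (\<lambda>x. u x - v x) x)\<^sup>2)"
  proof -
    have "(\<lambda>x. (weak_d2 u x - weak_d2 v x)\<^sup>2) \<in> borel_measurable lebesgue" using i by auto
    moreover have "(\<lambda>x. (weak_d2 (\<lambda>x. u x - v x) x)\<^sup>2) \<in> borel_measurable lebesgue"
      using weak_d2_measurable[OF ad] by measurable
    ultimately show ?thesis using integrable_cong_AE[OF _ _ ae] i by blast
  qed
  moreover have "integrable lebesgue (\<lambda>x. (u x - v x)\<^sup>2)" "integrable lebesgue (\<lambda>x. (deriv u x - deriv v x)\<^sup>2)"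
    using u v by (intro integrable_square_diff m; simp add: H2_def)+
  moreover have "(\<lambda>x. u x - v x) differentiable at x" for x using D real_differentiable_def by blast
  ultimately show ?thesis
    unfolding H2_def antiderivative_def[symmetric] d using ad[unfolded d] by blast
qed

section \<open>Continuity and boundedness of functions in the solution class\<close>

text \<open>The Sobolev bound turns continuity in time with values in H2 into convergence uniform in
  \<open>x\<close>.\<close>

lemma in_class_uniform:
  assumes w: "in_class w" and s: "0 \<le> s" and e: "0 < e"
  obtains d where "0 < d" "\<And>t x. 0 \<le> t \<Longrightarrow> \<bar>t - s\<bar> < d \<Longrightarrow> \<bar>w t x - w s x\<bar> < e"
proof -
  have "((\<lambda>t. H2_norm (\<lambda>x. w t x - w s x)) \<longlongrightarrow> 0) (at s within {0..})" using w s by (simp add: in_class_def)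
  then have "\<forall>\<^sub>F t in at s within {0..}. H2_norm (\<lambda>x. w t x - w s x) < e / 2"
    by (rule order_tendstoD(2)) (use e in simp)
  then obtain d where d: "0 < d" "\<And>t. 0 \<le> t \<Longrightarrow> t \<noteq> s \<Longrightarrow> \<bar>t - s\<bar> < d \<Longrightarrow> H2_norm (\<lambda>x. w t x - w s x) < e / 2"
    by (auto simp: eventually_at dist_real_def)
  have "\<bar>w t x - w s x\<bar> < e" if t: "0 \<le> t" "\<bar>t - s\<bar> < d" for t x
  proof (cases "t = s")
    case False
    have "H2 (\<lambda>x. w t x - W0 x)" "H2 (\<lambda>x. w s x - W0 x)" using w t s by (auto simp: in_class_def)
    from H2_diff[OF this] have "H2 (\<lambda>x. w t x - w s x)" by simp
    from H2_sup_bound(1)[OF this, of x] d(2)[OF t(1) False t(2)] show ?thesis by linarith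
  qed (use e in simp)
  with d(1) show ?thesis by (rule that)
qed

lemma in_class_continuous:
  assumes w: "in_class w"
  shows "continuous_on ({0..} \<times> A) (\<lambda>(t, x). w t x - W0 x)"
  unfolding continuous_on_iff
proof (clarsimp simp: dist_Pair_Pair dist_real_def)
  fix s y :: real and e :: real assume s: "0 \<le> s" and e: "0 < e"
  obtain d where d: "0 < d" "\<And>t x. 0 \<le> t \<Longrightarrow> \<bar>t - s\<bar> < d \<Longrightarrow> \<bar>w t x - w s x\<bar> < e / 2"
    using in_class_uniform[OF w s, of "e / 2"] e by auto
  have "isCont (\<lambda>x. w s x - W0 x) y"
    using H2_DERIV[of "\<lambda>x. w s x - W0 x"] w s by (auto simp: in_class_def intro: DERIV_isCont)
  then obtain d' where d': "0 < d'" "\<And>x. \<bar>x - y\<bar> < d' \<Longrightarrow> \<bar>(w s x - W0 x) - (w s y - W0 y)\<bar> < e / 2"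
    unfolding continuous_at_eps_delta dist_real_def using e by (meson half_gt_zero)
  show "\<exists>r>0. \<forall>t\<in>{0..}. \<forall>x\<in>A. sqrt ((t - s)\<^sup>2 + (x - y)\<^sup>2) < r \<longrightarrow> \<bar>w t x - W0 x - (w s y - W0 y)\<bar> < e"
  proof (intro exI[of _ "min d d'"] conjI ballI impI)
    fix t x assume t: "t \<in> {0..}" and r: "sqrt ((t - s)\<^sup>2 + (x - y)\<^sup>2) < min d d'"
    have "\<bar>t - s\<bar> \<le> sqrt ((t - s)\<^sup>2 + (x - y)\<^sup>2)" "\<bar>x - y\<bar> \<le> sqrt ((t - s)\<^sup>2 + (x - y)\<^sup>2)"
      using real_sqrt_sum_squares_ge1[of "\<bar>t - s\<bar>" "x - y"] real_sqrt_sum_squares_ge2[of "\<bar>x - y\<bar>" "t - s"]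
      unfolding power2_abs .
    then have "\<bar>t - s\<bar> < d" "\<bar>x - y\<bar> < d'" using r by linarith+
    then have "\<bar>w t x - w s x\<bar> < e / 2" "\<bar>(w s x - W0 x) - (w s y - W0 y)\<bar> < e / 2"
      using d(2) d'(2) t by auto
    then show "\<bar>w t x - W0 x - (w s y - W0 y)\<bar> < e" by linarith
  qed (use d d' in auto)
qed

text \<open>Compactness of the time interval. Together with joint continuity up to
  \<open>t = 0\<close>, this supplies the hypotheses of the maximum principle that
  \<open>odd_mburgers_sol\<close> does not contain.\<close>

lemma in_class_bounded:
  assumes w: "in_class w"
  obtains M where "\<And>t x. 0 \<le> t \<Longrightarrow> t \<le> T \<Longrightarrow> \<bar>w t x - W0 x\<bar> \<le> M"
proof -
  have "\<exists>d>0. \<forall>t x. 0 \<le> t \<longrightarrow> \<bar>t - s\<bar> < d \<longrightarrow> \<bar>w t x - w s x\<bar> < 1" if "s \<in> {0..T}" for s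
    using in_class_uniform[OF w, of s 1] that by (metis atLeastAtMost_iff zero_less_one)
  then obtain d where d: "\<And>s. s \<in> {0..T} \<Longrightarrow> 0 < d s"
    "\<And>s t x. s \<in> {0..T} \<Longrightarrow> 0 \<le> t \<Longrightarrow> \<bar>t - s\<bar> < d s \<Longrightarrow> \<bar>w t x - w s x\<bar> < 1" by metis
  obtain C where C: "C \<subseteq> {0..T}" "finite C" "{0..T} \<subseteq> (\<Union>s\<in>C. ball s (d s))"
    by (rule compactE_image[of "{0..T}" "{0..T}" "\<lambda>s. ball s (d s)"]) (use d in auto)
  \<comment> \<open>The sum over the finite cover serves as an upper bound for its maximum; 1
    accounts for the distance to the nearest chosen time.\<close>
  define M where "M = 1 + (\<Sum>s\<in>C. 2 * H2_norm (\<lambda>x. w s x - W0 x))"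
  have nn: "0 \<le> H2_norm u" for u by (simp add: H2_norm_def)
  have "\<bar>w t x - W0 x\<bar> \<le> M" if t: "0 \<le> t" "t \<le> T" for t x
  proof -
    obtain s where s: "s \<in> C" "\<bar>t - s\<bar> < d s" using C(3) t by (force simp: dist_real_def abs_minus_commute)
    have "\<bar>w s x - W0 x\<bar> \<le> 2 * H2_norm (\<lambda>x. w s x - W0 x)"
      using w s(1) C(1) by (intro H2_sup_bound) (auto simp: in_class_def)
    also have "\<dots> \<le> (\<Sum>s\<in>C. 2 * H2_norm (\<lambda>x. w s x - W0 x))"
      by (rule member_le_sum[OF s(1)]) (use nn C in auto)
    finally have "\<bar>w s x - W0 x\<bar> \<le> (\<Sum>s\<in>C. 2 * H2_norm (\<lambda>x. w s x - W0 x))" .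
    moreover have "\<bar>w t x - w s x\<bar> < 1" using d(2)[of s t x] s C(1) t by auto
    ultimately show ?thesis unfolding M_def by linarith
  qed
  then show ?thesis by (rule that)
qed

section \<open>Exponential weights, the shock profile and uniqueness\<close>

lemma LBINT_exp: "a \<le> b \<Longrightarrow> (LINT y:{a..b}|lborel. exp y) = exp b - exp (a::real)"
  by (rule antiderivative_LBINT[OF antiderivative_of_derivative[of exp exp] borel_integrable_atLeastAtMost'])
     (auto intro!: continuous_intros)

text \<open>Integration by parts for an antiderivative that need not be differentiable, by Fubini.\<close>
lemma antiderivative_exp_mult:
  fixes g g1 :: "real \<Rightarrow> real"
  assumes g: "antiderivative g g1" and [measurable]: "g1 \<in> borel_measurable borel"
    and int: "\<And>a b. set_integrable lborel {a..b} g1"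
  shows "antiderivative (\<lambda>y. exp y * g y) (\<lambda>y. exp y * (g y + g1 y))"
proof (rule antiderivativeI_LBINT)
  fix a b :: real assume ab: "a \<le> b"
  have gc: "continuous_on {a..b} g" by (rule antiderivative_continuous[OF g])
  have ieg: "set_integrable lborel {a..b} (\<lambda>y. exp y * g y)"
    by (intro borel_integrable_atLeastAtMost' continuous_intros gc)
  have iexp: "set_integrable lborel {a..b} (exp :: real \<Rightarrow> real)"
    by (rule borel_integrable_atLeastAtMost'[OF continuous_on_exp[OF continuous_on_id]])
  have ieg1: "set_integrable lborel {a..b} (\<lambda>y. exp y * g1 y)"
    unfolding set_integrable_def
  proof (rule Bochner_Integration.integrable_bound)
    show "integrable lborel (\<lambda>y. exp b * (indicator {a..b} y *\<^sub>R g1 y))"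
      using int[of a b] by (simp add: set_integrable_def)
  qed (auto simp: indicator_def abs_mult intro!: mult_right_mono)
  show "set_integrable lborel {a..b} (\<lambda>y. exp y * (g y + g1 y))"
    using set_integral_add(1)[OF ieg ieg1] by (simp add: distrib_left)
  \<comment> \<open>\<open>f\<close> lives on the triangle \<open>a \<le> s \<le> y \<le> b\<close>.
    Integrating first in \<open>s\<close> gives \<open>exp y * (g y - g a)\<close>, first in
    \<open>y\<close> gives \<open>(exp b - exp s) * g1 s\<close>; \<open>h\<close> dominates
    \<open>f\<close> on the full square.\<close>
  define f where "f = (\<lambda>(y, s). (indicator {a..b} y * exp y) * (indicator {a..y} s * g1 s))"
  define h where "h = (\<lambda>(y, s). (indicator {a..b} y * exp b) * (indicator {a..b} s * g1 s))"
  have mf: "f \<in> borel_measurable (lborel \<Otimes>\<^sub>M lborel)"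
  proof -
    have "f = (\<lambda>(y, s). (indicator {a..b} y * exp y) * ((if a \<le> s \<and> s \<le> y then 1 else 0) * g1 s))"
      by (auto simp: f_def indicator_def)
    then show ?thesis by simp
  qed
  have mh: "h \<in> borel_measurable (lborel \<Otimes>\<^sub>M lborel)" unfolding h_def by measurable
  have ih: "integrable (lborel \<Otimes>\<^sub>M lborel) h"
  proof (rule lborel_pair.Fubini_integrable[OF mh])
    show "integrable lborel (\<lambda>y. LINT s|lborel. norm (h (y, s)))"
      by (simp add: h_def abs_mult integrable_real_indicator emeasure_lborel_Icc_eq)
    show "AE y in lborel. integrable lborel (\<lambda>s. h (y, s))"
      using int[of a b] by (auto simp: h_def set_integrable_def)
  qed
  have "integrable (lborel \<Otimes>\<^sub>M lborel) f"
  proof (rule Bochner_Integration.integrable_bound[OF ih mf], rule AE_I2)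
    fix p :: "real \<times> real"
    show "norm (f p) \<le> norm (h p)"
      by (cases p) (auto simp: f_def h_def indicator_def abs_mult intro!: mult_right_mono)
  qed
  then have swap: "(LINT s|lborel. LINT y|lborel. f (y, s)) = (LINT y|lborel. LINT s|lborel. f (y, s))"
    using lborel_pair.Fubini_integral[of "\<lambda>y s. f (y, s)"] by simp
  have 1: "(LINT s|lborel. f (y, s)) = indicator {a..b} y * (exp y * g y) - g a * (indicator {a..b} y * exp y)" for y
  proof (cases "y \<in> {a..b}")
    case True
    then have "(LINT s:{a..y}|lborel. g1 s) = g y - g a" by (intro antiderivative_LBINT[OF g int]) auto
    then have "(LINT s|lborel. indicator {a..y} s * g1 s) = g y - g a" by (simp add: set_lebesgue_integral_def)
    then show ?thesis using True by (simp add: f_def right_diff_distrib mult.commute[of "g a"])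
  qed (simp add: f_def)
  have 2: "(LINT y|lborel. f (y, s)) = exp b * (indicator {a..b} s * g1 s) - indicator {a..b} s * (exp s * g1 s)" for s
  proof (cases "s \<in> {a..b}")
    case True
    have "(LINT y|lborel. f (y, s)) = (LINT y|lborel. g1 s * (indicator {s..b} y * exp y))"
      using True by (intro Bochner_Integration.integral_cong) (auto simp: f_def indicator_def)
    also have "\<dots> = g1 s * (exp b - exp s)"
      using LBINT_exp[of s b] True by (simp add: set_lebesgue_integral_def)
    finally show ?thesis using True by (simp add: algebra_simps)
  next
    case False
    then have "f (y, s) = 0" for y by (auto simp: f_def indicator_def)
    then show ?thesis using False by simp
  qed
  have "(LINT y|lborel. LINT s|lborel. f (y, s)) = (LINT y:{a..b}|lborel. exp y * g y) - g a * (exp b - exp a)"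
    unfolding 1 using ieg iexp LBINT_exp[OF ab]
    by (subst Bochner_Integration.integral_diff) (auto simp: set_integrable_def set_lebesgue_integral_def)
  moreover have "(LINT s|lborel. LINT y|lborel. f (y, s)) = exp b * (g b - g a) - (LINT s:{a..b}|lborel. exp s * g1 s)"
    unfolding 2 using ieg1 int[of a b] antiderivative_LBINT[OF g int ab]
    by (subst Bochner_Integration.integral_diff) (auto simp: set_integrable_def set_lebesgue_integral_def)
  ultimately have "(LINT y:{a..b}|lborel. exp y * g y) + (LINT y:{a..b}|lborel. exp y * g1 y) = exp b * g b - exp a * g a"
    using swap by (simp add: algebra_simps)
  then show "(LINT y:{a..b}|lborel. exp y * (g y + g1 y)) = exp b * g b - exp a * g a"
    using set_integral_add(2)[OF ieg ieg1] by (simp add: distrib_left)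
qed

lemma glue_wL2:
  assumes [measurable]: "p \<in> borel_measurable borel" "q \<in> borel_measurable borel"
    and i: "integrable lborel (\<lambda>y. (p y)\<^sup>2)" "integrable lborel (\<lambda>y. (q y)\<^sup>2)"
  shows "wL2 (glue p (\<lambda>s. exp s * q s))"
    "wsq (glue p (\<lambda>s. exp s * q s)) \<le> (LINT y|lborel. (p y)\<^sup>2) + (LINT y|lborel. (q y)\<^sup>2)"
proof -
  let ?G = "glue p (\<lambda>s. exp s * q s)"
  have j: "integrable lborel (\<lambda>y. (q (0 + (- 1) * y))\<^sup>2)" by (rule lborel_integrable_real_affine[OF i(2)]) simp
  have jeq: "(LINT y|lborel. (q (0 + (- 1) * y))\<^sup>2) = (LINT y|lborel. (q y)\<^sup>2)"
    using lborel_integral_real_affine[of "- 1" "\<lambda>y. (q y)\<^sup>2" 0] by simp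
  have s: "integrable lborel (\<lambda>y. (p y)\<^sup>2 + (q (0 + (- 1) * y))\<^sup>2)" by (rule Bochner_Integration.integrable_add[OF i(1) j])
  have le: "(wt y * ?G y)\<^sup>2 \<le> (p y)\<^sup>2 + (q (0 + (- 1) * y))\<^sup>2" for y
    by (auto simp: wt_def glue_def mult.assoc[symmetric] exp_add[symmetric])
  have "integrable lborel (\<lambda>y. (wt y * ?G y)\<^sup>2)"
    by (rule Bochner_Integration.integrable_bound[OF s]) (use le in \<open>auto simp: add_nonneg_nonneg\<close>)
  then show w: "wL2 ?G" by (simp add: wL2_def)
  have "wsq ?G \<le> (LINT y|lborel. (p y)\<^sup>2 + (q (0 + (- 1) * y))\<^sup>2)"
    unfolding wsq_def by (rule integral_mono[OF _ s le]) (use w in \<open>simp add: wL2_def\<close>)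
  also have "\<dots> = (LINT y|lborel. (p y)\<^sup>2) + (LINT y|lborel. (q y)\<^sup>2)"
    using Bochner_Integration.integral_add[OF i(1) j] jeq by simp
  finally show "wsq ?G \<le> (LINT y|lborel. (p y)\<^sup>2) + (LINT y|lborel. (q y)\<^sup>2)" .
qed

text \<open>For fixed \<open>y\<close> the reflected kernel vanishes as \<open>x\<close> grows and
  it is bounded by its height, so dominated convergence applies to the quadratic pointwise
  bound.\<close>

lemma drift_heat_tendsto_0:
  assumes H: "wL2 H" and t: "0 < t"
  shows "(drift_heat t H \<longlongrightarrow> 0) at_top"
proof -
  note [measurable] = wL2_measurable[OF H]
  define B where "B = 1 / sqrt (4 * pi * t)"
  let ?f = "\<lambda>x y. kern t (x + t - \<bar>y\<bar>) * (wt y * H y)\<^sup>2"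
  have H2: "integrable lborel (\<lambda>y. (wt y * H y)\<^sup>2)" using H by (simp add: wL2_def)
  have dom: "integrable lborel (\<lambda>y. B * (wt y * H y)\<^sup>2)" using H2 by simp
  have bound: "norm (?f x y) \<le> B * (wt y * H y)\<^sup>2" for x y
    using mult_right_mono[OF kern_le[OF t, of "x + t - \<bar>y\<bar>"], of "(wt y * H y)\<^sup>2"] kern_nonneg[OF t]
    by (simp add: B_def abs_mult)
  have int: "integrable lborel (?f x)" for x
  proof (rule Bochner_Integration.integrable_bound[OF dom])
    have "norm (?f x y) \<le> norm (B * (wt y * H y)\<^sup>2)" for y by (rule order_trans[OF bound]) simp
    then show "AE y in lborel. norm (?f x y) \<le> norm (B * (wt y * H y)\<^sup>2)" by simp
  qed measurable
  have k0: "((\<lambda>x. kern t (x + t - c)) \<longlongrightarrow> 0) at_top" for c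
  proof -
    have "filterlim (\<lambda>x. x + (t - c)) at_top at_top"
      by (subst add.commute) (rule filterlim_tendsto_add_at_top[OF tendsto_const filterlim_ident])
    then have "filterlim (\<lambda>x. (x + (t - c))\<^sup>2 * (1 / (4 * t))) at_top at_top"
      using t by (intro filterlim_at_top_mult_tendsto_pos[OF tendsto_const] filterlim_pow_at_top) auto
    then have "((\<lambda>x. exp (- ((x + (t - c))\<^sup>2 * (1 / (4 * t)))) / sqrt (4 * pi * t)) \<longlongrightarrow> 0 / sqrt (4 * pi * t)) at_top"
      using t by (intro tendsto_divide filterlim_compose[OF exp_at_bot] tendsto_const)
        (auto simp: filterlim_uminus_at_top[symmetric])
    then show ?thesis by (simp add: kern_def add_diff_eq)
  qed
  have "((\<lambda>x. LINT y|lborel. ?f x y) \<longlongrightarrow> (LINT y|lborel. 0 * (wt y * H y)\<^sup>2)) at_top"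
  proof (rule integral_dominated_convergence_at_top[OF _ _ dom])
    show "AE y in lborel. ((\<lambda>x. ?f x y) \<longlongrightarrow> 0 * (wt y * H y)\<^sup>2) at_top"
      by (intro AE_I2 tendsto_mult k0 tendsto_const)
  qed (use bound in simp_all)
  then have "((\<lambda>x. sqrt (2 * (LINT y|lborel. ?f x y))) \<longlongrightarrow> sqrt (2 * 0)) at_top"
    by (intro tendsto_intros) simp
  then have "((\<lambda>x. sqrt (2 * (LINT y|lborel. ?f x y))) \<longlongrightarrow> 0) at_top" by simp
  moreover have "\<forall>\<^sub>F x in at_top. norm (drift_heat t H x) \<le> sqrt (2 * (LINT y|lborel. ?f x y))"
    using eventually_ge_at_top[of "0::real"]
  proof eventually_elim
    case (elim x)
    have nn: "0 \<le> (LINT y|lborel. ?f x y)" using kern_nonneg[OF t] by (intro Bochner_Integration.integral_nonneg) simp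
    have "(\<integral>\<^sup>+y. ennreal (?f x y) \<partial>lborel) = ennreal (LINT y|lborel. ?f x y)"
      using kern_nonneg[OF t] by (intro nn_integral_eq_integral int) simp
    then have "ennreal ((drift_heat t H x)\<^sup>2) \<le> ennreal (2 * (LINT y|lborel. ?f x y))"
      using drift_heat_square_le[OF H t elim] nn by (simp add: ennreal_mult)
    then have "(drift_heat t H x)\<^sup>2 \<le> 2 * (LINT y|lborel. ?f x y)" using nn by (simp add: ennreal_le_iff)
    then show ?case by (simp add: real_le_rsqrt)
  qed
  ultimately show ?thesis by (rule Lim_null_comparison[rotated])
qed

lemma W0_nonneg_eq: "0 \<le> x \<Longrightarrow> W0 x = 1 - exp (- x)"
  by (cases "x = 0") (auto simp: W0_def sgn_if)

lemma W0_odd: "W0 (- x) = - W0 x"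
  by (simp add: W0_def sgn_if)

lemma W0_0: "W0 0 = 0"
  by (simp add: W0_def)

lemma W0_DERIV: "0 < x \<Longrightarrow> (W0 has_real_derivative exp (- x)) (at x)"
  by (rule has_field_derivative_transform_within_open[where S = "{0<..}" and f = "\<lambda>x. 1 - exp (- x)"])
     (auto intro!: derivative_eq_intros simp: W0_nonneg_eq)

lemma W0_continuous: "continuous_on {0..} W0"
  by (rule continuous_on_eq[of _ "\<lambda>x. 1 - exp (- x)"]) (auto intro!: continuous_intros simp: W0_nonneg_eq)

lemma W0_pos: "0 < x \<Longrightarrow> 0 < W0 x"
  by (simp add: W0_nonneg_eq)

lemma W0_tendsto_1: "(W0 \<longlongrightarrow> 1) at_top"
proof (rule Lim_transform_eventually)
  show "((\<lambda>x::real. 1 - exp (- x)) \<longlongrightarrow> 1) at_top"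
    using tendsto_diff[OF tendsto_const filterlim_compose[OF exp_at_bot filterlim_uminus_at_bot_at_top], of 1] by simp
  show "\<forall>\<^sub>F x in at_top. 1 - exp (- x) = W0 x"
    using eventually_ge_at_top[of "0::real"] by eventually_elim (simp add: W0_nonneg_eq)
qed

text \<open>From \<open>exp (- x) \<le> 1 / (1 + x)\<close>. The shape matches what H2 smallness
  gives for a perturbation: a linear bound near the origin and a constant one away from it.\<close>

lemma W0_lower_bound:
  assumes "0 \<le> x"
  shows "min x 1 / 2 \<le> W0 x"
proof -
  have "exp (- x) \<le> 1 / (1 + x)"
    using exp_ge_add_one_self[of x] assms by (simp add: exp_minus field_simps)
  then have "1 - 1 / (1 + x) \<le> W0 x" by (simp add: W0_nonneg_eq[OF assms])
  moreover have "min x 1 / 2 \<le> 1 - 1 / (1 + x)"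
    using assms by (auto simp: min_def field_simps mult_left_le)
  ultimately show ?thesis by linarith
qed

text \<open>On the half-line the equation is linear, so the difference of two solutions solves it
  again with zero data and obeys the maximum principle.\<close>

lemma odd_mburgers_sol_le:
  assumes v: "odd_mburgers_sol v w0" "in_class v" and w: "odd_mburgers_sol w w0" "in_class w"
    and t: "0 \<le> t" and x: "0 \<le> x"
  shows "v t x \<le> w t x"
proof -
  obtain M1 where M1: "\<And>s y. 0 \<le> s \<Longrightarrow> s \<le> t \<Longrightarrow> \<bar>v s y - W0 y\<bar> \<le> M1" using in_class_bounded[OF v(2)] by metis
  obtain M2 where M2: "\<And>s y. 0 \<le> s \<Longrightarrow> s \<le> t \<Longrightarrow> \<bar>w s y - W0 y\<bar> \<le> M2" using in_class_bounded[OF w(2)] by metis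
  have "v t x - w t x \<le> 0"
  proof (rule half_line_maximum_principle[where z = "\<lambda>t x. v t x - w t x" and T = t and M = "M1 + M2"
        and ?z1.0 = "\<lambda>t x. deriv (v t) x - deriv (w t) x" and ?z2.0 = "\<lambda>t x. deriv (deriv (v t)) x - deriv (deriv (w t)) x"])
    have "continuous_on ({0..t} \<times> {0..}) (\<lambda>p. (case p of (t, x) \<Rightarrow> v t x - W0 x) - (case p of (t, x) \<Rightarrow> w t x - W0 x))"
      by (intro continuous_on_diff continuous_on_subset[OF in_class_continuous[OF v(2), of "{0..}"]]
          continuous_on_subset[OF in_class_continuous[OF w(2), of "{0..}"]]) auto
    then show "continuous_on ({0..t} \<times> {0..}) (\<lambda>(t, x). v t x - w t x)" by (simp add: case_prod_beta')
    show "v s y - w s y \<le> M1 + M2" if "0 \<le> s" "s \<le> t" for s y using M1[OF that, of y] M2[OF that, of y] by linarith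
    show "v 0 y - w 0 y \<le> 0" for y using v(1) w(1) by (simp add: odd_mburgers_sol_def)
    \<comment> \<open>The Dirichlet condition is stated for positive times; at \<open>s = 0\<close>
      the boundary values agree because the initial data do.\<close>
    show "v s 0 - w s 0 \<le> 0" if "0 \<le> s" for s
      using v(1) w(1) that by (cases "s = 0") (auto simp: odd_mburgers_sol_def)
    fix s y :: real assume sy: "0 < s" "0 < y"
    show "((\<lambda>y. v s y - w s y) has_real_derivative deriv (v s) y - deriv (w s) y) (at y)"
      using v(1) w(1) sy by (intro DERIV_diff) (auto simp: odd_mburgers_sol_def DERIV_deriv_iff_real_differentiable)
    show "((\<lambda>y. deriv (v s) y - deriv (w s) y) has_real_derivative deriv (deriv (v s)) y - deriv (deriv (w s)) y) (at y)"
      using v(1) w(1) sy by (intro DERIV_diff) (auto simp: odd_mburgers_sol_def DERIV_deriv_iff_real_differentiable)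
    have "((\<lambda>s. v s y) has_real_derivative deriv (v s) y + deriv (deriv (v s)) y) (at s)"
      "((\<lambda>s. w s y) has_real_derivative deriv (w s) y + deriv (deriv (w s)) y) (at s)"
      using v(1) w(1) sy by (auto simp: odd_mburgers_sol_def)
    from DERIV_diff[OF this] show "((\<lambda>s. v s y - w s y) has_real_derivative
        (deriv (v s) y - deriv (w s) y) + (deriv (deriv (v s)) y - deriv (deriv (w s)) y)) (at s)"
      by (simp add: algebra_simps)
  qed (use t x in auto)
  then show ?thesis by simp
qed

lemma odd_mburgers_sol_unique:
  assumes v: "odd_mburgers_sol v w0" "in_class v" and w: "odd_mburgers_sol w w0" "in_class w" and t: "0 \<le> t"
  shows "v t x = w t x"
proof -
  have eq: "v t y = w t y" if "0 \<le> y" for y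
    using odd_mburgers_sol_le[OF v w t that] odd_mburgers_sol_le[OF w v t that] by simp
  show ?thesis
  proof (cases "0 \<le> x")
    case False
    have "v t (- x) = - v t x" "w t (- x) = - w t x" using v(1) w(1) t by (simp_all add: odd_mburgers_sol_def)
    then show ?thesis using eq[of "- x"] False by simp
  qed (rule eq)
qed

section \<open>Existence and stability\<close>

text \<open>\<open>u2\<close> is a Borel representative of the weak second derivative, so that every
  integral can be taken over \<open>lborel\<close>.\<close>

locale odd_perturbation =
  fixes u0 u1 u2 :: "real \<Rightarrow> real"
  assumes u01: "\<And>x. (u0 has_real_derivative u1 x) (at x)" and u12: "antiderivative u1 u2"
    and u2_measurable[measurable]: "u2 \<in> borel_measurable borel"
    and u0_L2: "integrable lborel (\<lambda>x. (u0 x)\<^sup>2)" and u1_L2: "integrable lborel (\<lambda>x. (u1 x)\<^sup>2)"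
    and u2_L2: "integrable lborel (\<lambda>x. (u2 x)\<^sup>2)"
    and u0_odd: "\<And>x. u0 (- x) = - u0 x"
begin

text \<open>\<open>U0\<close> extends the half-line datum so that \<open>U0 (- y) = - exp y * U0 y\<close>. The drift-diffusion flow
  on the whole line preserves this symmetry, which forces the Dirichlet condition at the origin.\<close>
definition "U0 = glue u0 (\<lambda>s. exp s * - u0 s)"
text \<open>\<open>U1\<close> and \<open>U2\<close> arise by differentiating
  \<open>- exp (- y) * u0 (- y)\<close> once and twice for \<open>y < 0\<close>. \<open>U1\<close>
  is continuous at 0 because \<open>u0 0 = 0\<close>; \<open>U2\<close> generally jumps there,
  unless \<open>u1 + u2\<close> vanishes at the origin.\<close>

definition "U1 = glue u1 (\<lambda>s. exp s * (u0 s + u1 s))"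
definition "U2 = glue u2 (\<lambda>s. exp s * - ((u0 s + u1 s) + (u1 s + u2 s)))"

text \<open>Only the half-line part of the flow is kept and reflected: the flow itself has the
  weighted symmetry of \<open>U0\<close> and is not odd.\<close>

definition sol :: "real \<Rightarrow> real \<Rightarrow> real" where
  "sol t x = W0 x + odd_ext (drift_heat t U0) x"

lemma u0_0: "u0 0 = 0"
  using u0_odd[of 0] by simp

lemma u0_measurable[measurable]: "u0 \<in> borel_measurable borel"
  by (rule borel_measurable_continuous_onI[OF antiderivative_continuous[OF antiderivative_of_derivative[OF u01]]])

lemma u1_measurable[measurable]: "u1 \<in> borel_measurable borel"
  by (rule borel_measurable_continuous_onI[OF antiderivative_continuous[OF u12]])

lemma L2_sum:
  assumes [measurable]: "f \<in> borel_measurable borel" "g \<in> borel_measurable borel"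
    and "integrable lborel (\<lambda>x. (f x)\<^sup>2)" "integrable lborel (\<lambda>x. (g x)\<^sup>2)"
  shows "integrable lborel (\<lambda>x. (f x + g x :: real)\<^sup>2)"
    "(LINT x|lborel. (f x + g x)\<^sup>2) \<le> 2 * (LINT x|lborel. (f x)\<^sup>2) + 2 * (LINT x|lborel. (g x)\<^sup>2)"
proof -
  show i: "integrable lborel (\<lambda>x. (f x + g x)\<^sup>2)"
    using integrable_square_diff[of f lborel "\<lambda>x. - g x"] assms by simp
  have "(LINT x|lborel. (f x + g x)\<^sup>2) \<le> (LINT x|lborel. 2 * (f x)\<^sup>2 + 2 * (g x)\<^sup>2)"
  proof (rule integral_mono[OF i])
    show "(f x + g x)\<^sup>2 \<le> 2 * (f x)\<^sup>2 + 2 * (g x)\<^sup>2" for x using square_diff_le[of "f x" "- g x" 0] by simp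
  qed (use assms(3,4) in simp)
  then show "(LINT x|lborel. (f x + g x)\<^sup>2) \<le> 2 * (LINT x|lborel. (f x)\<^sup>2) + 2 * (LINT x|lborel. (g x)\<^sup>2)"
    using assms(3,4) by simp
qed

definition "energy = (LINT x|lborel. (u0 x)\<^sup>2) + (LINT x|lborel. (u1 x)\<^sup>2) + (LINT x|lborel. (u2 x)\<^sup>2)"

lemma sum01_L2: "integrable lborel (\<lambda>x. (u0 x + u1 x)\<^sup>2)"
  and sum12_L2: "integrable lborel (\<lambda>x. (u1 x + u2 x)\<^sup>2)"
  and sum012_L2: "integrable lborel (\<lambda>x. ((u0 x + u1 x) + (u1 x + u2 x))\<^sup>2)"
proof -
  show 1: "integrable lborel (\<lambda>x. (u0 x + u1 x)\<^sup>2)" by (intro L2_sum u0_L2 u1_L2) simp_all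
  show 2: "integrable lborel (\<lambda>x. (u1 x + u2 x)\<^sup>2)" by (intro L2_sum u1_L2 u2_L2) simp_all
  show "integrable lborel (\<lambda>x. ((u0 x + u1 x) + (u1 x + u2 x))\<^sup>2)" by (intro L2_sum 1 2) simp_all
qed

lemma minus_sum012:
  "(\<lambda>x. - ((u0 x + u1 x) + (u1 x + u2 x))) \<in> borel_measurable borel"
  "integrable lborel (\<lambda>x. (- ((u0 x + u1 x) + (u1 x + u2 x)))\<^sup>2)"
  using sum012_L2 by (measurable, simp only: power2_minus)

lemma U_wL2: "wL2 U0" "wL2 U1" "wL2 U2"
proof -
  show "wL2 U0" "wL2 U1" unfolding U0_def U1_def by (intro glue_wL2; simp add: u0_L2 u1_L2 sum01_L2)+
  show "wL2 U2" unfolding U2_def by (rule glue_wL2(1)[OF u2_measurable minus_sum012(1) u2_L2 minus_sum012(2)])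
qed

text \<open>Each \<open>exp\<close>-weighted branch costs the plain L2 norm of its bracket. The
  coefficients 8, 11 and 5 are rounded up to 16 so that the final factor becomes a perfect
  square.\<close>

lemma U_wsq: "wsq U0 + wsq U1 + wsq U2 \<le> 16 * energy"
proof -
  let ?a = "LINT x|lborel. (u0 x)\<^sup>2" and ?b = "LINT x|lborel. (u1 x)\<^sup>2" and ?c = "LINT x|lborel. (u2 x)\<^sup>2"
  have 0: "wsq U0 \<le> ?a + ?a"
    unfolding U0_def by (rule order_trans[OF glue_wL2(2)]) (simp_all add: u0_L2)
  have 1: "wsq U1 \<le> ?b + (LINT x|lborel. (u0 x + u1 x)\<^sup>2)"
    unfolding U1_def by (rule order_trans[OF glue_wL2(2)]) (simp_all add: u1_L2 sum01_L2)
  have 2: "wsq U2 \<le> ?c + (LINT x|lborel. ((u0 x + u1 x) + (u1 x + u2 x))\<^sup>2)"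
  proof -
    have "wsq U2 \<le> ?c + (LINT x|lborel. (- ((u0 x + u1 x) + (u1 x + u2 x)))\<^sup>2)"
      unfolding U2_def by (rule glue_wL2(2)[OF u2_measurable minus_sum012(1) u2_L2 minus_sum012(2)])
    then show ?thesis by (simp only: power2_minus)
  qed
  have 3: "(LINT x|lborel. (u0 x + u1 x)\<^sup>2) \<le> 2 * ?a + 2 * ?b" by (intro L2_sum u0_L2 u1_L2) simp_all
  have 4: "(LINT x|lborel. (u1 x + u2 x)\<^sup>2) \<le> 2 * ?b + 2 * ?c" by (intro L2_sum u1_L2 u2_L2) simp_all
  have 5: "(LINT x|lborel. ((u0 x + u1 x) + (u1 x + u2 x))\<^sup>2) \<le> 2 * (LINT x|lborel. (u0 x + u1 x)\<^sup>2) + 2 * (LINT x|lborel. (u1 x + u2 x)\<^sup>2)"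
    by (intro L2_sum sum01_L2 sum12_L2) simp_all
  have nonneg: "0 \<le> ?a" "0 \<le> ?b" "0 \<le> ?c" by simp_all
  have "wsq U1 \<le> 2 * ?a + 3 * ?b" using 1 3 by simp
  moreover have "wsq U2 \<le> 4 * ?a + 8 * ?b + 5 * ?c" using 2 3 4 5 by simp
  ultimately have "wsq U0 + wsq U1 + wsq U2 \<le> 8 * ?a + 11 * ?b + 5 * ?c" using 0 by simp
  also have "\<dots> \<le> 16 * energy" using nonneg unfolding energy_def distrib_left by (intro add_mono mult_right_mono) simp_all
  finally show ?thesis .
qed

lemma U01: "antiderivative U0 U1"
proof -
  have "antiderivative (\<lambda>s. exp s * - u0 s) (\<lambda>s. - (exp s * (u0 s + u1 s)))"
    by (rule antiderivative_of_derivative) (auto intro!: derivative_eq_intros u01 simp: algebra_simps)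
  from glue_antiderivative[OF antiderivative_of_derivative[OF u01] this] show ?thesis
    by (simp add: U0_def U1_def u0_0)
qed

text \<open>Since \<open>u2\<close> is merely an integrand for \<open>u1\<close>, the product rule
  on the negative side is taken in the integrated form
  \<open>antiderivative_exp_mult\<close>.\<close>

lemma U12: "antiderivative U1 U2"
proof -
  have w: "wL2 (\<lambda>s. u1 s + u2 s)"
  proof -
    have "integrable lborel (\<lambda>y. (wt y * (u1 y + u2 y))\<^sup>2)"
    proof (rule Bochner_Integration.integrable_bound[OF sum12_L2])
      have "(wt y * (u1 y + u2 y))\<^sup>2 \<le> (u1 y + u2 y)\<^sup>2" for y
        using mult_right_mono[of "(wt y)\<^sup>2" 1 "(u1 y + u2 y)\<^sup>2"] wt_pos[of y] wt_le_1[of y]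
        by (simp add: power_mult_distrib power_le_one)
      then show "AE y in lborel. norm ((wt y * (u1 y + u2 y))\<^sup>2) \<le> norm ((u1 y + u2 y)\<^sup>2)" by simp
    qed measurable
    then show ?thesis by (simp add: wL2_def)
  qed
  have "antiderivative (\<lambda>s. u0 s + u1 s) (\<lambda>s. u1 s + u2 s)"
    by (intro antiderivative_add antiderivative_of_derivative u01 u12)
  then have "antiderivative (\<lambda>s. exp s * (u0 s + u1 s)) (\<lambda>s. exp s * ((u0 s + u1 s) + (u1 s + u2 s)))"
    by (rule antiderivative_exp_mult[OF _ _ wL2_set_integrable[OF w]]) simp
  from glue_antiderivative[OF u12 this] show ?thesis
    unfolding U1_def U2_def mult_minus_right by (simp only: u0_0 exp_zero mult_1 add_0)
qed

lemma U0_symmetry: "U0 (- y) = - exp y * U0 y"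
  using u0_0 by (auto simp: U0_def glue_def u0_odd mult.assoc[symmetric] exp_add[symmetric])

lemma flow_DERIV:
  assumes "0 \<le> t"
  shows "(drift_heat t U0 has_real_derivative drift_heat t U1 x) (at x)"
proof (cases "t = 0")
  case True
  have "(U0 has_real_derivative U1 x) (at x)"
    by (rule antiderivative_has_derivative[OF U01 antiderivative_continuous[OF U12]])
  then show ?thesis by (simp add: True drift_heat_0[abs_def])
next
  case False
  then show ?thesis using assms by (intro drift_heat_DERIV_space U_wL2 U01) simp
qed

lemma flow_antiderivative:
  assumes "0 \<le> t"
  shows "antiderivative (drift_heat t U1) (drift_heat t U2)"
proof (cases "t = 0")
  case True
  then show ?thesis using U12 by (simp add: drift_heat_0[abs_def])
next
  case False
  then show ?thesis using assms by (intro drift_heat_antiderivative U_wL2 U12) simp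
qed

text \<open>At \<open>x = 0\<close> the drift compensates the weight exactly,
  \<open>kern t (t + y) * exp y = kern t (t - y)\<close>, so reflecting \<open>y\<close> shows that
  the integral equals its own negative.\<close>

lemma flow_0:
  assumes "0 \<le> t"
  shows "drift_heat t U0 0 = 0"
proof (cases "t = 0")
  case True
  then show ?thesis by (simp add: drift_heat_0 U0_def glue_def u0_0)
next
  case False
  then have t: "0 < t" using assms by simp
  have k: "kern t (t + y) * exp y = kern t (t - y)" for y
  proof -
    have "- (t + y)\<^sup>2 / (4 * t) + y = - (t - y)\<^sup>2 / (4 * t)" using t by (simp add: field_simps power2_eq_square)
    then show ?thesis by (simp add: kern_def exp_add[symmetric])
  qed
  have "(LINT y|lborel. kern t (t - y) * U0 y) = (LINT y|lborel. kern t (t - (0 + (- 1) * y)) * U0 (0 + (- 1) * y))"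
    using lborel_integral_real_affine[of "- 1" "\<lambda>y. kern t (t - y) * U0 y" 0] by simp
  also have "\<dots> = (LINT y|lborel. - (kern t (t - y) * U0 y))"
  proof (rule Bochner_Integration.integral_cong)
    fix y
    show "kern t (t - (0 + (- 1) * y)) * U0 (0 + (- 1) * y) = - (kern t (t - y) * U0 y)"
      using k[of y] by (simp add: U0_symmetry mult.assoc[symmetric])
  qed simp
  also have "\<dots> = - (LINT y|lborel. kern t (t - y) * U0 y)" by simp
  finally show ?thesis by (simp add: drift_heat_kern[OF t])
qed

lemma sol_diff_W0: "(\<lambda>x. sol t x - W0 x) = odd_ext (drift_heat t U0)"
  by (simp add: sol_def)

lemma flow_hL2: "0 \<le> t \<Longrightarrow> hL2 (drift_heat t U0)" "0 \<le> t \<Longrightarrow> hL2 (drift_heat t U1)" "0 \<le> t \<Longrightarrow> hL2 (drift_heat t U2)"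
  by (intro drift_heat_L2_bound U_wL2; simp)+

text \<open>The constant is \<open>64 = 2 * 2 * 16\<close>: two half-lines, the L2 bound of the
  flow, and the cost of extending the datum. By \<open>H2_odd_perturbation\<close>,
  \<open>sqrt energy\<close> is the initial H2 norm.\<close>

lemma sol_H2_norm_le:
  assumes "0 \<le> t"
  shows "H2_norm (\<lambda>x. sol t x - W0 x) \<le> 8 * sqrt energy"
proof -
  have "H2_norm (\<lambda>x. sol t x - W0 x) = sqrt (2 * hsq (drift_heat t U0) + 2 * hsq (drift_heat t U1) + 2 * hsq (drift_heat t U2))"
    unfolding sol_diff_W0 using assms by (intro odd_ext_H2(2) flow_DERIV flow_0 flow_antiderivative flow_hL2)
  also have "\<dots> \<le> sqrt (64 * energy)"
  proof (rule real_sqrt_le_mono)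
    have "hsq (drift_heat t U0) \<le> 2 * wsq U0" "hsq (drift_heat t U1) \<le> 2 * wsq U1" "hsq (drift_heat t U2) \<le> 2 * wsq U2"
      by (intro drift_heat_L2_bound U_wL2 assms)+
    then show "2 * hsq (drift_heat t U0) + 2 * hsq (drift_heat t U1) + 2 * hsq (drift_heat t U2) \<le> 64 * energy"
      using U_wsq by linarith
  qed
  also have "\<dots> = 8 * sqrt energy" by (simp add: real_sqrt_mult)
  finally show ?thesis .
qed

lemma sol_in_class: "in_class sol"
  unfolding in_class_def
proof (intro conjI allI impI)
  fix t :: real assume "0 \<le> t"
  then show "H2 (\<lambda>x. sol t x - W0 x)"
    unfolding sol_diff_W0
    by (intro odd_ext_H2(1)[of "drift_heat t U0" "drift_heat t U1" "drift_heat t U2"] flow_DERIV flow_0 flow_antiderivative flow_hL2)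
next
  fix s :: real assume s: "0 \<le> s"
  let ?d = "\<lambda>U t x. drift_heat t U x - drift_heat s U x"
  have eq: "H2_norm (\<lambda>x. sol t x - sol s x) = sqrt (2 * hsq (?d U0 t) + 2 * hsq (?d U1 t) + 2 * hsq (?d U2 t))"
    if t: "0 \<le> t" for t
  proof -
    have "(\<lambda>x. sol t x - sol s x) = odd_ext (?d U0 t)" by (auto simp: sol_def odd_ext_def)
    moreover have "H2_norm (odd_ext (?d U0 t)) = sqrt (2 * hsq (?d U0 t) + 2 * hsq (?d U1 t) + 2 * hsq (?d U2 t))"
    proof (rule odd_ext_H2(2))
      show "(?d U0 t has_real_derivative ?d U1 t x) (at x)" for x by (intro DERIV_diff flow_DERIV s t)
      show "?d U0 t 0 = 0" by (simp add: flow_0 s t)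
      show "antiderivative (?d U1 t) (?d U2 t)" by (intro antiderivative_diff flow_antiderivative s t)
    qed (intro hL2_diff flow_hL2 s t)+
    ultimately show ?thesis by simp
  qed
  have "((\<lambda>t. sqrt (2 * hsq (?d U0 t) + 2 * hsq (?d U1 t) + 2 * hsq (?d U2 t))) \<longlongrightarrow> sqrt (2 * 0 + 2 * 0 + 2 * 0)) (at s within {0..})"
    by (intro tendsto_intros drift_heat_strong_continuity U_wL2 s)
  then have "((\<lambda>t. sqrt (2 * hsq (?d U0 t) + 2 * hsq (?d U1 t) + 2 * hsq (?d U2 t))) \<longlongrightarrow> 0) (at s within {0..})"
    by simp
  then show "((\<lambda>t. H2_norm (\<lambda>x. sol t x - sol s x)) \<longlongrightarrow> 0) (at s within {0..})"
    by (rule Lim_transform_eventually) (auto simp: eventually_at_filter eq)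
qed

lemma sol_W2inf: "((\<lambda>t. W2inf_norm (\<lambda>x. sol t x - W0 x)) \<longlongrightarrow> 0) at_top"
proof -
  \<comment> \<open>One envelope for the flows of \<open>U0\<close>, \<open>U1\<close> and
    \<open>U2\<close>, of order \<open>t powr (- 1 / 4)\<close>.\<close>
  define c where "c t = sqrt (2 * (wsq U0 + wsq U1 + wsq U2) / sqrt (4 * pi * t))" for t
  have bound: "\<bar>drift_heat t U x\<bar> \<le> c t" if "wL2 U" "wsq U \<le> wsq U0 + wsq U1 + wsq U2" "0 < t" "0 \<le> x" for U t x
  proof -
    have "(drift_heat t U x)\<^sup>2 \<le> 2 * wsq U / sqrt (4 * pi * t)" by (rule drift_heat_sup_bound) (use that in auto)
    also have "\<dots> \<le> 2 * (wsq U0 + wsq U1 + wsq U2) / sqrt (4 * pi * t)" using that by (intro divide_right_mono) auto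
    finally show ?thesis unfolding c_def by (simp add: real_le_rsqrt)
  qed
  have W: "0 \<le> W2inf_norm (\<lambda>x. sol t x - W0 x)" "W2inf_norm (\<lambda>x. sol t x - W0 x) \<le> ereal (3 * c t)" if t: "0 < t" for t
    unfolding sol_diff_W0
    using t wsq_nonneg[of U0] wsq_nonneg[of U1] wsq_nonneg[of U2]
    by (intro odd_ext_W2inf[where ?p1.0 = "drift_heat t U1" and ?p2.0 = "drift_heat t U2" and c = "c t"]
        flow_DERIV flow_0 flow_antiderivative flow_hL2 bound U_wL2; simp)+
  have c0: "((\<lambda>t. 3 * c t) \<longlongrightarrow> 0) at_top"
  proof -
    have "filterlim (\<lambda>t::real. (4 * pi) * t) at_top at_top"
      by (rule filterlim_tendsto_pos_mult_at_top[OF tendsto_const]) (auto simp: filterlim_ident)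
    then have "filterlim (\<lambda>t::real. sqrt (4 * pi * t)) at_top at_top" by (rule filterlim_compose[OF sqrt_at_top])
    then have "((\<lambda>t. 2 * (wsq U0 + wsq U1 + wsq U2) / sqrt (4 * pi * t)) \<longlongrightarrow> 0) at_top"
      by (intro tendsto_divide_0[OF tendsto_const] filterlim_at_top_imp_at_infinity)
    then have "(c \<longlongrightarrow> sqrt 0) at_top" unfolding c_def[abs_def] by (intro tendsto_intros)
    then show ?thesis using tendsto_mult_right_zero[of c at_top 3] by simp
  qed
  show ?thesis
  proof (rule tendsto_sandwich)
    show "\<forall>\<^sub>F t in at_top. 0 \<le> W2inf_norm (\<lambda>x. sol t x - W0 x)"
      using eventually_gt_at_top[of 0] by eventually_elim (rule W)
    show "\<forall>\<^sub>F t in at_top. W2inf_norm (\<lambda>x. sol t x - W0 x) \<le> ereal (3 * c t)"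
      using eventually_gt_at_top[of 0] by eventually_elim (rule W)
    show "((\<lambda>t. ereal (3 * c t)) \<longlongrightarrow> 0) at_top" using c0 by (simp add: zero_ereal_def)
  qed simp
qed

lemma sol_nonneg: "0 \<le> x \<Longrightarrow> sol t x = W0 x + drift_heat t U0 x"
  by (simp add: sol_def odd_ext_def)

lemma sol_initial: "sol 0 x = W0 x + u0 x"
  by (auto simp: sol_def odd_ext_def drift_heat_0 U0_def glue_def u0_odd)

lemma sol_DERIV_time:
  assumes "0 < t" "0 \<le> x"
  shows "((\<lambda>t. sol t x) has_real_derivative (drift_heat t U1 x + drift_heat t U2 x)) (at t)"
  using drift_heat_equation[OF U_wL2 U01 U12 assms(1), of x] unfolding sol_nonneg[OF assms(2)]
  by (auto intro!: derivative_eq_intros)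

text \<open>\<open>W0 / 2\<close> is stationary for the linear equation and vanishes at the origin,
  so subtracting it from plus or minus the perturbation leaves a solution to which the maximum
  principle applies.\<close>

lemma sol_perturbation_le:
  assumes init: "\<And>x. 0 \<le> x \<Longrightarrow> \<bar>u0 x\<bar> \<le> W0 x / 2" and \<sigma>: "\<bar>\<sigma>\<bar> = 1" and t: "0 \<le> t" and x: "0 \<le> x"
  shows "\<sigma> * (sol t x - W0 x) - W0 x / 2 \<le> 0"
proof -
  obtain M where M: "\<And>s y. 0 \<le> s \<Longrightarrow> s \<le> t \<Longrightarrow> \<bar>sol s y - W0 y\<bar> \<le> M" using in_class_bounded[OF sol_in_class] by metis
  have W0nn: "0 \<le> W0 y" if "0 \<le> y" for y using that W0_pos[of y] W0_0 by (cases "y = 0") auto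
  show ?thesis
  proof (rule half_line_maximum_principle[where z = "\<lambda>t x. \<sigma> * (sol t x - W0 x) - W0 x / 2" and T = t and M = M
        and ?z1.0 = "\<lambda>t x. \<sigma> * drift_heat t U1 x - exp (- x) / 2" and ?z2.0 = "\<lambda>t x. \<sigma> * drift_heat t U2 x + exp (- x) / 2"])
    have "continuous_on ({0..t} \<times> {0..}) (\<lambda>p. \<sigma> * (case p of (t, x) \<Rightarrow> sol t x - W0 x) - W0 (snd p) / 2)"
      by (intro continuous_intros continuous_on_subset[OF in_class_continuous[OF sol_in_class, of "{0..}"]]
          continuous_on_compose2[OF W0_continuous]) auto
    then show "continuous_on ({0..t} \<times> {0..}) (\<lambda>(t, x). \<sigma> * (sol t x - W0 x) - W0 x / 2)" by (simp add: case_prod_beta')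
    show "\<sigma> * (sol s y - W0 y) - W0 y / 2 \<le> M" if "0 \<le> s" "s \<le> t" "0 \<le> y" for s y
    proof -
      have "\<sigma> * (sol s y - W0 y) \<le> \<bar>sol s y - W0 y\<bar>" using \<sigma> by (metis abs_ge_self abs_mult mult_1)
      then show ?thesis using M[OF that(1,2), of y] W0nn[OF that(3)] by linarith
    qed
    show "\<sigma> * (sol 0 y - W0 y) - W0 y / 2 \<le> 0" if "0 \<le> y" for y
    proof -
      have "\<sigma> * u0 y \<le> \<bar>u0 y\<bar>" using \<sigma> by (metis abs_ge_self abs_mult mult_1)
      then show ?thesis using init[OF that] by (simp add: sol_initial)
    qed
    show "\<sigma> * (sol s 0 - W0 0) - W0 0 / 2 \<le> 0" if "0 \<le> s" for s
      using flow_0[OF that] by (simp add: sol_nonneg W0_0)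
    fix s y :: real assume sy: "0 < s" "0 < y"
    have "((\<lambda>x. \<sigma> * drift_heat s U0 x - W0 x / 2) has_real_derivative \<sigma> * drift_heat s U1 y - exp (- y) / 2) (at y)"
      using flow_DERIV[of s y] W0_DERIV[OF sy(2)] sy by (auto intro!: derivative_eq_intros)
    then show "((\<lambda>x. \<sigma> * (sol s x - W0 x) - W0 x / 2) has_real_derivative \<sigma> * drift_heat s U1 y - exp (- y) / 2) (at y)"
      by (rule has_field_derivative_transform_within_open[where S = "{0<..}"]) (use sy in \<open>auto simp: sol_nonneg\<close>)
    have "(drift_heat s U1 has_real_derivative drift_heat s U2 y) (at y)"
      by (intro drift_heat_DERIV_space U_wL2 U12 sy)
    then show "((\<lambda>x. \<sigma> * drift_heat s U1 x - exp (- x) / 2) has_real_derivative \<sigma> * drift_heat s U2 y + exp (- y) / 2) (at y)"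
      by (auto intro!: derivative_eq_intros)
    show "((\<lambda>s. \<sigma> * (sol s y - W0 y) - W0 y / 2) has_real_derivative
        (\<sigma> * drift_heat s U1 y - exp (- y) / 2) + (\<sigma> * drift_heat s U2 y + exp (- y) / 2)) (at s)"
      using sol_DERIV_time[OF sy(1), of y] sy by (auto intro!: derivative_eq_intros simp: algebra_simps)
  qed (use t x in auto)
qed

lemma sol_odd_mburgers:
  assumes init: "\<And>x. 0 \<le> x \<Longrightarrow> \<bar>u0 x\<bar> \<le> W0 x / 2"
  shows "odd_mburgers_sol sol (\<lambda>x. W0 x + u0 x)"
proof -
  have D: "(sol t has_real_derivative exp (- x) + drift_heat t U1 x) (at x)" if "0 < t" "0 < x" for t x
  proof -
    have "((\<lambda>x. W0 x + drift_heat t U0 x) has_real_derivative exp (- x) + drift_heat t U1 x) (at x)"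
      using that by (intro DERIV_add W0_DERIV flow_DERIV) auto
    then show ?thesis
      by (rule has_field_derivative_transform_within_open[where S = "{0<..}"]) (use that in \<open>auto simp: sol_nonneg\<close>)
  qed
  have d: "deriv (sol t) x = exp (- x) + drift_heat t U1 x" if "0 < t" "0 < x" for t x
    by (rule DERIV_imp_deriv[OF D[OF that]])
  have DD: "(deriv (sol t) has_real_derivative - exp (- x) + drift_heat t U2 x) (at x)" if "0 < t" "0 < x" for t x
  proof -
    have "(drift_heat t U1 has_real_derivative drift_heat t U2 x) (at x)"
      by (intro drift_heat_DERIV_space U_wL2 U12 that)
    then have "((\<lambda>x. exp (- x) + drift_heat t U1 x) has_real_derivative - exp (- x) + drift_heat t U2 x) (at x)"
      by (auto intro!: derivative_eq_intros)
    then show ?thesis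
      by (rule has_field_derivative_transform_within_open[where S = "{0<..}"]) (use that d in auto)
  qed
  have dd: "deriv (deriv (sol t)) x = - exp (- x) + drift_heat t U2 x" if "0 < t" "0 < x" for t x
    by (rule DERIV_imp_deriv[OF DD[OF that]])
  have lim: "(sol t \<longlongrightarrow> 1) at_top" if "0 < t" for t
  proof (rule Lim_transform_eventually)
    show "((\<lambda>x. W0 x + drift_heat t U0 x) \<longlongrightarrow> 1) at_top"
      using tendsto_add[OF W0_tendsto_1 drift_heat_tendsto_0[OF U_wL2(1) that]] by simp
    show "\<forall>\<^sub>F x in at_top. W0 x + drift_heat t U0 x = sol t x"
      using eventually_ge_at_top[of "0::real"] by eventually_elim (simp add: sol_nonneg)
  qed
  \<comment> \<open>The sign \<open>- 1\<close> turns the comparison into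
    \<open>W0 x / 2 \<le> sol t x\<close>.\<close>
  have pos: "0 < sol t x" if "0 < t" "0 < x" for t x
    using sol_perturbation_le[OF init, of "- 1" t x] that W0_pos[of x] by simp
  have odd: "sol t (- x) = - sol t x" if "0 \<le> t" for t x
    using flow_0[OF that] by (auto simp: sol_def odd_ext_def W0_odd)
  show ?thesis
    unfolding odd_mburgers_sol_def
  proof (intro conjI allI impI)
    fix t x :: real assume tx: "0 < t" "0 < x"
    show "sol t differentiable at x" using D[OF tx] by (auto simp: real_differentiable_def)
    show "deriv (sol t) differentiable at x" using DD[OF tx] by (auto simp: real_differentiable_def)
    show "((\<lambda>s. sol s x) has_real_derivative deriv (sol t) x + deriv (deriv (sol t)) x) (at t)"
      using sol_DERIV_time[of t x] tx by (simp add: d dd)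
  qed (use lim pos odd flow_0 in \<open>auto simp: sol_initial sol_nonneg W0_0\<close>)
qed

end

text \<open>The Sobolev constant 2 turns \<open>1 / 8\<close> into \<open>1 / 4\<close> for both
  \<open>u\<close> and its slope. With \<open>u 0 = 0\<close> the slope bound gives
  \<open>x / 4\<close>, and the smaller of the two bounds lies below \<open>W0 x / 2\<close>, even
  near the origin where \<open>W0\<close> vanishes.\<close>

lemma H2_norm_small_imp_below_W0:
  assumes u: "H2 u" and u0: "u 0 = 0" and small: "H2_norm u < 1 / 8" and x: "0 \<le> x"
  shows "\<bar>u x\<bar> \<le> W0 x / 2"
proof -
  have 1: "\<bar>u x\<bar> \<le> 1 / 4" using H2_sup_bound(1)[OF u, of x] small by simp
  have 2: "\<bar>u x\<bar> \<le> x / 4"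
  proof (cases "x = 0")
    case False
    then obtain y where y: "0 < y" "y < x" "u x - u 0 = (x - 0) * deriv u y"
      using MVT2[of 0 x u "deriv u"] H2_DERIV[OF u] x by auto
    have "\<bar>u x\<bar> = x * \<bar>deriv u y\<bar>" using y(3) u0 x by (simp add: abs_mult)
    also have "\<dots> \<le> x * (1 / 4)" using H2_sup_bound(2)[OF u, of y] small x by (intro mult_left_mono) auto
    finally show ?thesis by simp
  qed (simp add: u0)
  show ?thesis using 1 2 W0_lower_bound[OF x] by (simp add: min_def split: if_splits)
qed

text \<open>The weak second derivative is only Lebesgue measurable; a Borel function equal to it
  almost everywhere is still an integrand for \<open>deriv u\<close> and leaves the norm
  unchanged.\<close>

lemma H2_odd_perturbation:
  assumes u: "H2 u" and odd: "\<And>x. u (- x) = - u x"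
  obtains u2 where "odd_perturbation u (deriv u) u2" "sqrt (odd_perturbation.energy u (deriv u) u2) = H2_norm u"
proof -
  have ad: "antiderivative (deriv u) (weak_d2 u)" by (rule H2_antiderivative[OF u])
  obtain u2 where u2[measurable]: "u2 \<in> borel_measurable lborel" and "AE x in lborel. weak_d2 u x = u2 x"
    using completion_ex_borel_measurable_real[OF antiderivative_measurable[OF ad]] by blast
  then have ae: "AE x in lebesgue. weak_d2 u x = u2 x" by (intro AE_completion)
  have ad2: "antiderivative (deriv u) u2" by (rule antiderivative_cong_AE[OF ad ae])
  have [measurable]: "u \<in> borel_measurable borel" "deriv u \<in> borel_measurable borel"
    using antiderivative_continuous[OF ad] antiderivative_continuous[OF antiderivative_of_derivative[OF H2_DERIV[OF u]]]
    by (auto intro: borel_measurable_continuous_onI)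
  have ae2: "AE x in lebesgue. (weak_d2 u x)\<^sup>2 = (u2 x)\<^sup>2" using ae by eventually_elim simp
  have m: "(\<lambda>x. (weak_d2 u x)\<^sup>2) \<in> borel_measurable lebesgue" "(\<lambda>x. (u2 x)\<^sup>2) \<in> borel_measurable lebesgue"
    using antiderivative_measurable[OF ad] antiderivative_measurable[OF ad2] by measurable
  have i: "integrable lebesgue (\<lambda>x. (u x)\<^sup>2)" "integrable lebesgue (\<lambda>x. (deriv u x)\<^sup>2)" "integrable lebesgue (\<lambda>x. (u2 x)\<^sup>2)"
    using u integrable_cong_AE[OF m ae2] by (auto simp: H2_def)
  interpret odd_perturbation u "deriv u" u2
  proof
    show "(u has_real_derivative deriv u x) (at x)" for x by (rule H2_DERIV[OF u])
  qed (use ad2 u2 i odd in \<open>auto simp: integrable_completion\<close>)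
  have "(LINT x|lebesgue. (weak_d2 u x)\<^sup>2) = (LINT x|lborel. (u2 x)\<^sup>2)"
    using integral_cong_AE[OF m ae2] by (simp add: integral_completion)
  then have "sqrt energy = H2_norm u" by (simp add: energy_def H2_norm_def integral_completion)
  with odd_perturbation_axioms show ?thesis by (rule that)
qed

theorem theorem2p1:
  fixes \<epsilon> :: real
  assumes "\<epsilon> > 0"
  shows "\<exists>\<delta>>0. \<forall>w0 :: real \<Rightarrow> real.
           (\<forall>x. w0 (- x) = - w0 x) \<and> H2 (\<lambda>x. w0 x - W0 x) \<and> H2_norm (\<lambda>x. w0 x - W0 x) < \<delta>
           \<longrightarrow> (\<exists>w. odd_mburgers_sol w w0 \<and> in_class w
                  \<and> (\<forall>t>0. H2_norm (\<lambda>x. w t x - W0 x) < \<epsilon>)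
                  \<and> ((\<lambda>t. W2inf_norm (\<lambda>x. w t x - W0 x)) \<longlongrightarrow> 0) at_top
                  \<and> (\<forall>v. odd_mburgers_sol v w0 \<and> in_class v \<longrightarrow> (\<forall>t\<ge>0. \<forall>x. v t x = w t x)))"
proof (intro exI[of _ "min (1 / 8) (\<epsilon> / 8)"] conjI allI impI)
  \<comment> \<open>\<open>1 / 8\<close> secures positivity through the comparison with
    \<open>W0 / 2\<close>; \<open>\<epsilon> / 8\<close> offsets the factor 8 of
    \<open>sol_H2_norm_le\<close>.\<close>
  show "min (1 / 8) (\<epsilon> / 8) > 0" using assms by simp
  fix w0 :: "real \<Rightarrow> real"
  assume "(\<forall>x. w0 (- x) = - w0 x) \<and> H2 (\<lambda>x. w0 x - W0 x) \<and> H2_norm (\<lambda>x. w0 x - W0 x) < min (1 / 8) (\<epsilon> / 8)"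
  then have odd: "\<And>x. w0 (- x) = - w0 x" and u: "H2 (\<lambda>x. w0 x - W0 x)"
    and small: "H2_norm (\<lambda>x. w0 x - W0 x) < 1 / 8" "H2_norm (\<lambda>x. w0 x - W0 x) < \<epsilon> / 8" by auto
  define u where "u = (\<lambda>x. w0 x - W0 x)"
  have w0: "w0 = (\<lambda>x. W0 x + u x)" by (simp add: u_def)
  have u_odd: "\<And>x. u (- x) = - u x" by (simp add: u_def odd W0_odd)
  then have u_0: "u 0 = 0" by (metis add.inverse_neutral neg_equal_zero)
  obtain u2 where "odd_perturbation u (deriv u) u2" and energy: "sqrt (odd_perturbation.energy u (deriv u) u2) = H2_norm u"
    using H2_odd_perturbation[of u] u u_odd by (auto simp: u_def[symmetric])
  then interpret odd_perturbation u "deriv u" u2 by simp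
  have "odd_mburgers_sol sol w0"
    unfolding w0 using H2_norm_small_imp_below_W0[of u] u small(1) u_0
    by (intro sol_odd_mburgers) (auto simp: u_def[symmetric])
  moreover have "H2_norm (\<lambda>x. sol t x - W0 x) < \<epsilon>" if "t > 0" for t
    using sol_H2_norm_le[of t] that small(2) energy by (simp add: u_def[symmetric])
  ultimately show "\<exists>w. odd_mburgers_sol w w0 \<and> in_class w
                  \<and> (\<forall>t>0. H2_norm (\<lambda>x. w t x - W0 x) < \<epsilon>)
                  \<and> ((\<lambda>t. W2inf_norm (\<lambda>x. w t x - W0 x)) \<longlongrightarrow> 0) at_top
                  \<and> (\<forall>v. odd_mburgers_sol v w0 \<and> in_class v \<longrightarrow> (\<forall>t\<ge>0. \<forall>x. v t x = w t x))"
    using sol_in_class sol_W2inf odd_mburgers_sol_unique by blast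
qed

end
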